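(* Let $(E,\rho_E,[\cdot,\cdot]_E,J_E)$ be an almost complex Lie algebroid over a smooth manifold $M$. The following assertions are equivalent: (i) if $s_1,s_2\in\Gamma(E^{1,0})$ then $[s_1,s_2]_E\in\Gamma(E^{1,0})$; (ii) if $s_1,s_2\in\Gamma(E^{0,1})$ then $[s_1,s_2]_E\in\Gamma(E^{0,1})$; (iii) $d_E\Omega^{1,0}(E)\subset\Omega^{2,0}(E)+\Omega^{1,1}(E)$ and $d_E\Omega^{0,1}(E)\subset\Omega^{1,1}(E)+\Omega^{0,2}(E)$; (iv) $d_E\Omega^{p,q}(E)\subset\Omega^{p+1,q}(E)+\Omega^{p,q+1}(E)$ for all $p,q$; (v) the real Nijenhuis tensor $N_{J_E}$ vanishes, that is, $J_E$ is integrable.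
   Context: A Lie algebroid $(E,\rho_E,[\cdot,\cdot]_E)$ over a smooth manifold $M$ is a real vector bundle $E\to M$ with a vector bundle morphism $\rho_E:E\to TM$ (the anchor) and a real Lie algebra bracket $[\cdot,\cdot]_E$ on $\Gamma(E)$ such that $\rho_E([s_1,s_2]_E)=[\rho_E(s_1),\rho_E(s_2)]$ and $[s_1,fs_2]_E=f[s_1,s_2]_E+\rho_E(s_1)(f)s_2$ for all $s_1,s_2\in\Gamma(E)$, $f\in C^\infty(M)$. An almost complex Lie algebroid $(E,\rho_E,[\cdot,\cdot]_E,J_E)$ is a Lie algebroid with $\mathrm{rank}\,E=2m$ endowed with a vector bundle endomorphism $J_E$ of $E$ over the identity of $M$ with $J_E^2=-\mathrm{id}$ ($M$ itself need not be almost complex). The Nijenhuis tensor is $$N_{J_E}(s_1,s_2)=[J_Es_1,J_Es_2]_E-J_E[s_1,J_Es_2]_E-J_E[J_Es_1,s_2]_E-[s_1,s_2]_E,\quad s_1,s_2\in\Gamma(E),$$ and $J_E$ is integrable if $N_{J_E}=0$. Let $E_{\mathbb C}=E\otimes_{\mathbb R}\mathbb C$; the anchor (with values in $TM\otimes_{\mathbb R}\mathbb C$), the bracket and $J_E$ are extended $\mathbb C$-linearly. $E^{1,0}$ and $E^{0,1}$ are the eigenbundles of $J_E$ on $E_{\mathbb C}$ for the eigenvalues $i$ and $-i$, so $E_{\mathbb C}=E^{1,0}\oplus E^{0,1}$. Put $\Omega^{p,q}(E)=\Gamma\left(\bigwedge^p(E^{1,0})^*\otimes\bigwedge^q(E^{0,1})^*\right)$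 (complex-valued forms of type $(p,q)$ on $E$; zero if $p$ or $q$ is negative). The differential $d_E$ on (complex-valued) $r$-forms on $E$ is $$d_E\omega(s_0,\ldots,s_r)=\sum_{i=0}^r(-1)^i\rho_E(s_i)\big(\omega(s_0,\ldots,\widehat{s_i},\ldots,s_r)\big)+\sum_{i<j}(-1)^{i+j}\omega([s_i,s_j]_E,s_0,\ldots,\widehat{s_i},\ldots,\widehat{s_j},\ldots,s_r).$$ *)

theory Defs
  imports "HOL-Analysis.Analysis"
begin

text \<open>\<open>C_on\<close>, \<open>smooth_on\<close> and \<open>msmooth_on\<close> are meant for open sets and finite-dimensional domains; there
  \<open>C_on n S f\<close> says that \<open>f\<close> is of class \<open>C^n\<close> on \<open>S\<close>.\<close>

primrec C_on :: "nat \<Rightarrow> 'k::real_normed_vector set \<Rightarrow> ('k \<Rightarrow> 'b::real_normed_vector) \<Rightarrow> bool" where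
  "C_on 0 S f \<longleftrightarrow> continuous_on S f"
| "C_on (Suc n) S f \<longleftrightarrow> (\<forall>x\<in>S. f differentiable (at x)) \<and>
     (\<forall>v. C_on n S (\<lambda>x. frechet_derivative f (at x) v))"

definition smooth_on :: "'k::real_normed_vector set \<Rightarrow> ('k \<Rightarrow> 'b::real_normed_vector) \<Rightarrow> bool" where
  "smooth_on S f \<longleftrightarrow> (\<forall>n. C_on n S f)"

type_synonym ('m, 'k) chart = "'m set \<times> ('m \<Rightarrow> 'k)"

text \<open>A smooth manifold is a Hausdorff, second countable space \<open>'m\<close> with a smooth atlas. The atlas
  need not be maximal. The charts take values in a finite-dimensional real vector space \<open>'k\<close>;
  class \<^class>\<open>euclidean_space\<close> is not used for \<open>'k\<close> because it excludes dimension 0 (and with it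
  the Lie algebroids over a point).\<close>

definition smooth_manifold ::
    "('m::{t2_space,second_countable_topology}, 'k::real_inner) chart set \<Rightarrow> bool" where
  "smooth_manifold K \<longleftrightarrow>
     (\<exists>B::'k set. finite B \<and> span B = UNIV) \<and>
     (\<Union>(U, \<phi>)\<in>K. U) = UNIV \<and>
     (\<forall>(U, \<phi>)\<in>K. open U \<and> open (\<phi> ` U) \<and> homeomorphism U (\<phi> ` U) \<phi> (inv_into U \<phi>)) \<and>
     (\<forall>(U, \<phi>)\<in>K. \<forall>(V, \<psi>)\<in>K. smooth_on (\<phi> ` (U \<inter> V)) (\<psi> \<circ> inv_into U \<phi>))"

definition msmooth_on ::
    "('m, 'k::real_inner) chart set \<Rightarrow> 'm set \<Rightarrow> ('m \<Rightarrow> 'b::real_normed_vector) \<Rightarrow> bool" where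
  "msmooth_on K W f \<longleftrightarrow> (\<forall>(U, \<phi>)\<in>K. smooth_on (\<phi> ` (U \<inter> W)) (f \<circ> inv_into U \<phi>))"

definition smooth_functions :: "('m, 'k::real_inner) chart set \<Rightarrow> ('m \<Rightarrow> real) set" where
  "smooth_functions K = {f. msmooth_on K UNIV f}"

text \<open>Tangent vectors at \<open>x\<close> are the derivations of \<open>C^\<infinity>(M)\<close> at \<open>x\<close>, set to 0 on functions that are
  not smooth.\<close>

definition tangent_space ::
    "('m, 'k::real_inner) chart set \<Rightarrow> 'm \<Rightarrow> (('m \<Rightarrow> real) \<Rightarrow> real) set" where
  "tangent_space K x = {D.
     (\<forall>f. f \<notin> smooth_functions K \<longrightarrow> D f = 0) \<and>
     (\<forall>f\<in>smooth_functions K. \<forall>g\<in>smooth_functions K. \<forall>a b.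
        D (\<lambda>y. a * f y + b * g y) = a * D f + b * D g) \<and>
     (\<forall>f\<in>smooth_functions K. \<forall>g\<in>smooth_functions K.
        D (\<lambda>y. f y * g y) = D f * g x + f x * D g)}"

text \<open>The tangent vector at \<open>x\<close> with coordinates \<open>c\<close> in a chart. The maps
  \<open>(x, c) \<mapsto> coord_vector K (U, \<phi>) x c\<close> are the local trivialisations defining the smooth structure
  of the tangent bundle.\<close>

definition coord_vector ::
    "('m, 'k::real_inner) chart set \<Rightarrow> ('m, 'k) chart \<Rightarrow> 'm \<Rightarrow> 'k \<Rightarrow> ('m \<Rightarrow> real) \<Rightarrow> real" where
  "coord_vector K ch x c = (\<lambda>f. if f \<in> smooth_functions K
     then frechet_derivative (f \<circ> inv_into (fst ch) (snd ch)) (at (snd ch x)) c else 0)"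

text \<open>The fibre over \<open>x\<close> is a linear subspace \<open>fibre A x\<close> of an auxiliary real vector space \<open>'v\<close>
  without topology (this is no restriction: the fibres of any bundle can be embedded linearly,
  one by one, in a common space). The smooth structure of the total space is given by local
  trivialisations \<open>U \<times> \<real>^n \<rightarrow> E\<close> over open sets \<open>U\<close>, \<open>(x, c) \<mapsto> \<Sum>i<n. c i *\<^sub>R e i x\<close>, written as local
  frames \<open>(U, e)\<close>, whose transition matrices are smooth.\<close>

record ('m, 'k, 'v) vector_bundle =
  charts :: "('m, 'k) chart set"
  fibre :: "'m \<Rightarrow> 'v set"
  bundle_rank :: nat
  frames :: "('m set \<times> (nat \<Rightarrow> 'm \<Rightarrow> 'v)) set"

definition vector_bundle ::
    "('m::{t2_space,second_countable_topology}, 'k::real_inner, 'v::real_vector, 'z)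
       vector_bundle_scheme \<Rightarrow> bool" where
  "vector_bundle A \<longleftrightarrow>
     smooth_manifold (charts A) \<and>
     (\<forall>x. subspace (fibre A x)) \<and>
     (\<Union>(U, e)\<in>frames A. U) = UNIV \<and>
     (\<forall>(U, e)\<in>frames A. open U \<and>
        (\<forall>x\<in>U. inj_on (\<lambda>i. e i x) {..<bundle_rank A} \<and>
                independent ((\<lambda>i. e i x) ` {..<bundle_rank A}) \<and>
                span ((\<lambda>i. e i x) ` {..<bundle_rank A}) = fibre A x)) \<and>
     (\<forall>(U, e)\<in>frames A. \<forall>(V, e')\<in>frames A. \<exists>g.
        (\<forall>i<bundle_rank A. \<forall>j<bundle_rank A.
           msmooth_on (charts A) (U \<inter> V) (g i j :: 'm \<Rightarrow> real)) \<and>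
        (\<forall>j<bundle_rank A. \<forall>x\<in>U \<inter> V. e' j x = (\<Sum>i<bundle_rank A. g i j x *\<^sub>R e i x)))"

definition sections ::
    "('m, 'k::real_inner, 'v::real_vector, 'z) vector_bundle_scheme \<Rightarrow> ('m \<Rightarrow> 'v) set" where
  "sections A = {s. (\<forall>x. s x \<in> fibre A x) \<and>
     (\<forall>(U, e)\<in>frames A. \<exists>c.
        (\<forall>i<bundle_rank A. msmooth_on (charts A) U (c i :: 'm \<Rightarrow> real)) \<and>
        (\<forall>x\<in>U. s x = (\<Sum>i<bundle_rank A. c i x *\<^sub>R e i x)))}"

definition bundle_endomorphism ::
    "('m, 'k::real_inner, 'v::real_vector, 'z) vector_bundle_scheme \<Rightarrow> ('m \<Rightarrow> 'v \<Rightarrow> 'v) \<Rightarrow> bool" where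
  "bundle_endomorphism A T \<longleftrightarrow>
     (\<forall>x. \<forall>u\<in>fibre A x. T x u \<in> fibre A x) \<and>
     (\<forall>x. \<forall>u\<in>fibre A x. \<forall>v\<in>fibre A x. \<forall>a b.
        T x (a *\<^sub>R u + b *\<^sub>R v) = a *\<^sub>R T x u + b *\<^sub>R T x v) \<and>
     (\<forall>(U, e)\<in>frames A. \<exists>t.
        (\<forall>i<bundle_rank A. \<forall>j<bundle_rank A. msmooth_on (charts A) U (t i j :: 'm \<Rightarrow> real)) \<and>
        (\<forall>j<bundle_rank A. \<forall>x\<in>U. T x (e j x) = (\<Sum>i<bundle_rank A. t i j x *\<^sub>R e i x)))"

text \<open>Bundle morphisms to the tangent bundle over the identity: fibrewise linear, and smooth with
  respect to the frames of the bundle and the chart trivialisations of the tangent bundle.\<close>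

definition morphism_to_tangent ::
    "('m, 'k::real_inner, 'v::real_vector, 'z) vector_bundle_scheme \<Rightarrow>
     ('m \<Rightarrow> 'v \<Rightarrow> ('m \<Rightarrow> real) \<Rightarrow> real) \<Rightarrow> bool" where
  "morphism_to_tangent A \<rho> \<longleftrightarrow>
     (\<forall>x. \<forall>u\<in>fibre A x. \<rho> x u \<in> tangent_space (charts A) x) \<and>
     (\<forall>x. \<forall>u\<in>fibre A x. \<forall>v\<in>fibre A x. \<forall>a b.
        \<rho> x (a *\<^sub>R u + b *\<^sub>R v) = (\<lambda>f. a * \<rho> x u f + b * \<rho> x v f)) \<and>
     (\<forall>(U, e)\<in>frames A. \<forall>(V, \<phi>)\<in>charts A. \<exists>r.
        (\<forall>j<bundle_rank A. msmooth_on (charts A) (U \<inter> V) (r j :: 'm \<Rightarrow> 'k)) \<and>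
        (\<forall>j<bundle_rank A. \<forall>x\<in>U \<inter> V. \<rho> x (e j x) = coord_vector (charts A) (V, \<phi>) x (r j x)))"

record ('m, 'k, 'v) lie_algebroid = "('m, 'k, 'v) vector_bundle" +
  anchor :: "'m \<Rightarrow> 'v \<Rightarrow> ('m \<Rightarrow> real) \<Rightarrow> real"
  bracket :: "('m \<Rightarrow> 'v) \<Rightarrow> ('m \<Rightarrow> 'v) \<Rightarrow> 'm \<Rightarrow> 'v"

definition lie_algebroid ::
    "('m::{t2_space,second_countable_topology}, 'k::real_inner, 'v::real_vector, 'z)
       lie_algebroid_scheme \<Rightarrow> bool" where
  "lie_algebroid A \<longleftrightarrow>
     vector_bundle A \<and>
     morphism_to_tangent A (anchor A) \<and>
     (\<forall>s\<in>sections A. \<forall>t\<in>sections A. bracket A s t \<in> sections A) \<and>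
     (\<forall>s\<in>sections A. \<forall>t\<in>sections A. \<forall>u\<in>sections A. \<forall>a b.
        bracket A (\<lambda>x. a *\<^sub>R s x + b *\<^sub>R t x) u = (\<lambda>x. a *\<^sub>R bracket A s u x + b *\<^sub>R bracket A t u x) \<and>
        bracket A u (\<lambda>x. a *\<^sub>R s x + b *\<^sub>R t x) = (\<lambda>x. a *\<^sub>R bracket A u s x + b *\<^sub>R bracket A u t x)) \<and>
     (\<forall>s\<in>sections A. bracket A s s = (\<lambda>x. 0)) \<and>
     (\<forall>s\<in>sections A. \<forall>t\<in>sections A. \<forall>u\<in>sections A. \<forall>x.
        bracket A s (bracket A t u) x + bracket A t (bracket A u s) x
          + bracket A u (bracket A s t) x = 0) \<and>
     (\<forall>s\<in>sections A. \<forall>t\<in>sections A. \<forall>f\<in>smooth_functions (charts A). \<forall>x.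
        anchor A x (bracket A s t x) f =
          anchor A x (s x) (\<lambda>y. anchor A y (t y) f) - anchor A x (t x) (\<lambda>y. anchor A y (s y) f)) \<and>
     (\<forall>s\<in>sections A. \<forall>t\<in>sections A. \<forall>f\<in>smooth_functions (charts A).
        bracket A s (\<lambda>x. f x *\<^sub>R t x) = (\<lambda>x. f x *\<^sub>R bracket A s t x + anchor A x (s x) f *\<^sub>R t x))"

record ('m, 'k, 'v) almost_complex_lie_algebroid = "('m, 'k, 'v) lie_algebroid" +
  cplx_str :: "'m \<Rightarrow> 'v \<Rightarrow> 'v"

definition almost_complex_lie_algebroid ::
    "('m::{t2_space,second_countable_topology}, 'k::real_inner, 'v::real_vector, 'z)
       almost_complex_lie_algebroid_scheme \<Rightarrow> bool" where
  "almost_complex_lie_algebroid A \<longleftrightarrow>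
     lie_algebroid A \<and>
     (\<exists>m. bundle_rank A = 2 * m) \<and>
     bundle_endomorphism A (cplx_str A) \<and>
     (\<forall>x. \<forall>u\<in>fibre A x. cplx_str A x (cplx_str A x u) = - u)"

definition apply_J ::
    "('m, 'k, 'v, 'z) almost_complex_lie_algebroid_scheme \<Rightarrow> ('m \<Rightarrow> 'v) \<Rightarrow> 'm \<Rightarrow> 'v" where
  "apply_J A s = (\<lambda>x. cplx_str A x (s x))"

definition nijenhuis ::
    "('m, 'k, 'v::real_vector, 'z) almost_complex_lie_algebroid_scheme \<Rightarrow>
     ('m \<Rightarrow> 'v) \<Rightarrow> ('m \<Rightarrow> 'v) \<Rightarrow> 'm \<Rightarrow> 'v" where
  "nijenhuis A s t = (\<lambda>x.
     bracket A (apply_J A s) (apply_J A t) x - apply_J A (bracket A s (apply_J A t)) x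
       - apply_J A (bracket A (apply_J A s) t) x - bracket A s t x)"

text \<open>The pair \<open>(u, v)\<close> stands for \<open>u \<otimes> 1 + v \<otimes> \<i>\<close>.\<close>

definition scaleI :: "complex \<Rightarrow> 'v::real_vector \<times> 'v \<Rightarrow> 'v \<times> 'v" where
  "scaleI c w = (Re c *\<^sub>R fst w - Im c *\<^sub>R snd w, Re c *\<^sub>R snd w + Im c *\<^sub>R fst w)"

definition fibreC :: "('m, 'k, 'v, 'z) vector_bundle_scheme \<Rightarrow> 'm \<Rightarrow> ('v \<times> 'v) set" where
  "fibreC A x = fibre A x \<times> fibre A x"

definition sectionsC ::
    "('m, 'k::real_inner, 'v::real_vector, 'z) vector_bundle_scheme \<Rightarrow> ('m \<Rightarrow> 'v \<times> 'v) set" where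
  "sectionsC A = {s. (\<lambda>x. fst (s x)) \<in> sections A \<and> (\<lambda>x. snd (s x)) \<in> sections A}"

text \<open>\<open>C\<close>-linear extensions of the anchor, the bracket and the almost complex structure. The complex
  tangent vector \<open>\<rho>(u) + \<i> \<rho>(v)\<close> acts on complex-valued functions.\<close>

definition anchorC ::
    "('m, 'k, 'v, 'z) lie_algebroid_scheme \<Rightarrow> 'm \<Rightarrow> 'v \<times> 'v \<Rightarrow> ('m \<Rightarrow> complex) \<Rightarrow> complex" where
  "anchorC A x w f =
     Complex (anchor A x (fst w) (\<lambda>y. Re (f y)) - anchor A x (snd w) (\<lambda>y. Im (f y)))
             (anchor A x (fst w) (\<lambda>y. Im (f y)) + anchor A x (snd w) (\<lambda>y. Re (f y)))"

definition bracketC ::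
    "('m, 'k, 'v::real_vector, 'z) lie_algebroid_scheme \<Rightarrow>
     ('m \<Rightarrow> 'v \<times> 'v) \<Rightarrow> ('m \<Rightarrow> 'v \<times> 'v) \<Rightarrow> 'm \<Rightarrow> 'v \<times> 'v" where
  "bracketC A s t = (\<lambda>x.
     (bracket A (fst \<circ> s) (fst \<circ> t) x - bracket A (snd \<circ> s) (snd \<circ> t) x,
      bracket A (fst \<circ> s) (snd \<circ> t) x + bracket A (snd \<circ> s) (fst \<circ> t) x))"

definition JC ::
    "('m, 'k, 'v, 'z) almost_complex_lie_algebroid_scheme \<Rightarrow> 'm \<Rightarrow> 'v \<times> 'v \<Rightarrow> 'v \<times> 'v" where
  "JC A x w = (cplx_str A x (fst w), cplx_str A x (snd w))"

definition E10 ::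
    "('m, 'k, 'v::real_vector, 'z) almost_complex_lie_algebroid_scheme \<Rightarrow> 'm \<Rightarrow> ('v \<times> 'v) set" where
  "E10 A x = {w \<in> fibreC A x. JC A x w = scaleI \<i> w}"

definition E01 ::
    "('m, 'k, 'v::real_vector, 'z) almost_complex_lie_algebroid_scheme \<Rightarrow> 'm \<Rightarrow> ('v \<times> 'v) set" where
  "E01 A x = {w \<in> fibreC A x. JC A x w = scaleI (- \<i>) w}"

definition sections10 ::
    "('m, 'k::real_inner, 'v::real_vector, 'z) almost_complex_lie_algebroid_scheme \<Rightarrow>
     ('m \<Rightarrow> 'v \<times> 'v) set" where
  "sections10 A = {s \<in> sectionsC A. \<forall>x. s x \<in> E10 A x}"

definition sections01 ::
    "('m, 'k::real_inner, 'v::real_vector, 'z) almost_complex_lie_algebroid_scheme \<Rightarrow>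
     ('m \<Rightarrow> 'v \<times> 'v) set" where
  "sections01 A = {s \<in> sectionsC A. \<forall>x. s x \<in> E01 A x}"

text \<open>A complex-valued \<open>r\<close>-form assigns to \<open>x\<close> a complex-multilinear alternating function of \<open>r\<close>
  arguments, given as a list, in the complexified fibre over \<open>x\<close>; its values at other lists are
  irrelevant. It is smooth if its components in the frames \<open>e i \<otimes> 1\<close> of the complexification are.\<close>

type_synonym ('m, 'v) form = "'m \<Rightarrow> ('v \<times> 'v) list \<Rightarrow> complex"

definition forms ::
    "('m, 'k::real_inner, 'v::real_vector, 'z) vector_bundle_scheme \<Rightarrow> nat \<Rightarrow> ('m, 'v) form set" where
  "forms A r = {\<omega>.
     (\<forall>x ws. length ws = r \<and> set ws \<subseteq> fibreC A x \<longrightarrow>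
        (\<forall>i<r. \<forall>u\<in>fibreC A x. \<forall>v\<in>fibreC A x. \<forall>a b.
           \<omega> x (ws[i := scaleI a u + scaleI b v]) = a * \<omega> x (ws[i := u]) + b * \<omega> x (ws[i := v])) \<and>
        (\<forall>j<r. \<forall>i<j. ws ! i = ws ! j \<longrightarrow> \<omega> x ws = 0)) \<and>
     (\<forall>(U, e)\<in>frames A. \<forall>is. length is = r \<and> set is \<subseteq> {..<bundle_rank A} \<longrightarrow>
        msmooth_on (charts A) U (\<lambda>x. \<omega> x (map (\<lambda>i. (e i x, 0)) is)))}"

text \<open>Forms of type \<open>(p, q)\<close>: the summand \<open>\<And>\<^sup>p (E10)\<^sup>* \<otimes> \<And>\<^sup>q (E01)\<^sup>*\<close> of the \<open>(p + q)\<close>-forms consists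
  of the forms that vanish on arguments taken from \<open>E10\<close> and \<open>E01\<close> unless \<open>p\<close> of them are from \<open>E10\<close>
  and \<open>q\<close> from \<open>E01\<close>.\<close>

definition Omega ::
    "('m, 'k::real_inner, 'v::real_vector, 'z) almost_complex_lie_algebroid_scheme \<Rightarrow>
     nat \<Rightarrow> nat \<Rightarrow> ('m, 'v) form set" where
  "Omega A p q = {\<omega> \<in> forms A (p + q).
     \<forall>x ws. length ws = p + q \<and> set ws \<subseteq> E10 A x \<union> E01 A x \<and>
            length (filter (\<lambda>w. w \<in> E10 A x) ws) \<noteq> p \<longrightarrow> \<omega> x ws = 0}"

definition form_sum :: "('m, 'v) form set \<Rightarrow> ('m, 'v) form set \<Rightarrow> ('m, 'v) form set" where
  "form_sum V W = {\<lambda>x ws. \<alpha> x ws + \<beta> x ws | \<alpha> \<beta>. \<alpha> \<in> V \<and> \<beta> \<in> W}"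

definition form_eval :: "('m, 'v) form \<Rightarrow> ('m \<Rightarrow> 'v \<times> 'v) list \<Rightarrow> 'm \<Rightarrow> complex" where
  "form_eval \<omega> ss = (\<lambda>x. \<omega> x (map (\<lambda>s. s x) ss))"

definition omit :: "nat \<Rightarrow> 'a list \<Rightarrow> 'a list" where
  "omit i xs = take i xs @ drop (Suc i) xs"

text \<open>The function \<open>d\<^sub>E \<omega>(s\<^sub>0, \<dots>, s\<^sub>r)\<close> for a list \<open>ss\<close> of \<open>r + 1\<close> sections.\<close>

definition dE ::
    "('m, 'k, 'v::real_vector, 'z) lie_algebroid_scheme \<Rightarrow> ('m, 'v) form \<Rightarrow>
     ('m \<Rightarrow> 'v \<times> 'v) list \<Rightarrow> 'm \<Rightarrow> complex" where
  "dE A \<omega> ss = (\<lambda>x.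
     (\<Sum>i<length ss. (- 1) ^ i * anchorC A x ((ss ! i) x) (form_eval \<omega> (omit i ss)))
     + (\<Sum>j<length ss. \<Sum>i<j. (- 1) ^ (i + j) *
          form_eval \<omega> (bracketC A (ss ! i) (ss ! j) # omit i (omit j ss)) x))"

text \<open>For an \<open>r\<close>-form \<open>\<omega>\<close>, the form \<open>d\<^sub>E \<omega>\<close> belongs to the set \<open>W\<close> of \<open>(r + 1)\<close>-forms; forms are
  identified by their values on sections.\<close>

definition dE_in ::
    "('m, 'k::real_inner, 'v::real_vector, 'z) lie_algebroid_scheme \<Rightarrow> nat \<Rightarrow>
     ('m, 'v) form \<Rightarrow> ('m, 'v) form set \<Rightarrow> bool" where
  "dE_in A r \<omega> W \<longleftrightarrow> (\<exists>\<eta>\<in>W. \<forall>ss. length ss = Suc r \<and> set ss \<subseteq> sectionsC A \<longrightarrow>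
     dE A \<omega> ss = form_eval \<eta> ss)"

end

theory Submission
  imports Defs "HOL-Library.Function_Algebras"
begin

text \<open>
  Conjugation exchanges \<open>E\<^bsup>1,0\<^esup>\<close> and \<open>E\<^bsup>0,1\<^esup>\<close> and commutes with the bracket, so (i) and (ii) are equivalent
  (\<open>closed_type_conj\<close>). The sections of \<open>E\<^bsup>1,0\<^esup>\<close> are the sections \<open>s - \<i> J s\<close> with \<open>s\<close> real, and expanding the bracket of two
  of them shows that it lies in \<open>E\<^bsup>1,0\<^esup>\<close> if and only if the Nijenhuis tensor vanishes on the real sections, which is the
  equivalence of (i) and (v) (\<open>bracket10_iff\<close>).

  If (i) and (ii) hold and \<open>\<omega>\<close> has type \<open>(p, q)\<close>, then in the formula for \<open>d \<omega>\<close> on sections of pure type every summand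
  vanishes unless \<open>p\<close> or \<open>p + 1\<close> of the sections are of type \<open>(1, 0)\<close> (\<open>dE_vanish\<close>). This gives (iv)
  (\<open>dE_in_form_sum\<close>), of which (iii) is a special case. Conversely, if \<open>\<omega>\<close> has type \<open>(0, 1)\<close> and \<open>s\<close>, \<open>t\<close> have type \<open>(1, 0)\<close>,
  then \<open>d \<omega> (s, t) = - \<omega> ([s, t])\<close>; if \<open>d \<omega>\<close> has no component of type \<open>(2, 0)\<close>, then \<open>[s, t]\<close> is annihilated by all forms
  of type \<open>(0, 1)\<close> and hence has type \<open>(1, 0)\<close> (\<open>closed10_if_dE\<close>, \<open>E10_if_Omega01_vanish\<close>).

  The membership of \<open>d \<omega>\<close> in a sum of spaces of forms includes that \<open>d \<omega>\<close> is given by smooth forms on the fibres. This rests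
  on two facts: the differential of an alternating map is alternating and multilinear over the functions
  (\<open>d_alternating\<close>, proved in an abstract Lie--Rinehart setting with Cartan's formula), and alternating maps on
  sections that are multilinear over the functions are forms (\<open>alternating_is_form\<close>). The latter, as well as the
  existence of enough forms and sections, uses smooth bump functions on \<open>M\<close> (\<open>exists_bump\<close>).
\<close>

section \<open>Smooth functions on open subsets of a normed space\<close>

lemma frechet_derivative_eqI: "(f has_derivative f') (at x) \<Longrightarrow> frechet_derivative f (at x) = f'"
  using frechet_derivative_at by metis

lemma C_on_Suc_E: "C_on (Suc n) S f \<Longrightarrow> C_on n S f"
proof (induction n arbitrary: f)
  case 0
  then show ?case
    by (simp add: continuous_at_imp_continuous_on differentiable_imp_continuous_within)
next
  case (Suc n)
  have "f differentiable (at x)" if "x \<in> S" for x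
    using Suc.prems that by (subst (asm) C_on.simps) simp
  moreover have "C_on n S (\<lambda>x. frechet_derivative f (at x) v)" for v
    using Suc.prems by (intro Suc.IH) (subst (asm) C_on.simps, simp)
  ultimately show ?case by simp
qed

lemma C_on_has_derivative:
  "C_on (Suc n) S f \<Longrightarrow> x \<in> S \<Longrightarrow> (f has_derivative frechet_derivative f (at x)) (at x)"
  using frechet_derivative_works by auto

lemma C_on_subset: "C_on n S f \<Longrightarrow> T \<subseteq> S \<Longrightarrow> C_on n T f"
proof (induction n arbitrary: f)
  case 0
  then show ?case using continuous_on_subset by auto
next
  case (Suc n)
  then show ?case using Suc.IH by (simp add: subset_iff)
qed

lemma C_on_cong:
  assumes "C_on n S f" "open S" "\<And>x. x \<in> S \<Longrightarrow> f x = g x"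
  shows "C_on n S g"
  using assms(1,3)
proof (induction n arbitrary: f g)
  case 0
  then show ?case
    using continuous_on_eq[of S f g] by simp
next
  case (Suc n)
  have D: "(g has_derivative frechet_derivative f (at x)) (at x)" if "x \<in> S" for x
    by (rule has_derivative_transform_within_open[OF C_on_has_derivative[OF Suc.prems(1) that] assms(2) that])
      (rule Suc.prems(2))
  have "C_on n S (\<lambda>x. frechet_derivative g (at x) v)" for v
  proof (rule Suc.IH)
    show "C_on n S (\<lambda>x. frechet_derivative f (at x) v)"
      using Suc.prems(1) by simp
    show "frechet_derivative f (at x) v = frechet_derivative g (at x) v" if "x \<in> S" for x
      by (simp only: frechet_derivative_eqI[OF D[OF that]])
  qed
  then show ?case
    using D by (auto simp: differentiable_def)
qed

text \<open>Proving \<open>C_on (Suc n)\<close> through a derivative given by a formula avoids \<^const>\<open>frechet_derivative\<close>,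
  which is determined only at the points of \<open>S\<close>.\<close>

lemma C_on_SucI:
  assumes D: "\<And>x. x \<in> S \<Longrightarrow> (f has_derivative f' x) (at x)"
    and f': "\<And>v. C_on n S (\<lambda>x. f' x v)" and S: "open S"
  shows "C_on (Suc n) S f"
proof -
  have "C_on n S (\<lambda>x. frechet_derivative f (at x) v)" for v
    by (rule C_on_cong[OF f' S]) (simp only: frechet_derivative_eqI[OF D])
  moreover have "f differentiable (at x)" if "x \<in> S" for x
    using D[OF that] by (auto simp: differentiable_def)
  ultimately show ?thesis by simp
qed

lemma C_on_frechet_derivative: "C_on (Suc n) S f \<Longrightarrow> C_on n S (\<lambda>x. frechet_derivative f (at x) v)"
  by simp

lemma C_on_local:
  assumes "\<And>x. x \<in> S \<Longrightarrow> \<exists>T. open T \<and> x \<in> T \<and> C_on n T f"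
  shows "C_on n S f"
  using assms
proof (induction n arbitrary: f)
  case 0
  have "isCont f x" if x: "x \<in> S" for x
  proof -
    obtain T where "open T" "x \<in> T" "C_on 0 T f"
      using 0 x by blast
    then show ?thesis
      by (simp add: continuous_on_eq_continuous_at)
  qed
  then show ?case
    by (simp add: continuous_at_imp_continuous_on)
next
  case (Suc n)
  have "f differentiable (at x)" if "x \<in> S" for x
    using Suc.prems[OF that] by auto
  moreover have "C_on n S (\<lambda>x. frechet_derivative f (at x) v)" for v
  proof (rule Suc.IH)
    fix x assume "x \<in> S"
    then obtain T where "open T" "x \<in> T" "C_on (Suc n) T f"
      using Suc.prems by blast
    then show "\<exists>T. open T \<and> x \<in> T \<and> C_on n T (\<lambda>x. frechet_derivative f (at x) v)"
      by auto
  qed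
  ultimately show ?case by simp
qed

lemma C_on_const: "C_on n S (\<lambda>x. c)"
  by (induction n arbitrary: c) (auto simp: frechet_derivative_const)

lemma C_on_add:
  assumes "C_on n S f" "C_on n S g" "open S"
  shows "C_on n S (\<lambda>x. f x + g x)"
  using assms(1,2)
proof (induction n arbitrary: f g)
  case 0
  then show ?case by (auto intro: continuous_intros)
next
  case (Suc n)
  let ?D = "\<lambda>f x. frechet_derivative f (at x)"
  have D: "((\<lambda>x. f x + g x) has_derivative (\<lambda>v. ?D f x v + ?D g x v)) (at x)" if "x \<in> S" for x
    by (intro has_derivative_add C_on_has_derivative[OF Suc.prems(1) that] C_on_has_derivative[OF Suc.prems(2) that])
  show ?case
    by (rule C_on_SucI[OF D Suc.IH assms(3)]) (assumption | rule C_on_frechet_derivative, rule Suc.prems)+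
qed

lemma C_on_bounded_linear:
  assumes L: "bounded_linear L" and "C_on n S f" "open S"
  shows "C_on n S (\<lambda>x. L (f x))"
  using assms(2)
proof (induction n arbitrary: f)
  case 0
  then show ?case using bounded_linear.continuous_on[OF L] by simp
next
  case (Suc n)
  have D: "((\<lambda>x. L (f x)) has_derivative (\<lambda>v. L (frechet_derivative f (at x) v))) (at x)" if "x \<in> S" for x
    by (rule bounded_linear.has_derivative[OF L C_on_has_derivative[OF Suc.prems that]])
  show ?case
    by (rule C_on_SucI[OF D Suc.IH assms(3)]) (assumption | rule C_on_frechet_derivative, rule Suc.prems)+
qed

lemma C_on_bounded_bilinear:
  assumes P: "bounded_bilinear P" and "C_on n S f" "C_on n S g" and S: "open S"
  shows "C_on n S (\<lambda>x. P (f x) (g x))"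
  using assms(2,3)
proof (induction n arbitrary: f g)
  case 0
  then show ?case using bounded_bilinear.continuous_on[OF P] by simp
next
  case (Suc n)
  let ?D = "\<lambda>f x. frechet_derivative f (at x)"
  have D: "((\<lambda>x. P (f x) (g x)) has_derivative (\<lambda>v. P (f x) (?D g x v) + P (?D f x v) (g x))) (at x)"
    if "x \<in> S" for x
    by (rule bounded_bilinear.FDERIV[OF P C_on_has_derivative[OF Suc.prems(1) that]
          C_on_has_derivative[OF Suc.prems(2) that]])
  show ?case
    by (rule C_on_SucI[OF D C_on_add[OF Suc.IH Suc.IH S] S])
      (assumption | rule C_on_frechet_derivative C_on_Suc_E, rule Suc.prems)+
qed

lemma C_on_inverse:
  fixes f :: "'a::real_normed_vector \<Rightarrow> real"
  assumes "C_on n S f" "open S" "\<And>x. x \<in> S \<Longrightarrow> f x \<noteq> 0"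
  shows "C_on n S (\<lambda>x. inverse (f x))"
  using assms(1)
proof (induction n)
  case 0
  then show ?case using assms(3) by (auto intro: continuous_intros)
next
  case (Suc n)
  let ?D = "\<lambda>f x. frechet_derivative f (at x)"
  have D: "((\<lambda>x. inverse (f x)) has_derivative (\<lambda>v. (- inverse (f x) * inverse (f x)) * ?D f x v)) (at x)"
    if "x \<in> S" for x
    using Deriv.has_derivative_inverse[OF assms(3)[OF that] C_on_has_derivative[OF Suc.prems that]]
    by (simp add: algebra_simps)
  note mul = C_on_bounded_bilinear[OF bounded_bilinear_mult _ _ assms(2)]
  have i: "C_on n S (\<lambda>x. inverse (f x))"
    by (rule Suc.IH[OF C_on_Suc_E[OF Suc.prems]])
  have "C_on n S (\<lambda>x. ((- 1) * (inverse (f x) * inverse (f x))) * ?D f x v)" for v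
    by (intro mul C_on_const i C_on_frechet_derivative Suc.prems)
  then have h: "C_on n S (\<lambda>x. (- inverse (f x) * inverse (f x)) * ?D f x v)" for v
    by simp
  show ?case
    by (rule C_on_SucI[OF D h assms(2)])
qed

lemma smooth_on_const: "smooth_on S (\<lambda>x. c)"
  by (simp add: smooth_on_def C_on_const)

lemma smooth_on_subset:
  assumes "smooth_on S f" "T \<subseteq> S"
  shows "smooth_on T f"
  unfolding smooth_on_def
  by (rule allI, rule C_on_subset[OF _ assms(2)], rule spec[OF assms(1)[unfolded smooth_on_def]])

lemma smooth_on_cong:
  assumes "smooth_on S f" "open S" "\<And>x. x \<in> S \<Longrightarrow> f x = g x"
  shows "smooth_on S g"
  unfolding smooth_on_def
  by (rule allI, rule C_on_cong[OF spec[OF assms(1)[unfolded smooth_on_def]] assms(2,3)])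

lemma smooth_on_local:
  assumes "\<And>x. x \<in> S \<Longrightarrow> \<exists>T. open T \<and> x \<in> T \<and> smooth_on T f"
  shows "smooth_on S f"
  unfolding smooth_on_def
proof (intro allI C_on_local)
  fix n x assume "x \<in> S"
  then obtain T where "open T" "x \<in> T" "\<forall>n. C_on n T f"
    using assms[unfolded smooth_on_def] by auto
  then show "\<exists>T. open T \<and> x \<in> T \<and> C_on n T f" by auto
qed

lemma smooth_on_add: "smooth_on S f \<Longrightarrow> smooth_on S g \<Longrightarrow> open S \<Longrightarrow> smooth_on S (\<lambda>x. f x + g x)"
  by (simp add: smooth_on_def C_on_add)

lemma smooth_on_bounded_linear:
  "bounded_linear L \<Longrightarrow> smooth_on S f \<Longrightarrow> open S \<Longrightarrow> smooth_on S (\<lambda>x. L (f x))"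
  by (simp add: smooth_on_def C_on_bounded_linear)

lemma smooth_on_bounded_bilinear:
  "bounded_bilinear P \<Longrightarrow> smooth_on S f \<Longrightarrow> smooth_on S g \<Longrightarrow> open S \<Longrightarrow> smooth_on S (\<lambda>x. P (f x) (g x))"
  by (simp add: smooth_on_def C_on_bounded_bilinear)

lemma smooth_on_inverse:
  fixes f :: "'a::real_normed_vector \<Rightarrow> real"
  shows "smooth_on S f \<Longrightarrow> open S \<Longrightarrow> (\<And>x. x \<in> S \<Longrightarrow> f x \<noteq> 0) \<Longrightarrow> smooth_on S (\<lambda>x. inverse (f x))"
  by (simp add: smooth_on_def C_on_inverse)

section \<open>A flat function\<close>

text \<open>The functions \<open>p(1/t) exp(-1/t)\<close> for \<open>t > 0\<close>, extended by 0, with \<open>p\<close> a polynomial. They are closed under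
  differentiation, hence smooth.\<close>

definition flat :: "real poly \<Rightarrow> real \<Rightarrow> real" where
  "flat p t = (if t \<le> 0 then 0 else poly p (inverse t) * exp (- inverse t))"

lemma flat_tendsto_0: "((\<lambda>t. poly p (inverse t) * exp (- inverse t)) \<longlongrightarrow> 0) (at_right (0::real))"
proof -
  have "((\<lambda>u::real. coeff p i * (u ^ i / exp u)) \<longlongrightarrow> coeff p i * 0) at_top" for i
    by (intro tendsto_mult tendsto_const tendsto_power_div_exp_0)
  then have "((\<lambda>u::real. \<Sum>i\<le>degree p. coeff p i * (u ^ i / exp u)) \<longlongrightarrow> 0) at_top"
    by (intro tendsto_null_sum) simp
  then have "((\<lambda>u::real. poly p u * exp (- u)) \<longlongrightarrow> 0) at_top"
    by (simp add: poly_altdef sum_distrib_right exp_minus divide_inverse mult.assoc)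
  from filterlim_compose[OF this filterlim_inverse_at_top_right] show ?thesis .
qed

lemma flat_has_derivative:
  "(flat p has_real_derivative flat ((p - pderiv p) * [:0, 0, 1:]) t) (at t)"
proof -
  consider "t < 0" | "t = 0" | "t > 0" by linarith
  then show ?thesis
  proof cases
    case 1
    have "((\<lambda>t. 0) has_real_derivative 0) (at t)" by simp
    then have "(flat p has_real_derivative 0) (at t)"
      by (rule has_field_derivative_transform_within_open[where S = "{..<0}"]) (use 1 in \<open>auto simp: flat_def\<close>)
    then show ?thesis using 1 by (simp add: flat_def)
  next
    case 3
    have "((\<lambda>t. poly p (inverse t) * exp (- inverse t)) has_real_derivative
        poly ((p - pderiv p) * [:0, 0, 1:]) (inverse t) * exp (- inverse t)) (at t)"
    proof -
      have i: "(inverse has_real_derivative - (inverse t * inverse t)) (at t)"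
        using DERIV_inverse'[OF DERIV_ident, of t] 3 by simp
      have "((\<lambda>t. poly p (inverse t)) has_real_derivative poly (pderiv p) (inverse t) * - (inverse t * inverse t)) (at t)"
        by (rule DERIV_chain2[OF poly_DERIV i])
      moreover have "((\<lambda>t. exp (- inverse t)) has_real_derivative exp (- inverse t) * - (- (inverse t * inverse t))) (at t)"
        by (rule DERIV_chain2[OF DERIV_exp DERIV_minus[OF i]])
      ultimately show ?thesis
        by (rule DERIV_cong[OF DERIV_mult]) (simp add: algebra_simps)
    qed
    then have "(flat p has_real_derivative
        poly ((p - pderiv p) * [:0, 0, 1:]) (inverse t) * exp (- inverse t)) (at t)"
      by (rule has_field_derivative_transform_within_open[where S = "{0<..}"]) (use 3 in \<open>auto simp: flat_def\<close>)
    then show ?thesis using 3 by (simp add: flat_def)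
  next
    case 2
    have "((\<lambda>h. flat p h / h) \<longlongrightarrow> 0) (at_right 0)"
      using flat_tendsto_0[of "p * [:0, 1:]"]
      by (rule Lim_transform_eventually) (auto simp: eventually_at_filter flat_def field_simps)
    moreover have "((\<lambda>h. flat p h / h) \<longlongrightarrow> 0) (at_left 0)"
      by (rule Lim_transform_eventually[OF tendsto_const]) (auto simp: eventually_at_filter flat_def)
    ultimately have "((\<lambda>h. flat p h / h) \<longlongrightarrow> 0) (at 0)"
      by (simp add: filterlim_split_at)
    then show ?thesis using 2 by (simp add: DERIV_def flat_def)
  qed
qed

lemma C_on_flat:
  assumes "C_on n S g" "open S"
  shows "C_on n S (\<lambda>x. flat p (g x))"
  using assms(1)
proof (induction n arbitrary: p)
  case 0
  have "continuous_on UNIV (flat p)"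
    using flat_has_derivative by (auto intro!: continuous_at_imp_continuous_on DERIV_isCont)
  then show ?case using 0 by (auto intro: continuous_on_compose2)
next
  case (Suc n)
  let ?D = "\<lambda>f x. frechet_derivative f (at x)" and ?q = "(p - pderiv p) * [:0, 0, 1:]"
  have D: "((\<lambda>x. flat p (g x)) has_derivative (\<lambda>v. flat ?q (g x) * ?D g x v)) (at x)"
    if "x \<in> S" for x
  proof -
    have "(flat p has_derivative (*) (flat ?q (g x))) (at (g x))"
      using flat_has_derivative by (simp add: has_field_derivative_def)
    then show ?thesis
      by (rule has_derivative_compose[OF C_on_has_derivative[OF Suc.prems that]])
  qed
  show ?case
    by (rule C_on_SucI[OF D C_on_bounded_bilinear[OF bounded_bilinear_mult Suc.IH _ assms(2)] assms(2)])
      (assumption | rule C_on_frechet_derivative C_on_Suc_E, rule Suc.prems)+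
qed

lemma smooth_on_flat: "smooth_on S f \<Longrightarrow> open S \<Longrightarrow> smooth_on S (\<lambda>x. flat p (f x))"
  by (simp add: smooth_on_def C_on_flat)

section \<open>Compactness of balls in the model space\<close>

text \<open>In an orthogonal basis the coordinates of a bounded vector are bounded, so a ball lies in the image of a cube,
  which is compact by induction on the number of basis vectors. The model space is not required to be in class
  \<^class>\<open>euclidean_space\<close>, so the usual Heine--Borel theorem does not apply.\<close>

lemma compact_cball_finite_span:
  fixes B :: "'k::real_inner set"
  assumes "finite B" "span B = UNIV"
  shows "compact (cball (z::'k) e)"
proof -
  obtain C :: "'k set" where C: "finite C" "span C = UNIV" "pairwise orthogonal C"
    using basis_orthogonal[OF assms(1)] assms(2) by metis
  define D where "D = C - {0}"
  have D: "finite D" "span D = UNIV" "pairwise orthogonal D" "0 \<notin> D"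
    using C by (auto simp: D_def span_delete_0 intro: pairwise_subset)
  have cube: "compact ((\<lambda>c. \<Sum>b\<in>E. c b *\<^sub>R b) ` (PiE E (\<lambda>_. {-r..r})))" if "finite E" for E :: "'k set" and r
    using that
  proof (induction E)
    case empty
    then show ?case by simp
  next
    case (insert b E)
    let ?f = "\<lambda>E c. \<Sum>b\<in>E. c b *\<^sub>R (b :: 'k)"
    have "?f (insert b E) ` (PiE (insert b E) (\<lambda>_. {-r..r})) =
        {x + y | x y. x \<in> (\<lambda>t. t *\<^sub>R b) ` {-r..r} \<and> y \<in> ?f E ` (PiE E (\<lambda>_. {-r..r}))}" (is "?L = ?R")
    proof (intro equalityI subsetI)
      fix z assume "z \<in> ?L"
      then obtain c where c: "z = ?f (insert b E) c" "c \<in> PiE (insert b E) (\<lambda>_. {-r..r})"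
        by blast
      have "z = c b *\<^sub>R b + ?f E (restrict c E)"
        using c insert by simp
      moreover have "restrict c E \<in> PiE E (\<lambda>_. {-r..r})" "c b \<in> {-r..r}"
        using c(2) by (auto simp: PiE_iff)
      ultimately show "z \<in> ?R"
        by (intro CollectI exI[of _ "c b *\<^sub>R b"] exI[of _ "?f E (restrict c E)"] conjI imageI)
    next
      fix z assume "z \<in> ?R"
      then obtain x y where "z = x + y" "x \<in> (\<lambda>t. t *\<^sub>R b) ` {-r..r}" "y \<in> ?f E ` (PiE E (\<lambda>_. {-r..r}))"
        by (elim CollectE exE conjE)
      then obtain t c where c: "z = t *\<^sub>R b + ?f E c" "t \<in> {-r..r}" "c \<in> PiE E (\<lambda>_. {-r..r})"
        by (elim imageE) simp
      have "z = ?f (insert b E) (c(b := t))"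
        using c insert by (auto intro!: sum.cong)
      moreover have "c(b := t) \<in> PiE (insert b E) (\<lambda>_. {-r..r})"
        using c by (auto simp: PiE_iff extensional_def)
      ultimately show "z \<in> ?L" by (simp only: image_eqI)
    qed
    moreover have "compact ((\<lambda>t. t *\<^sub>R b) ` {-r..r})"
      by (intro compact_continuous_image continuous_intros) auto
    ultimately show ?case
      using compact_sums[OF _ insert.IH, of "(\<lambda>t. t *\<^sub>R b) ` {-r..r}"] by simp
  qed
  define r where "r = (\<Sum>b\<in>D. (norm z + \<bar>e\<bar>) / norm b)"
  have "cball z e \<subseteq> (\<lambda>c. \<Sum>b\<in>D. c b *\<^sub>R b) ` (PiE D (\<lambda>_. {-r..r}))"
  proof
    fix y assume "y \<in> cball z e"
    then have y: "norm y \<le> norm z + \<bar>e\<bar>"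
      using norm_triangle_sub[of y z] by (simp add: dist_norm norm_minus_commute)
    have "y \<in> span D" using D by simp
    then obtain c where c: "y = (\<Sum>b\<in>D. c b *\<^sub>R b)"
      using D(1) by (auto simp: span_finite)
    have "\<bar>c b\<bar> \<le> r" if b: "b \<in> D" for b
    proof -
      have "inner y b = (\<Sum>a\<in>D. c a * inner a b)"
        by (simp add: c inner_sum_left)
      also have "\<dots> = (\<Sum>a\<in>D. if a = b then c b * inner b b else 0)"
        using D(3) b by (intro sum.cong) (auto simp: pairwise_def orthogonal_def)
      finally have "inner y b = c b * norm b ^ 2"
        using D(1) b by (simp add: power2_norm_eq_inner)
      then have "\<bar>c b\<bar> * norm b * norm b \<le> norm y * norm b"
        using Cauchy_Schwarz_ineq2[of y b] by (simp add: abs_mult power2_eq_square mult.assoc)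
      moreover have "norm b > 0" using D b by auto
      ultimately have "\<bar>c b\<bar> * norm b \<le> norm y" by simp
      then have "\<bar>c b\<bar> \<le> norm y / norm b"
        using \<open>norm b > 0\<close> by (simp add: pos_le_divide_eq)
      also have "\<dots> \<le> (norm z + \<bar>e\<bar>) / norm b"
        using y by (simp add: divide_right_mono)
      also have "\<dots> \<le> r"
        unfolding r_def using D(1) b by (intro member_le_sum) auto
      finally show ?thesis .
    qed
    then have "restrict c D \<in> PiE D (\<lambda>_. {-r..r})"
      by (simp add: PiE_iff abs_le_iff minus_le_iff)
    moreover have "y = (\<Sum>b\<in>D. restrict c D b *\<^sub>R b)"
      using c by simp
    ultimately show "y \<in> (\<lambda>c. \<Sum>b\<in>D. c b *\<^sub>R b) ` (PiE D (\<lambda>_. {-r..r}))"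
      by (simp only: image_eqI)
  qed
  then show ?thesis
    using compact_Int_closed[OF cube[OF D(1), of r] closed_cball[of z e]] by (simp add: Int_absorb1)
qed

section \<open>Smooth functions on a manifold\<close>

text \<open>Smooth functions with values in a normed space on open subsets of a manifold with atlas \<open>K\<close>.\<close>

locale manifold_atlas =
  fixes K :: "('m::{t2_space,second_countable_topology}, 'k::real_inner) chart set"
  assumes manifold: "smooth_manifold K"
begin

lemmas manifold_conditions = manifold[unfolded smooth_manifold_def]

lemma model_finite_span: "\<exists>B::'k set. finite B \<and> span B = UNIV"
  by (rule conjunct1[OF manifold_conditions])

lemma chart_cover: "\<exists>U \<phi>. (U, \<phi>) \<in> K \<and> x \<in> U"
proof -
  have "x \<in> (\<Union>(U, \<phi>)\<in>K. U)"
    by (simp only: conjunct1[OF conjunct2[OF manifold_conditions]] UNIV_I)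
  then show ?thesis by (auto simp only: UN_iff split: prod.splits)
qed

lemma
  assumes "(U, \<phi>) \<in> K"
  shows chart_open: "open U" and chart_range_open: "open (\<phi> ` U)"
    and chart_homeo: "homeomorphism U (\<phi> ` U) \<phi> (inv_into U \<phi>)"
  using bspec[OF conjunct1[OF conjunct2[OF conjunct2[OF manifold_conditions]]] assms] by auto

lemma chart_transition:
  assumes "(U, \<phi>) \<in> K" "(V, \<psi>) \<in> K"
  shows "smooth_on (\<phi> ` (U \<inter> V)) (\<psi> \<circ> inv_into U \<phi>)"
  by (rule bspec[OF bspec[OF conjunct2[OF conjunct2[OF conjunct2[OF manifold_conditions]]] assms(1), unfolded prod.case]
        assms(2), unfolded prod.case])

lemma chart_inv: "(U, \<phi>) \<in> K \<Longrightarrow> x \<in> U \<Longrightarrow> inv_into U \<phi> (\<phi> x) = x"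
  using chart_homeo by (meson homeomorphism_apply1)

lemma chart_image_open:
  assumes "(U, \<phi>) \<in> K" "open W"
  shows "open (\<phi> ` (U \<inter> W))"
proof -
  have "openin (top_of_set U) (U \<inter> W)"
    using assms(2) by auto
  then have "openin (top_of_set (\<phi> ` U)) (\<phi> ` (U \<inter> W))"
    using homeomorphism_imp_open_map[OF chart_homeo[OF assms(1)]] by blast
  then show ?thesis
    using chart_range_open[OF assms(1)] by (simp add: openin_open_eq)
qed

lemma msmooth_onI:
  assumes "\<And>U \<phi>. (U, \<phi>) \<in> K \<Longrightarrow> open (\<phi> ` (U \<inter> W)) \<Longrightarrow> smooth_on (\<phi> ` (U \<inter> W)) (\<lambda>z. f (inv_into U \<phi> z))"
    and "open W"
  shows "msmooth_on K W f"
proof -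
  have "smooth_on (\<phi> ` (U \<inter> W)) (f \<circ> inv_into U \<phi>)" if "(U, \<phi>) \<in> K" for U \<phi>
    unfolding o_def by (rule assms(1)[OF that chart_image_open[OF that assms(2)]])
  then show ?thesis by (auto simp only: msmooth_on_def split: prod.splits)
qed

lemma msmooth_onD:
  "msmooth_on K W f \<Longrightarrow> (U, \<phi>) \<in> K \<Longrightarrow> smooth_on (\<phi> ` (U \<inter> W)) (\<lambda>z. f (inv_into U \<phi> z))"
  unfolding msmooth_on_def o_def by auto

lemma msmooth_const: "open W \<Longrightarrow> msmooth_on K W (\<lambda>x. c)"
  by (rule msmooth_onI[OF smooth_on_const])

lemma msmooth_add:
  assumes "open W" "msmooth_on K W f" "msmooth_on K W g"
  shows "msmooth_on K W (\<lambda>x. f x + g x)"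
  by (rule msmooth_onI[OF smooth_on_add[OF msmooth_onD[OF assms(2)] msmooth_onD[OF assms(3)]] assms(1)])

lemma msmooth_bounded_linear:
  assumes "open W" "bounded_linear L" "msmooth_on K W f"
  shows "msmooth_on K W (\<lambda>x. L (f x))"
  by (rule msmooth_onI[OF smooth_on_bounded_linear[OF assms(2) msmooth_onD[OF assms(3)]] assms(1)])

lemma msmooth_bounded_bilinear:
  assumes "open W" "bounded_bilinear P" "msmooth_on K W f" "msmooth_on K W g"
  shows "msmooth_on K W (\<lambda>x. P (f x) (g x))"
  by (rule msmooth_onI[OF smooth_on_bounded_bilinear[OF assms(2) msmooth_onD[OF assms(3)] msmooth_onD[OF assms(4)]] assms(1)])

lemma msmooth_inverse:
  fixes f :: "'m \<Rightarrow> real"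
  assumes "open W" "msmooth_on K W f" "\<And>x. x \<in> W \<Longrightarrow> f x \<noteq> 0"
  shows "msmooth_on K W (\<lambda>x. inverse (f x))"
proof (rule msmooth_onI[OF _ assms(1)])
  fix U \<phi> assume ch: "(U, \<phi>) \<in> K" and op: "open (\<phi> ` (U \<inter> W))"
  have "f (inv_into U \<phi> z) \<noteq> 0" if "z \<in> \<phi> ` (U \<inter> W)" for z
    using that chart_inv[OF ch] assms(3) by auto
  then show "smooth_on (\<phi> ` (U \<inter> W)) (\<lambda>z. inverse (f (inv_into U \<phi> z)))"
    by (rule smooth_on_inverse[OF msmooth_onD[OF assms(2) ch] op])
qed

lemma msmooth_flat:
  assumes "open W" "msmooth_on K W f"
  shows "msmooth_on K W (\<lambda>x. flat p (f x))"
  by (rule msmooth_onI[OF smooth_on_flat[OF msmooth_onD[OF assms(2)]] assms(1)])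

lemma msmooth_subset:
  assumes "msmooth_on K W f" "V \<subseteq> W" "open V"
  shows "msmooth_on K V f"
  by (rule msmooth_onI[OF smooth_on_subset[OF msmooth_onD[OF assms(1)]] assms(3)]) (use assms(2) in auto)

lemma msmooth_cong:
  assumes "msmooth_on K W f" "open W" "\<And>x. x \<in> W \<Longrightarrow> f x = g x"
  shows "msmooth_on K W g"
proof (rule msmooth_onI[OF _ assms(2)])
  fix U \<phi> assume ch: "(U, \<phi>) \<in> K" and op: "open (\<phi> ` (U \<inter> W))"
  have "f (inv_into U \<phi> z) = g (inv_into U \<phi> z)" if "z \<in> \<phi> ` (U \<inter> W)" for z
    using that chart_inv[OF ch] assms(3) by auto
  then show "smooth_on (\<phi> ` (U \<inter> W)) (\<lambda>z. g (inv_into U \<phi> z))"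
    by (rule smooth_on_cong[OF msmooth_onD[OF assms(1) ch] op])
qed

lemma msmooth_local:
  assumes "open W" "\<And>x. x \<in> W \<Longrightarrow> \<exists>T. open T \<and> x \<in> T \<and> msmooth_on K T f"
  shows "msmooth_on K W f"
proof (rule msmooth_onI[OF _ assms(1)], rule smooth_on_local)
  fix U \<phi> z assume ch: "(U, \<phi>) \<in> K" and "z \<in> \<phi> ` (U \<inter> W)"
  then obtain y where y: "y \<in> U" "y \<in> W" "z = \<phi> y" by auto
  then obtain T where "open T" "y \<in> T" "msmooth_on K T f"
    using assms(2) by blast
  then show "\<exists>T. open T \<and> z \<in> T \<and> smooth_on T (\<lambda>z. f (inv_into U \<phi> z))"
    using y by (intro exI[of _ "\<phi> ` (U \<inter> T)"] conjI chart_image_open[OF ch] msmooth_onD[OF _ ch]) auto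
qed

lemma msmooth_sum:
  "open W \<Longrightarrow> (\<And>i. i \<in> I \<Longrightarrow> msmooth_on K W (f i)) \<Longrightarrow> msmooth_on K W (\<lambda>x. \<Sum>i\<in>I. f i x)"
  by (induction I rule: infinite_finite_induct) (auto intro: msmooth_const msmooth_add)

lemmas msmooth_mult = msmooth_bounded_bilinear[OF _ bounded_bilinear_mult]
lemmas msmooth_scaleR = msmooth_bounded_bilinear[OF _ bounded_bilinear_scaleR]

lemma msmooth_power:
  fixes f :: "'m \<Rightarrow> real"
  shows "open W \<Longrightarrow> msmooth_on K W f \<Longrightarrow> msmooth_on K W (\<lambda>x. f x ^ r)"
  by (induction r) (auto intro: msmooth_const msmooth_mult)

lemma msmooth_chart:
  assumes "(U, \<phi>) \<in> K"
  shows "msmooth_on K U \<phi>"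
  by (rule msmooth_onI[OF chart_transition[OF _ assms, unfolded o_def] chart_open[OF assms]])

lemma smooth_functionsI: "msmooth_on K UNIV f \<Longrightarrow> f \<in> smooth_functions K"
  by (simp add: smooth_functions_def)

lemma smooth_functionsD: "f \<in> smooth_functions K \<Longrightarrow> open W \<Longrightarrow> msmooth_on K W f"
  by (simp add: smooth_functions_def msmooth_subset[of UNIV])

text \<open>A bump function is built in one chart from the flat function; its support \<open>C\<close> is compact, hence closed in the
  Hausdorff space \<open>M\<close>. Only the value 1 at \<open>x\<close> is asked for, not the value 1 in a neighbourhood.\<close>

lemma exists_bump:
  assumes "open W" "x \<in> W"
  obtains \<beta> C where "\<beta> \<in> smooth_functions K" "closed C" "C \<subseteq> W" "\<beta> x = 1" "\<And>y. y \<notin> C \<Longrightarrow> \<beta> y = 0"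
proof -
  obtain U \<phi> where ch: "(U, \<phi>) \<in> K" and x: "x \<in> U"
    using chart_cover by blast
  obtain e where e: "e > 0" "cball (\<phi> x) e \<subseteq> \<phi> ` (U \<inter> W)"
    using chart_image_open[OF ch assms(1)] x assms(2) open_contains_cball[of "\<phi> ` (U \<inter> W)"] by blast
  define C where "C = inv_into U \<phi> ` cball (\<phi> x) e"
  have C: "C \<subseteq> U" "C \<subseteq> W"
    using e chart_inv[OF ch] by (auto simp: C_def)
  obtain B :: "'k set" where "finite B" "span B = UNIV"
    using model_finite_span by blast
  then have "compact (cball (\<phi> x) e)"
    by (rule compact_cball_finite_span)
  moreover have "cball (\<phi> x) e \<subseteq> \<phi> ` U"
    using e(2) by blast
  then have "continuous_on (cball (\<phi> x) e) (inv_into U \<phi>)"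
    by (rule continuous_on_subset[OF homeomorphism_cont2[OF chart_homeo[OF ch]]])
  ultimately have "compact C"
    unfolding C_def by (intro compact_continuous_image)
  then have closed: "closed C" by (rule compact_imp_closed)
  \<comment> \<open>positive exactly on the open ball of radius \<open>e\<close>, with value 1 at the centre\<close>
  define g where "g y = 1 - inverse (e ^ 2) * inner (\<phi> y + - \<phi> x) (\<phi> y + - \<phi> x)" for y
  define \<beta> where "\<beta> y = (if y \<in> U then exp 1 * flat 1 (g y) else 0)" for y
  have zero: "\<beta> y = 0" if "y \<notin> C" for y
  proof (cases "y \<in> U")
    case True
    have "dist (\<phi> x) (\<phi> y) > e"
    proof (rule ccontr)
      assume "\<not> dist (\<phi> x) (\<phi> y) > e"
      then have "inv_into U \<phi> (\<phi> y) \<in> C" by (auto simp: C_def)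
      then show False using that chart_inv[OF ch True] by simp
    qed
    then have "e ^ 2 < (norm (\<phi> y + - \<phi> x)) ^ 2"
      using e(1) by (intro power_strict_mono) (auto simp: dist_norm norm_minus_commute)
    then have "g y \<le> 0"
      using e(1) by (simp add: g_def power2_norm_eq_inner field_simps)
    then show ?thesis by (simp add: \<beta>_def flat_def)
  qed (simp add: \<beta>_def)
  have U: "open U" using chart_open[OF ch] .
  have "msmooth_on K U (\<lambda>y. exp 1 * flat 1 (1 + (- inverse (e ^ 2)) * inner (\<phi> y + - \<phi> x) (\<phi> y + - \<phi> x)))"
    by (intro msmooth_mult msmooth_flat msmooth_add msmooth_const U msmooth_chart[OF ch]
        msmooth_bounded_bilinear[OF _ bounded_bilinear_inner])
  then have "msmooth_on K U \<beta>"
    by (rule msmooth_cong[OF _ U]) (simp add: \<beta>_def g_def)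
  moreover have "msmooth_on K (- C) \<beta>"
    using closed by (intro msmooth_cong[OF msmooth_const[of _ 0]]) (auto simp: zero)
  ultimately have T: "\<exists>T. open T \<and> y \<in> T \<and> msmooth_on K T \<beta>" for y
    using U closed C(1) by (cases "y \<in> U") (rule exI[of _ U], simp, rule exI[of _ "- C"], auto)
  have one: "\<beta> x = 1"
    using x exp_add[of 1 "- 1 :: real"] by (simp add: \<beta>_def g_def flat_def)
  show ?thesis
    by (rule that[OF smooth_functionsI[OF msmooth_local[OF open_UNIV T]] closed C(2) one zero])
qed

text \<open>Extension by zero of a local function that has been cut off by a bump function.\<close>

lemma msmooth_extend:
  assumes "\<beta> \<in> smooth_functions K" "closed C" "C \<subseteq> U" "\<And>y. y \<notin> C \<Longrightarrow> \<beta> y = 0" "open U" "open V"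
    and f: "msmooth_on K (U \<inter> V) f"
  shows "msmooth_on K V (\<lambda>y. if y \<in> U then \<beta> y *\<^sub>R f y else 0)"
proof (rule msmooth_local[OF assms(6)])
  let ?g = "\<lambda>y. if y \<in> U then \<beta> y *\<^sub>R f y else 0"
  fix x assume x: "x \<in> V"
  have "msmooth_on K (U \<inter> V) (\<lambda>y. \<beta> y *\<^sub>R f y)"
    using assms by (intro msmooth_scaleR smooth_functionsD) auto
  then have 1: "msmooth_on K (U \<inter> V) ?g"
    by (rule msmooth_cong) (use assms in auto)
  have 2: "msmooth_on K (- C) ?g"
    using assms by (intro msmooth_cong[OF msmooth_const[of _ 0]]) auto
  show "\<exists>T. open T \<and> x \<in> T \<and> msmooth_on K T ?g"
  proof (cases "x \<in> U")
    case True
    then show ?thesis using 1 x assms by (intro exI[of _ "U \<inter> V"]) auto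
  next
    case False
    then show ?thesis using 2 assms by (intro exI[of _ "- C"]) auto
  qed
qed

text \<open>Smoothness of \<open>f\<close> can be tested after multiplication by global functions, which may be bump functions: near \<open>x\<close>
  the factor \<open>h\<close> is invertible.\<close>

lemma msmooth_if_bump_mult:
  fixes f :: "'m \<Rightarrow> 'b::real_normed_vector"
  assumes "open W"
    and "\<And>x. x \<in> W \<Longrightarrow> \<exists>h\<in>smooth_functions K. h x \<noteq> 0 \<and> msmooth_on K W (\<lambda>y. h y *\<^sub>R f y)"
  shows "msmooth_on K W f"
proof (rule msmooth_local[OF assms(1)])
  fix x assume x: "x \<in> W"
  then obtain h where h: "h \<in> smooth_functions K" "h x \<noteq> 0" "msmooth_on K W (\<lambda>y. h y *\<^sub>R f y)"
    using assms(2) by blast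
  obtain U \<phi> where ch: "(U, \<phi>) \<in> K" and xU: "x \<in> U"
    using chart_cover by blast
  have "C_on 0 (\<phi> ` (U \<inter> UNIV)) (\<lambda>z. h (inv_into U \<phi> z))"
    using msmooth_onD[OF smooth_functionsD[OF h(1)] ch] unfolding smooth_on_def by blast
  then have "continuous_on (\<phi> ` U) (\<lambda>z. h (inv_into U \<phi> z))" by simp
  moreover have "continuous_on U \<phi>"
    using chart_homeo[OF ch] by (simp add: homeomorphism_def)
  ultimately have "continuous_on U (\<lambda>y. h (inv_into U \<phi> (\<phi> y)))"
    by (rule continuous_on_compose2) auto
  then have "continuous_on U h"
    using chart_inv[OF ch] by (simp cong: continuous_on_cong)
  then have "open (U \<inter> h -` (- {0}))"
    using chart_open[OF ch] by (intro continuous_open_preimage) auto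
  then have T: "open (W \<inter> (U \<inter> h -` (- {0})))" (is "open ?T")
    using assms(1) by blast
  have "msmooth_on K ?T (\<lambda>y. inverse (h y) *\<^sub>R (h y *\<^sub>R f y))"
    using T by (intro msmooth_scaleR msmooth_inverse smooth_functionsD h(1) msmooth_subset[OF h(3)]) auto
  then have "msmooth_on K ?T f"
    by (rule msmooth_cong[OF _ T]) auto
  then show "\<exists>T. open T \<and> x \<in> T \<and> msmooth_on K T f"
    using T x xU h(2) by (intro exI[of _ ?T]) auto
qed

end

section \<open>Sections of a vector bundle\<close>

text \<open>A vector bundle with atlas \<open>K\<close> and rank \<open>n\<close>.\<close>

locale smooth_bundle =
  fixes A :: "('m::{t2_space,second_countable_topology}, 'k::real_inner, 'v::real_vector, 'z) vector_bundle_scheme"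
  assumes bundle_structure: "vector_bundle A"
begin

abbreviation "K \<equiv> charts A"
abbreviation "n \<equiv> bundle_rank A"

sublocale manifold_atlas K
  by unfold_locales (rule conjunct1[OF bundle_structure[unfolded vector_bundle_def]])

lemmas bundle_conditions = bundle_structure[unfolded vector_bundle_def]

lemma fibre_subspace: "subspace (fibre A x)"
  by (rule spec[OF conjunct1[OF conjunct2[OF bundle_conditions]]])

lemma frame_cover: "\<exists>U e. (U, e) \<in> frames A \<and> x \<in> U"
proof -
  have "x \<in> (\<Union>(U, e)\<in>frames A. U)"
    by (simp only: conjunct1[OF conjunct2[OF conjunct2[OF bundle_conditions]]] UNIV_I)
  then show ?thesis by (auto simp only: UN_iff split: prod.splits)
qed

lemma
  assumes "(U, e) \<in> frames A"
  shows frame_open: "open U"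
    and frame_inj: "x \<in> U \<Longrightarrow> inj_on (\<lambda>i. e i x) {..<n}"
    and frame_independent: "x \<in> U \<Longrightarrow> independent ((\<lambda>i. e i x) ` {..<n})"
    and frame_span: "x \<in> U \<Longrightarrow> span ((\<lambda>i. e i x) ` {..<n}) = fibre A x"
  using bspec[OF conjunct1[OF conjunct2[OF conjunct2[OF conjunct2[OF bundle_conditions]]]] assms] by simp_all

lemma frame_mem: "(U, e) \<in> frames A \<Longrightarrow> x \<in> U \<Longrightarrow> i < n \<Longrightarrow> e i x \<in> fibre A x"
  by (subst frame_span[symmetric]) (auto intro: span_base)

lemma frame_transition:
  assumes "(U, e) \<in> frames A" "(V, e') \<in> frames A"
  obtains g :: "nat \<Rightarrow> nat \<Rightarrow> 'm \<Rightarrow> real" where "\<And>i j. i < n \<Longrightarrow> j < n \<Longrightarrow> msmooth_on K (U \<inter> V) (g i j)"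
    "\<And>j x. j < n \<Longrightarrow> x \<in> U \<Longrightarrow> x \<in> V \<Longrightarrow> e' j x = (\<Sum>i<n. g i j x *\<^sub>R e i x)"
proof -
  have "\<exists>g. (\<forall>i<n. \<forall>j<n. msmooth_on K (U \<inter> V) (g i j :: 'm \<Rightarrow> real)) \<and>
        (\<forall>j<n. \<forall>x\<in>U \<inter> V. e' j x = (\<Sum>i<n. g i j x *\<^sub>R e i x))"
    using bspec[OF bspec[OF conjunct2[OF conjunct2[OF conjunct2[OF conjunct2[OF bundle_conditions]]]] assms(1), unfolded prod.case] assms(2)]
    by (simp only: prod.case)
  then obtain g where "\<forall>i<n. \<forall>j<n. msmooth_on K (U \<inter> V) (g i j :: 'm \<Rightarrow> real)"
      "\<forall>j<n. \<forall>x\<in>U \<inter> V. e' j x = (\<Sum>i<n. g i j x *\<^sub>R e i x)"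
    by (elim exE conjE)
  then show ?thesis by (intro that[of g]) simp_all
qed

lemma frame_unique:
  assumes "(U, e) \<in> frames A" "x \<in> U" "(\<Sum>i<n. c i *\<^sub>R e i x) = (\<Sum>i<n. c' i *\<^sub>R e i x)" "j < n"
  shows "c j = c' j"
proof -
  let ?h = "\<lambda>i. e i x" and ?g = "\<lambda>v. c (inv_into {..<n} (\<lambda>i. e i x) v) - c' (inv_into {..<n} (\<lambda>i. e i x) v)"
  note inj = frame_inj[OF assms(1,2)]
  have inv: "inv_into {..<n} (\<lambda>i. e i x) (e i x) = i" if "i < n" for i
    using inv_into_f_f[OF inj] that by simp
  have "(\<Sum>v\<in>?h ` {..<n}. ?g v *\<^sub>R v) = (\<Sum>i<n. ?g (?h i) *\<^sub>R ?h i)"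
    by (rule sum.reindex_cong[OF inj]) auto
  also have "\<dots> = (\<Sum>i<n. (c i - c' i) *\<^sub>R e i x)"
    using inv by (intro sum.cong) auto
  also have "\<dots> = 0"
    using assms(3) by (simp add: scaleR_diff_left sum_subtractf)
  finally have "?g (?h j) = 0"
    using independentD[OF frame_independent[OF assms(1,2)], of "?h ` {..<n}" ?g "?h j"] assms(4) by auto
  then show ?thesis using inv assms(4) by simp
qed

lemma frame_exists:
  assumes "(U, e) \<in> frames A" "x \<in> U" "v \<in> fibre A x"
  shows "\<exists>c. v = (\<Sum>i<n. c i *\<^sub>R e i x)"
proof -
  obtain g where "v = (\<Sum>w\<in>(\<lambda>i. e i x) ` {..<n}. g w *\<^sub>R w)"
    using assms(3) frame_span[OF assms(1,2)] span_finite[of "(\<lambda>i. e i x) ` {..<n}"] by auto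
  also have "\<dots> = (\<Sum>i<n. g (e i x) *\<^sub>R e i x)"
    by (rule sum.reindex_cong[OF frame_inj[OF assms(1,2)]]) auto
  finally show ?thesis by (intro exI[of _ "\<lambda>i. g (e i x)"])
qed

text \<open>The coordinates of \<open>v\<close> with respect to the frame \<open>e\<close> at \<open>x\<close>; meaningful for \<open>v\<close> in the fibre and indices below
  the rank.\<close>

definition coord :: "(nat \<Rightarrow> 'm \<Rightarrow> 'v) \<Rightarrow> 'm \<Rightarrow> 'v \<Rightarrow> nat \<Rightarrow> real" where
  "coord e x v = (SOME c. v = (\<Sum>i<n. c i *\<^sub>R e i x))"

lemma coord_sum:
  assumes "(U, e) \<in> frames A" "x \<in> U" "v \<in> fibre A x"
  shows "v = (\<Sum>i<n. coord e x v i *\<^sub>R e i x)"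
  unfolding coord_def by (rule someI_ex[OF frame_exists[OF assms]])

lemma fibre_sum: "(\<And>i. i \<in> I \<Longrightarrow> f i \<in> fibre A x) \<Longrightarrow> (\<Sum>i\<in>I. c i *\<^sub>R f i) \<in> fibre A x"
  using fibre_subspace by (intro subspace_sum subspace_scale) auto

lemma coord_eqI:
  assumes "(U, e) \<in> frames A" "x \<in> U" "v = (\<Sum>i<n. c i *\<^sub>R e i x)" "j < n"
  shows "coord e x v j = c j"
proof -
  have "v \<in> fibre A x"
    unfolding assms(3) using frame_mem[OF assms(1,2)] by (intro fibre_sum) auto
  then show ?thesis
    by (intro frame_unique[OF assms(1,2) _ assms(4)] trans[OF coord_sum[OF assms(1,2), symmetric] assms(3)])
qed

lemma coord_linear:
  assumes "(U, e) \<in> frames A" "x \<in> U" "u \<in> fibre A x" "v \<in> fibre A x" "j < n"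
  shows "coord e x (a *\<^sub>R u + b *\<^sub>R v) j = a * coord e x u j + b * coord e x v j"
proof (rule coord_eqI[OF assms(1,2) _ assms(5)])
  have "a *\<^sub>R u + b *\<^sub>R v = a *\<^sub>R (\<Sum>i<n. coord e x u i *\<^sub>R e i x) + b *\<^sub>R (\<Sum>i<n. coord e x v i *\<^sub>R e i x)"
    by (rule arg_cong2[where f = "\<lambda>u v. a *\<^sub>R u + b *\<^sub>R v", OF coord_sum[OF assms(1-3)] coord_sum[OF assms(1,2,4)]])
  then show "a *\<^sub>R u + b *\<^sub>R v = (\<Sum>i<n. (a * coord e x u i + b * coord e x v i) *\<^sub>R e i x)"
    by (simp add: scaleR_sum_right sum.distrib scaleR_add_left)
qed

lemma coord_eq_0:
  assumes "(U, e) \<in> frames A" "x \<in> U" "v \<in> fibre A x" "\<And>j. j < n \<Longrightarrow> coord e x v j = 0"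
  shows "v = 0"
proof -
  have "v = (\<Sum>i<n. coord e x v i *\<^sub>R e i x)"
    by (rule coord_sum[OF assms(1-3)])
  also have "\<dots> = 0" using assms(4) by simp
  finally show ?thesis .
qed

lemma section_fibre: "s \<in> sections A \<Longrightarrow> s x \<in> fibre A x"
  by (simp add: sections_def)

lemma section_coord_smooth:
  assumes "s \<in> sections A" "(U, e) \<in> frames A" "j < n"
  shows "msmooth_on K U (\<lambda>x. coord e x (s x) j)"
proof -
  obtain c :: "nat \<Rightarrow> 'm \<Rightarrow> real" where c: "\<And>i. i < n \<Longrightarrow> msmooth_on K U (c i)" "\<And>x. x \<in> U \<Longrightarrow> s x = (\<Sum>i<n. c i x *\<^sub>R e i x)"
  proof -
    have "\<exists>c. (\<forall>i<n. msmooth_on K U (c i :: 'm \<Rightarrow> real)) \<and> (\<forall>x\<in>U. s x = (\<Sum>i<n. c i x *\<^sub>R e i x))"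
      using bspec[OF conjunct2[OF CollectD[OF assms(1)[unfolded sections_def]]] assms(2)] by (simp only: prod.case)
    then show ?thesis
      by (elim exE conjE, intro that) simp_all
  qed
  show ?thesis
    by (rule msmooth_cong[OF c(1)[OF assms(3)] frame_open[OF assms(2)]])
      (rule coord_eqI[OF assms(2) _ c(2) assms(3), symmetric])
qed

lemma sectionsI:
  assumes "\<And>x. s x \<in> fibre A x"
    and "\<And>U e i. (U, e) \<in> frames A \<Longrightarrow> open U \<Longrightarrow> i < n \<Longrightarrow> msmooth_on K U (c e i)"
    and "\<And>U e x. (U, e) \<in> frames A \<Longrightarrow> x \<in> U \<Longrightarrow> s x = (\<Sum>i<n. c e i x *\<^sub>R e i x)"
  shows "s \<in> sections A"
proof -
  have "\<exists>c. (\<forall>i<n. msmooth_on K U (c i :: 'm \<Rightarrow> real)) \<and> (\<forall>x\<in>U. s x = (\<Sum>i<n. c i x *\<^sub>R e i x))"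
    if fr: "(U, e) \<in> frames A" for U e
    by (intro exI[of _ "c e"] conjI allI impI ballI assms(2)[OF fr frame_open[OF fr]] assms(3)[OF fr])
  then show ?thesis
    using assms(1) by (auto simp only: sections_def mem_Collect_eq split: prod.splits)
qed

lemma sections_coordI:
  assumes "\<And>x. s x \<in> fibre A x"
    and "\<And>U e i. (U, e) \<in> frames A \<Longrightarrow> open U \<Longrightarrow> i < n \<Longrightarrow> msmooth_on K U (\<lambda>x. coord e x (s x) i)"
  shows "s \<in> sections A"
  by (rule sectionsI[OF assms(1,2) coord_sum[OF _ _ assms(1)]])

lemma sections_add:
  assumes "s \<in> sections A" "t \<in> sections A"
  shows "(\<lambda>x. s x + t x) \<in> sections A"
proof (rule sectionsI)
  show "s x + t x \<in> fibre A x" for x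
    using assms section_fibre fibre_subspace subspace_add by blast
  fix U e assume fr: "(U, e) \<in> frames A"
  show "msmooth_on K U (\<lambda>x. coord e x (s x) i + coord e x (t x) i)" if "open U" "i < n" for i
    using msmooth_add[OF that(1) section_coord_smooth[OF assms(1) fr that(2)] section_coord_smooth[OF assms(2) fr that(2)]] .
  show "s x + t x = (\<Sum>i<n. (coord e x (s x) i + coord e x (t x) i) *\<^sub>R e i x)" if "x \<in> U" for x
    using arg_cong2[where f = "(+)", OF coord_sum[OF fr that section_fibre[OF assms(1)]] coord_sum[OF fr that section_fibre[OF assms(2)]]]
    by (simp only: scaleR_add_left sum.distrib)
qed

lemma sections_scale:
  assumes "f \<in> smooth_functions K" "s \<in> sections A"
  shows "(\<lambda>x. f x *\<^sub>R s x) \<in> sections A"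
proof (rule sectionsI)
  show "f x *\<^sub>R s x \<in> fibre A x" for x
    using assms section_fibre fibre_subspace subspace_scale by blast
  fix U e assume fr: "(U, e) \<in> frames A"
  show "msmooth_on K U (\<lambda>x. f x * coord e x (s x) i)" if "open U" "i < n" for i
    using msmooth_mult[OF that(1) smooth_functionsD[OF assms(1) that(1)] section_coord_smooth[OF assms(2) fr that(2)]] .
  show "f x *\<^sub>R s x = (\<Sum>i<n. (f x * coord e x (s x) i) *\<^sub>R e i x)" if "x \<in> U" for x
    using arg_cong[where f = "\<lambda>v. f x *\<^sub>R v", OF coord_sum[OF fr that section_fibre[OF assms(2)]]]
    by (simp only: scaleR_sum_right scaleR_scaleR)
qed

lemma smooth_const: "(\<lambda>x. c) \<in> smooth_functions K"
  by (intro smooth_functionsI msmooth_const) auto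

lemma sections_zero: "(\<lambda>x. 0) \<in> sections A"
  by (rule sectionsI[where c = "\<lambda>_ _ _. 0"])
    (auto simp: fibre_subspace subspace_0 intro: msmooth_const)

lemma sections_linear:
  assumes "s \<in> sections A" "t \<in> sections A"
  shows "(\<lambda>x. a *\<^sub>R s x + b *\<^sub>R t x) \<in> sections A"
  by (intro sections_add sections_scale[OF smooth_const] assms)

lemma section_bump_frame:
  assumes fr: "(U, e) \<in> frames A" and j: "j < n"
    and \<beta>: "\<beta> \<in> smooth_functions K" "closed C" "C \<subseteq> U" "\<And>y. y \<notin> C \<Longrightarrow> \<beta> y = 0"
  shows "(\<lambda>y. if y \<in> U then \<beta> y *\<^sub>R e j y else 0) \<in> sections A" (is "?s \<in> _")
proof (rule sections_coordI)
  show "?s x \<in> fibre A x" for x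
    by (simp add: subspace_scale[OF fibre_subspace] subspace_0[OF fibre_subspace] frame_mem[OF fr _ j])
  fix V e' i assume fr': "(V, e') \<in> frames A" and V: "open V" and i: "i < n"
  obtain g :: "nat \<Rightarrow> nat \<Rightarrow> 'm \<Rightarrow> real" where g: "\<And>i j. i < n \<Longrightarrow> j < n \<Longrightarrow> msmooth_on K (V \<inter> U) (g i j)"
    "\<And>j x. j < n \<Longrightarrow> x \<in> V \<Longrightarrow> x \<in> U \<Longrightarrow> e j x = (\<Sum>i<n. g i j x *\<^sub>R e' i x)"
    using frame_transition[OF fr' fr] by metis
  have "msmooth_on K V (\<lambda>y. if y \<in> U then \<beta> y *\<^sub>R g i j y else 0)"
    using g(1)[OF i j] by (intro msmooth_extend[OF \<beta> frame_open[OF fr] V]) (auto simp: Int_commute)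
  then show "msmooth_on K V (\<lambda>x. coord e' x (?s x) i)"
  proof (rule msmooth_cong[OF _ V])
    fix x assume x: "x \<in> V"
    show "(if x \<in> U then \<beta> x *\<^sub>R g i j x else 0) = coord e' x (?s x) i"
    proof (rule coord_eqI[OF fr' x _ i, symmetric])
      show "?s x = (\<Sum>i<n. (if x \<in> U then \<beta> x *\<^sub>R g i j x else 0) *\<^sub>R e' i x)"
        using g(2)[OF j x] by (auto simp: scaleR_sum_right)
    qed
  qed
qed

lemma section_through:
  assumes "v \<in> fibre A x"
  obtains s where "s \<in> sections A" "s x = v"
proof -
  obtain U e where fr: "(U, e) \<in> frames A" and x: "x \<in> U"
    using frame_cover by blast
  obtain \<beta> C where \<beta>: "\<beta> \<in> smooth_functions K" "closed C" "C \<subseteq> U" "\<beta> x = 1" "\<And>y. y \<notin> C \<Longrightarrow> \<beta> y = 0"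
    using exists_bump[OF frame_open[OF fr] x] by metis
  let ?s = "\<lambda>i y. if y \<in> U then \<beta> y *\<^sub>R e i y else 0"
  have "(\<lambda>y. \<Sum>i\<in>I. coord e x v i *\<^sub>R ?s i y) \<in> sections A" if "I \<subseteq> {..<n}" for I
    using finite_subset[OF that finite_lessThan] that
  proof (induction I)
    case empty
    then show ?case by (simp add: sections_zero)
  next
    case (insert i I)
    have "?s i \<in> sections A"
      using insert.prems section_bump_frame[OF fr _ \<beta>(1-3,5)] by simp
    then have "(\<lambda>y. coord e x v i *\<^sub>R ?s i y + (\<Sum>i\<in>I. coord e x v i *\<^sub>R ?s i y)) \<in> sections A"
      using insert by (intro sections_add sections_scale[OF smooth_const]) auto
    then show ?case using insert.hyps by simp
  qed
  moreover have "(\<Sum>i<n. coord e x v i *\<^sub>R ?s i x) = v"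
  proof -
    have "(\<Sum>i<n. coord e x v i *\<^sub>R ?s i x) = (\<Sum>i<n. coord e x v i *\<^sub>R e i x)"
      using x \<beta>(4) by simp
    also have "\<dots> = v" by (rule coord_sum[OF fr x assms, symmetric])
    finally show ?thesis .
  qed
  ultimately show ?thesis using that by blast
qed

text \<open>Hadamard-type decomposition, the reason why function-linear maps are tensors: a section that vanishes at \<open>x\<close> is a
  finite combination of global sections with coefficients vanishing at \<open>x\<close>. With \<open>\<beta>\<close> a bump function at \<open>x\<close> in the domain
  of a frame \<open>e\<close>, it is \<open>s = (1 - \<beta>\<^sup>2) s + (\<Sum>i. (\<beta> s\<^sub>i) (\<beta> e\<^sub>i))\<close>.\<close>

lemma section_vanishing_decomposition:
  assumes s: "s \<in> sections A" and "s x = 0"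
  obtains N f t where "\<And>i. i < N \<Longrightarrow> f i \<in> smooth_functions K" "\<And>i. i < N \<Longrightarrow> f i x = (0::real)"
    "\<And>i. i < N \<Longrightarrow> t i \<in> sections A" "s = (\<lambda>y. \<Sum>i<(N::nat). f i y *\<^sub>R t i y)"
proof -
  obtain U e where fr: "(U, e) \<in> frames A" and x: "x \<in> U"
    using frame_cover by blast
  obtain \<beta> C where \<beta>: "\<beta> \<in> smooth_functions K" "closed C" "C \<subseteq> U" "\<beta> x = 1" "\<And>y. y \<notin> C \<Longrightarrow> \<beta> y = 0"
    using exists_bump[OF frame_open[OF fr] x] by metis
  define f where "f i y = (if i < n then (if y \<in> U then \<beta> y *\<^sub>R coord e y (s y) i else 0)
    else 1 + (- 1) * (\<beta> y * \<beta> y))" for i y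
  define t where "t i y = (if i < n then (if y \<in> U then \<beta> y *\<^sub>R e i y else 0) else s y)" for i y
  have "f i \<in> smooth_functions K" if "i < Suc n" for i
  proof (cases "i < n")
    case True
    then show ?thesis
      using msmooth_extend[OF \<beta>(1-3,5) frame_open[OF fr] open_UNIV] section_coord_smooth[OF s fr True]
      unfolding f_def by (auto intro: smooth_functionsI)
  next
    case False
    then have "f i = (\<lambda>y. 1 + (- 1) * (\<beta> y * \<beta> y))"
      by (simp add: f_def[abs_def])
    then show ?thesis
      by (simp only:) (intro smooth_functionsI msmooth_add msmooth_const msmooth_mult smooth_functionsD[OF \<beta>(1)] open_UNIV)
  qed
  moreover have "f i x = 0" if "i < Suc n" for i
    using coord_eqI[OF fr x, of 0 "\<lambda>_. 0" i] assms(2) \<beta>(4) by (simp add: f_def)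
  moreover have "t i \<in> sections A" if "i < Suc n" for i
    using s section_bump_frame[OF fr _ \<beta>(1-3,5)] by (cases "i < n") (simp_all add: t_def[abs_def])
  moreover have "s = (\<lambda>y. \<Sum>i<Suc n. f i y *\<^sub>R t i y)"
  proof
    fix y
    have "(\<Sum>i<n. f i y *\<^sub>R t i y) = (\<beta> y * \<beta> y) *\<^sub>R s y"
    proof (cases "y \<in> U")
      case True
      have "(\<Sum>i<n. f i y *\<^sub>R t i y) = (\<beta> y * \<beta> y) *\<^sub>R (\<Sum>i<n. coord e y (s y) i *\<^sub>R e i y)"
        using True by (auto simp: f_def t_def scaleR_sum_right algebra_simps intro!: sum.cong)
      then show ?thesis
        by (simp only: coord_sum[OF fr True section_fibre[OF s], symmetric])
    next
      case False
      then show ?thesis using \<beta>(3,5) by (auto simp: f_def)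
    qed
    then show "s y = (\<Sum>i<Suc n. f i y *\<^sub>R t i y)"
      by (simp add: f_def t_def algebra_simps)
  qed
  ultimately show ?thesis by (rule that)
qed

lemma endomorphism_section:
  assumes T: "bundle_endomorphism A T" and s: "s \<in> sections A"
  shows "(\<lambda>x. T x (s x)) \<in> sections A"
proof -
  have lin: "T x (a *\<^sub>R u + b *\<^sub>R v) = a *\<^sub>R T x u + b *\<^sub>R T x v" if "u \<in> fibre A x" "v \<in> fibre A x" for x u v a b
    by (rule conjunct1[OF conjunct2[OF T[unfolded bundle_endomorphism_def]], rule_format]) (rule that)+
  have mem: "T x u \<in> fibre A x" if "u \<in> fibre A x" for x u
    by (rule conjunct1[OF T[unfolded bundle_endomorphism_def], rule_format]) (rule that)
  have sum: "T x (\<Sum>i\<in>I. c i *\<^sub>R f i) = (\<Sum>i\<in>I. c i *\<^sub>R T x (f i))" if "finite I" "\<And>i. i \<in> I \<Longrightarrow> f i \<in> fibre A x"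
    for x and I :: "nat set" and c f
    using that
  proof (induction I)
    case empty
    have "T x (0 *\<^sub>R 0 + 0 *\<^sub>R 0) = 0 *\<^sub>R T x 0 + 0 *\<^sub>R T x 0"
      by (intro lin subspace_0[OF fibre_subspace])
    then show ?case by simp
  next
    case (insert i I)
    have "T x (c i *\<^sub>R f i + 1 *\<^sub>R (\<Sum>i\<in>I. c i *\<^sub>R f i)) = c i *\<^sub>R T x (f i) + 1 *\<^sub>R T x (\<Sum>i\<in>I. c i *\<^sub>R f i)"
      using insert.prems by (intro lin fibre_sum) auto
    then show ?case
      using insert.IH insert.hyps insert.prems by simp
  qed
  show ?thesis
  proof (rule sections_coordI)
    show "T x (s x) \<in> fibre A x" for x
      by (intro mem section_fibre[OF s])
    fix U e i assume fr: "(U, e) \<in> frames A" and U: "open U" and i: "i < n"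
    have "\<exists>t. (\<forall>i<n. \<forall>j<n. msmooth_on K U (t i j :: 'm \<Rightarrow> real)) \<and>
        (\<forall>j<n. \<forall>x\<in>U. T x (e j x) = (\<Sum>i<n. t i j x *\<^sub>R e i x))"
      using bspec[OF conjunct2[OF conjunct2[OF T[unfolded bundle_endomorphism_def]]] fr] by (simp only: prod.case)
    then obtain t where t': "\<forall>i<n. \<forall>j<n. msmooth_on K U (t i j :: 'm \<Rightarrow> real)"
        "\<forall>j<n. \<forall>x\<in>U. T x (e j x) = (\<Sum>i<n. t i j x *\<^sub>R e i x)"
      by (elim exE conjE)
    then have t: "\<And>i j. i < n \<Longrightarrow> j < n \<Longrightarrow> msmooth_on K U (t i j)"
      "\<And>j x. j < n \<Longrightarrow> x \<in> U \<Longrightarrow> T x (e j x) = (\<Sum>i<n. t i j x *\<^sub>R e i x)"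
      by simp_all
    have "msmooth_on K U (\<lambda>x. \<Sum>j<n. coord e x (s x) j * t i j x)"
      by (intro msmooth_sum msmooth_mult U t(1)[OF i] section_coord_smooth[OF s fr]) auto
    then show "msmooth_on K U (\<lambda>x. coord e x (T x (s x)) i)"
    proof (rule msmooth_cong[OF _ U])
      fix x assume x: "x \<in> U"
      show "(\<Sum>j<n. coord e x (s x) j * t i j x) = coord e x (T x (s x)) i"
      proof (rule coord_eqI[OF fr x _ i, symmetric])
        have "T x (s x) = T x (\<Sum>j<n. coord e x (s x) j *\<^sub>R e j x)"
          by (rule arg_cong[OF coord_sum[OF fr x section_fibre[OF s]]])
        also have "\<dots> = (\<Sum>j<n. coord e x (s x) j *\<^sub>R T x (e j x))"
          using frame_mem[OF fr x] by (intro sum) auto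
        also have "\<dots> = (\<Sum>j<n. \<Sum>i<n. (coord e x (s x) j * t i j x) *\<^sub>R e i x)"
          using t(2) x by (simp add: scaleR_sum_right)
        also have "\<dots> = (\<Sum>i<n. (\<Sum>j<n. coord e x (s x) j * t i j x) *\<^sub>R e i x)"
          unfolding scaleR_sum_left by (rule sum.swap)
        finally show "T x (s x) = (\<Sum>i<n. (\<Sum>j<n. coord e x (s x) j * t i j x) *\<^sub>R e i x)" .
      qed
    qed
  qed
qed

end

section \<open>Alternating multilinear maps\<close>

lemma omit_Cons_0 [simp]: "omit 0 (x # xs) = xs"
  by (simp add: omit_def)

lemma omit_Cons_Suc [simp]: "omit (Suc i) (x # xs) = x # omit i xs"
  by (simp add: omit_def)

lemma length_omit: "i < length xs \<Longrightarrow> length (omit i xs) = length xs - 1"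
  by (simp add: omit_def)

lemma set_omit: "set (omit i xs) \<subseteq> set xs"
  by (auto simp: omit_def dest: in_set_takeD in_set_dropD)

lemma filter_omit:
  assumes "i < length ts"
  shows "length (filter P (omit i ts)) + (if P (ts ! i) then 1 else 0) = length (filter P ts)"
proof -
  have "length (filter P ts) = length (filter P (take i ts @ ts ! i # drop (Suc i) ts))"
    using id_take_nth_drop[OF assms] by simp
  then show ?thesis by (simp add: omit_def)
qed

lemma nth_omit_less: "i < j \<Longrightarrow> j < length ts \<Longrightarrow> omit j ts ! i = ts ! i"
  by (simp add: omit_def nth_append)

lemma list_all2_omit: "list_all2 P xs ys \<Longrightarrow> list_all2 P (omit i xs) (omit i ys)"
  unfolding omit_def by (intro list_all2_appendI list_all2_takeI list_all2_dropI)

text \<open>A module with carrier \<open>S\<close> over a ring with carrier \<open>R\<close>. The instances are the sections over the smooth functions and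
  the fibres over the complex numbers. The unit and distributive laws are required outside the carriers too, as they
  hold there in both instances.\<close>

locale module_on =
  fixes R :: "'f::comm_ring_1 set" and S :: "'a::ab_group_add set" and smul :: "'f \<Rightarrow> 'a \<Rightarrow> 'a"
  assumes R_one: "1 \<in> R" and R_add: "a \<in> R \<Longrightarrow> b \<in> R \<Longrightarrow> a + b \<in> R"
    and R_mult: "a \<in> R \<Longrightarrow> b \<in> R \<Longrightarrow> a * b \<in> R" and R_uminus: "a \<in> R \<Longrightarrow> - a \<in> R"
    and S_zero: "0 \<in> S" and S_add: "s \<in> S \<Longrightarrow> t \<in> S \<Longrightarrow> s + t \<in> S"
    and S_smul: "a \<in> R \<Longrightarrow> s \<in> S \<Longrightarrow> smul a s \<in> S"
    and smul_one: "smul 1 s = s"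
    and smul_add_left: "smul (a + b) s = smul a s + smul b s"
    and smul_add_right: "smul a (s + t) = smul a s + smul a t"
begin

lemma R_zero: "0 \<in> R"
  using R_add[OF R_one R_uminus[OF R_one]] by simp

lemma R_power_minus_one: "(- 1) ^ k \<in> R"
  by (induction k) (auto intro: R_mult R_one R_uminus)

lemma R_sum: "(\<And>x. x \<in> X \<Longrightarrow> f x \<in> R) \<Longrightarrow> sum f X \<in> R"
  by (induction X rule: infinite_finite_induct) (auto intro: R_zero R_add)

lemma smul_zero_left: "smul 0 s = 0"
  using smul_add_left[of 0 0 s] by simp

lemma smul_zero_right: "smul a 0 = 0"
  using smul_add_right[of a 0 0] by simp

lemma smul_uminus: "smul (- a) s = - smul a s"
  using smul_add_left[of a "- a" s] smul_zero_left[of s] by (simp add: eq_neg_iff_add_eq_0 add.commute)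

text \<open>\<open>F\<close> is an alternating \<open>R\<close>-multilinear map of \<open>r\<close> arguments, given as a list; its values at other lists are irrelevant.\<close>

definition alternating :: "nat \<Rightarrow> ('a list \<Rightarrow> 'f) \<Rightarrow> bool" where
  "alternating r F \<longleftrightarrow>
     (\<forall>ss. length ss = r \<and> set ss \<subseteq> S \<longrightarrow>
        F ss \<in> R \<and>
        (\<forall>k<r. \<forall>u\<in>S. \<forall>v\<in>S. \<forall>a\<in>R. \<forall>b\<in>R.
           F (ss[k := smul a u + smul b v]) = a * F (ss[k := u]) + b * F (ss[k := v])) \<and>
        (\<forall>j<r. \<forall>i<j. ss ! i = ss ! j \<longrightarrow> F ss = 0))"

lemma alternating_closed: "alternating r F \<Longrightarrow> length ss = r \<Longrightarrow> set ss \<subseteq> S \<Longrightarrow> F ss \<in> R"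
  by (simp add: alternating_def)

lemma alternating_linear:
  "alternating r F \<Longrightarrow> length ss = r \<Longrightarrow> set ss \<subseteq> S \<Longrightarrow> k < r \<Longrightarrow> u \<in> S \<Longrightarrow> v \<in> S \<Longrightarrow> a \<in> R \<Longrightarrow> b \<in> R \<Longrightarrow>
   F (ss[k := smul a u + smul b v]) = a * F (ss[k := u]) + b * F (ss[k := v])"
  by (simp add: alternating_def)

lemma alternating_repeat:
  "alternating r F \<Longrightarrow> length ss = r \<Longrightarrow> set ss \<subseteq> S \<Longrightarrow> j < r \<Longrightarrow> i < j \<Longrightarrow> ss ! i = ss ! j \<Longrightarrow> F ss = 0"
  by (simp add: alternating_def)

lemma alternating_add:
  assumes "alternating r F" "length ss = r" "set ss \<subseteq> S" "k < r" "u \<in> S" "v \<in> S"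
  shows "F (ss[k := u + v]) = F (ss[k := u]) + F (ss[k := v])"
  using alternating_linear[OF assms R_one R_one] by (simp add: smul_one)

lemma alternating_smul:
  assumes "alternating r F" "length ss = r" "set ss \<subseteq> S" "k < r" "u \<in> S" "a \<in> R"
  shows "F (ss[k := smul a u]) = a * F (ss[k := u])"
  using alternating_linear[OF assms(1-5,5,6) R_zero] by (simp add: smul_zero_left)

lemma alternating_zero_arg:
  assumes "alternating r F" "length ss = r" "set ss \<subseteq> S" "0 \<in> set ss"
  shows "F ss = 0"
proof -
  obtain k where k: "k < r" "ss ! k = 0"
    using assms(2,4) by (auto simp: in_set_conv_nth)
  have "F (ss[k := smul 0 0]) = 0"
    using alternating_smul[OF assms(1-3) k(1) S_zero R_zero] by simp
  then show ?thesis
    using k list_update_id[of ss k] by (simp add: smul_zero_left)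
qed

lemma set_update_subset: "set ss \<subseteq> S \<Longrightarrow> u \<in> S \<Longrightarrow> set (ss[k := u]) \<subseteq> S"
  using set_update_subset_insert[of ss k u] by blast

lemma alternating_swap:
  assumes F: "alternating r F" and ss: "length ss = r" "set ss \<subseteq> S" and ij: "i < j" "j < r"
    and uv: "u \<in> S" "v \<in> S"
  shows "F (ss[i := u, j := v]) = - F (ss[i := v, j := u])"
proof -
  have mem: "set (ss[i := x]) \<subseteq> S" "set (ss[j := x]) \<subseteq> S" if "x \<in> S" for x
    using set_update_subset[OF ss(2) that] by auto
  have vanish: "F (ss[i := x, j := x]) = 0" if "x \<in> S" for x
    using alternating_repeat[OF F, of "ss[i := x, j := x]" j i] ij ss set_update_subset mem that by simp
  have "0 = F (ss[i := u + v, j := u + v])"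
    using vanish S_add uv by simp
  also have "\<dots> = F (ss[i := u + v, j := u]) + F (ss[i := u + v, j := v])"
    using alternating_add[OF F, of "ss[i := u + v]" j u v] mem(1)[OF S_add[OF uv]] ij ss uv by simp
  also have "\<dots> = F (ss[i := u, j := v]) + F (ss[i := v, j := u])"
    using alternating_add[OF F, of "ss[j := u]" i u v] alternating_add[OF F, of "ss[j := v]" i u v]
      mem uv ij ss vanish by (simp add: list_update_swap)
  finally show ?thesis
    by (simp add: eq_neg_iff_add_eq_0)
qed

text \<open>If \<open>ss\<close> and \<open>vs\<close> have equal entries at \<open>i\<close> and \<open>j\<close>, the summands for \<open>k = i\<close> and \<open>k = j\<close> cancel and the other ones vanish.\<close>

lemma alternating_sum_replace_repeat:
  assumes F: "alternating r F" and ss: "length ss = r" "set ss \<subseteq> S" and ij: "i < j" "j < r"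
    and vs: "\<And>k. k < r \<Longrightarrow> vs k \<in> S" and eq: "ss ! i = ss ! j" "vs i = vs j"
  shows "(\<Sum>k<r. F (ss[k := vs k])) = 0"
proof -
  have "F (ss[k := vs k]) = 0" if "k < r" "k \<noteq> i" "k \<noteq> j" for k
    using alternating_repeat[OF F, of "ss[k := vs k]" j i] that ij ss vs eq set_update_subset by simp
  then have "(\<Sum>k<r. F (ss[k := vs k])) = (\<Sum>k\<in>{i, j}. F (ss[k := vs k]))"
    using ij by (intro sum.mono_neutral_right) auto
  also have "\<dots> = F (ss[i := vs i, j := ss ! j]) + F (ss[i := ss ! i, j := vs j])"
    using ij by simp (metis list_update_id list_update_swap nat_neq_iff)
  also have "\<dots> = 0"
  proof -
    have "ss ! j \<in> S" "vs i \<in> S"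
      using ss ij vs by auto
    then show ?thesis
      using alternating_swap[OF F ss ij, of "vs i" "ss ! j"] by (simp add: eq)
  qed
  finally show ?thesis .
qed

lemma alternating_move_front:
  assumes F: "alternating (Suc (length as + length bs)) F"
    and S: "set as \<subseteq> S" "set bs \<subseteq> S" "v \<in> S"
  shows "F (as @ v # bs) = (- 1) ^ length as * F (v # as @ bs)"
  using assms
proof (induction as arbitrary: bs rule: rev_induct)
  case Nil
  then show ?case by simp
next
  case (snoc a as)
  have "F ((as @ [a]) @ v # bs) = F ((as @ a # v # bs)[length as := a, Suc (length as) := v])"
    by (simp add: list_update_append)
  also have "\<dots> = - F ((as @ a # v # bs)[length as := v, Suc (length as) := a])"
    using snoc.prems by (intro alternating_swap[OF snoc.prems(1)]) auto
  also have "(as @ a # v # bs)[length as := v, Suc (length as) := a] = as @ v # (a # bs)"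
    by (simp add: list_update_append)
  also have "F (as @ v # (a # bs)) = (- 1) ^ length as * F (v # as @ a # bs)"
    using snoc.prems by (intro snoc.IH) auto
  finally show ?case by simp
qed

lemma alternating_update_front:
  assumes F: "alternating r F" and ss: "length ss = r" "set ss \<subseteq> S" "k < r" and v: "v \<in> S"
  shows "F (ss[k := v]) = (- 1) ^ k * F (v # omit k ss)"
proof -
  have "set (take k ss) \<subseteq> S" "set (drop (Suc k) ss) \<subseteq> S"
    using ss by (auto dest: in_set_takeD in_set_dropD)
  then show ?thesis
    using alternating_move_front[of "take k ss" "drop (Suc k) ss" F v] F ss v
    by (simp add: upd_conv_take_nth_drop omit_def min_def)
qed

lemma alternating_swap_front:
  assumes "alternating r F" "Suc (Suc (length ts)) = r" "set ts \<subseteq> S" "u \<in> S" "v \<in> S"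
  shows "F (u # v # ts) = - F (v # u # ts)"
  using alternating_swap[OF assms(1), of "u # v # ts" 0 1 u v] assms by simp

lemma S_sum: "(\<And>i. i \<in> I \<Longrightarrow> v i \<in> S) \<Longrightarrow> sum v I \<in> S"
  by (induction I rule: infinite_finite_induct) (auto intro: S_zero S_add)

lemma alternating_sum_arg:
  assumes F: "alternating r F" and ss: "length ss = r" "set ss \<subseteq> S" "k < r"
    and I: "finite I" "\<And>i. i \<in> I \<Longrightarrow> c i \<in> R" "\<And>i. i \<in> I \<Longrightarrow> v i \<in> S"
  shows "F (ss[k := \<Sum>i\<in>I. smul (c i) (v i)]) = (\<Sum>i\<in>I. c i * F (ss[k := v i]))"
  using I
proof (induction I)
  case empty
  then show ?case
    using alternating_smul[OF F ss S_zero R_zero] by (simp add: smul_zero_left)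
next
  case (insert i I)
  have "(\<Sum>i\<in>I. smul (c i) (v i)) \<in> S"
    using insert.prems by (intro S_sum S_smul) auto
  then show ?case
    using insert alternating_linear[OF F ss, of "v i" "\<Sum>i\<in>I. smul (c i) (v i)" "c i" 1] R_one
    by (simp add: smul_one)
qed

lemma alternating_map_smul:
  assumes F: "alternating r F" and "length us + length ws = r" "set us \<subseteq> S" "set ws \<subseteq> S" "c \<in> R"
  shows "F (map (smul c) us @ ws) = c ^ length us * F (us @ ws)"
  using assms(2-4)
proof (induction us arbitrary: ws rule: rev_induct)
  case Nil
  then show ?case by simp
next
  case (snoc u us)
  have "F (map (smul c) us @ (smul c u # ws)) = c ^ length us * F (us @ (smul c u # ws))"
    using snoc.prems assms(5) by (intro snoc.IH) (auto intro: S_smul)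
  also have "F (us @ (smul c u # ws)) = c * F (us @ u # ws)"
    using alternating_smul[OF F, of "us @ u # ws" "length us" u c] snoc.prems assms(5) by simp
  finally show ?case by (simp add: mult.assoc)
qed

lemma alternating_lincomb:
  assumes "alternating r F" "alternating r G" "a \<in> R" "b \<in> R"
  shows "alternating r (\<lambda>ss. a * F ss + b * G ss)"
  unfolding alternating_def
proof (intro allI impI conjI ballI)
  fix ss assume ss: "length ss = r \<and> set ss \<subseteq> S"
  show "a * F ss + b * G ss \<in> R"
    using ss by (intro R_add R_mult assms(3,4) alternating_closed[OF assms(1)] alternating_closed[OF assms(2)]) auto
  fix k assume k: "k < r"
  show "a * F (ss[k := smul c u + smul c' v]) + b * G (ss[k := smul c u + smul c' v]) =
      c * (a * F (ss[k := u]) + b * G (ss[k := u])) + c' * (a * F (ss[k := v]) + b * G (ss[k := v]))"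
    if "u \<in> S" "v \<in> S" "c \<in> R" "c' \<in> R" for u v c c'
    using alternating_linear[OF assms(1), of ss k u v c c'] alternating_linear[OF assms(2), of ss k u v c c'] ss k that
    by (simp add: algebra_simps)
  show "a * F ss + b * G ss = 0" if "i < k" "ss ! i = ss ! k" for i
    using alternating_repeat[OF assms(1), of ss k i] alternating_repeat[OF assms(2), of ss k i] ss k that by simp
qed

text \<open>The derivation of the exterior algebra that extends the transpose of an endomorphism \<open>T\<close>.\<close>

lemma alternating_derivation:
  assumes F: "alternating r F" and T: "\<And>u. u \<in> S \<Longrightarrow> T u \<in> S"
    and T_linear: "\<And>u v a b. u \<in> S \<Longrightarrow> v \<in> S \<Longrightarrow> a \<in> R \<Longrightarrow> b \<in> R \<Longrightarrow>
      T (smul a u + smul b v) = smul a (T u) + smul b (T v)"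
  shows "alternating r (\<lambda>ss. \<Sum>k<r. F (ss[k := T (ss ! k)]))"
  unfolding alternating_def
proof (intro allI impI conjI ballI)
  fix ss assume ss: "length ss = r \<and> set ss \<subseteq> S"
  have nth: "ss ! k \<in> S" if "k < r" for k
    using ss that by auto
  show "(\<Sum>k<r. F (ss[k := T (ss ! k)])) \<in> R"
    using ss nth T set_update_subset by (intro R_sum alternating_closed[OF F]) auto
  fix m assume m: "m < r"
  show "(\<Sum>k<r. F (ss[m := smul a u + smul b v, k := T (ss[m := smul a u + smul b v] ! k)])) =
      a * (\<Sum>k<r. F (ss[m := u, k := T (ss[m := u] ! k)])) + b * (\<Sum>k<r. F (ss[m := v, k := T (ss[m := v] ! k)]))"
    if uv: "u \<in> S" "v \<in> S" "a \<in> R" "b \<in> R" for u v a b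
  proof -
    have "F (ss[m := smul a u + smul b v, k := T (ss[m := smul a u + smul b v] ! k)]) =
      a * F (ss[m := u, k := T (ss[m := u] ! k)]) + b * F (ss[m := v, k := T (ss[m := v] ! k)])" if k: "k < r" for k
    proof (cases "k = m")
      case True
      then show ?thesis
        using alternating_linear[OF F, of ss m "T u" "T v" a b] T uv ss m by (simp add: T_linear)
    next
      case False
      then show ?thesis
        using alternating_linear[OF F, of "ss[k := T (ss ! k)]" m u v a b] T[OF nth[OF k]] uv ss m set_update_subset
        by (simp add: list_update_swap[of m k])
    qed
    then show ?thesis
      by (simp add: sum.distrib sum_distrib_left)
  qed
  show "(\<Sum>k<r. F (ss[k := T (ss ! k)])) = 0" if "i < m" "ss ! i = ss ! m" for i
    using ss m that T nth by (intro alternating_sum_replace_repeat[OF F, of ss i m]) auto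
qed

lemma alternating_contract:
  assumes F: "alternating (Suc r) F" and s: "s \<in> S"
  shows "alternating r (\<lambda>ts. F (s # ts))"
  unfolding alternating_def
proof (intro allI impI conjI ballI)
  fix ss assume ss: "length ss = r \<and> set ss \<subseteq> S"
  show "F (s # ss) \<in> R"
    using alternating_closed[OF F] ss s by simp
  fix k assume k: "k < r"
  show "F (s # ss[k := smul a u + smul b v]) = a * F (s # ss[k := u]) + b * F (s # ss[k := v])"
    if "u \<in> S" "v \<in> S" "a \<in> R" "b \<in> R" for u v a b
    using alternating_linear[OF F, of "s # ss" "Suc k" u v a b] ss s k that by simp
  show "F (s # ss) = 0" if "i < k" "ss ! i = ss ! k" for i
    using alternating_repeat[OF F, of "s # ss" "Suc k" "Suc i"] ss s k that by simp
qed

end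


section \<open>The Chevalley--Eilenberg differential\<close>

text \<open>Sections \<open>S\<close> acting on functions \<open>R\<close> by derivations, with a bracket that satisfies the Leibniz rule. That the
  differential of a form is a form depends neither on the Jacobi identity nor on the compatibility of the action
  with the bracket.\<close>

locale lie_rinehart = module_on R S smul
  for R :: "'f::comm_ring_1 set" and S :: "'a::ab_group_add set" and smul +
  fixes act :: "'a \<Rightarrow> 'f \<Rightarrow> 'f" and br :: "'a \<Rightarrow> 'a \<Rightarrow> 'a"
  assumes act_closed: "s \<in> S \<Longrightarrow> f \<in> R \<Longrightarrow> act s f \<in> R"
    and act_linear_left: "s \<in> S \<Longrightarrow> t \<in> S \<Longrightarrow> a \<in> R \<Longrightarrow> b \<in> R \<Longrightarrow> f \<in> R \<Longrightarrow>
          act (smul a s + smul b t) f = a * act s f + b * act t f"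
    and act_add: "s \<in> S \<Longrightarrow> f \<in> R \<Longrightarrow> g \<in> R \<Longrightarrow> act s (f + g) = act s f + act s g"
    and act_mult: "s \<in> S \<Longrightarrow> f \<in> R \<Longrightarrow> g \<in> R \<Longrightarrow> act s (f * g) = act s f * g + f * act s g"
    and br_closed: "s \<in> S \<Longrightarrow> t \<in> S \<Longrightarrow> br s t \<in> S"
    and br_add_left: "s \<in> S \<Longrightarrow> t \<in> S \<Longrightarrow> u \<in> S \<Longrightarrow> br (s + t) u = br s u + br t u"
    and br_add_right: "s \<in> S \<Longrightarrow> t \<in> S \<Longrightarrow> u \<in> S \<Longrightarrow> br u (s + t) = br u s + br u t"
    and br_self: "s \<in> S \<Longrightarrow> br s s = 0"
    and br_smul_right: "s \<in> S \<Longrightarrow> t \<in> S \<Longrightarrow> f \<in> R \<Longrightarrow> br s (smul f t) = smul f (br s t) + smul (act s f) t"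
begin

lemma br_swap: "s \<in> S \<Longrightarrow> t \<in> S \<Longrightarrow> br s t = - br t s"
  using br_self[of "s + t"] br_add_left[of s t "s + t"] br_add_right[of s t s] br_add_right[of s t t]
    br_self[of s] br_self[of t] S_add[of s t]
  by (simp add: eq_neg_iff_add_eq_0 add.commute)

lemma br_smul_left:
  assumes "s \<in> S" "t \<in> S" "f \<in> R"
  shows "br (smul f s) t = smul f (br s t) - smul (act t f) s"
proof -
  have "br (smul f s) t = - (smul f (br t s) + smul (act t f) s)"
    using br_swap[of "smul f s" t] br_smul_right[of t s f] assms S_smul by simp
  also have "smul f (br t s) = - smul f (br s t)"
    using smul_add_right[of f "br t s" "br s t"] smul_zero_right[of f] br_swap[OF assms(2,1)]
    by (metis eq_neg_iff_add_eq_0)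
  finally show ?thesis by simp
qed

text \<open>The differential of an alternating map, by the formula of \<^const>\<open>dE\<close>.\<close>

definition d :: "('a list \<Rightarrow> 'f) \<Rightarrow> 'a list \<Rightarrow> 'f" where
  "d F ss = (\<Sum>i<length ss. (- 1) ^ i * act (ss ! i) (F (omit i ss)))
     + (\<Sum>j<length ss. \<Sum>i<j. (- 1) ^ (i + j) * F (br (ss ! i) (ss ! j) # omit i (omit j ss)))"

lemma d_Cons_front:
  "d F (s # ss) = act s (F ss) - (\<Sum>k<length ss. (- 1) ^ k * F (br s (ss ! k) # omit k ss))
     - ((\<Sum>i<length ss. (- 1) ^ i * act (ss ! i) (F (s # omit i ss)))
        - (\<Sum>j<length ss. \<Sum>i<j. (- 1) ^ (i + j) * F (br (ss ! i) (ss ! j) # s # omit i (omit j ss))))"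
  unfolding d_def
  by (simp only: length_Cons sum.lessThan_Suc_shift)
    (simp add: sum.distrib sum_negf sum_subtractf algebra_simps)

text \<open>Cartan's formula \<open>\<iota>\<^sub>s d F = L\<^sub>s F - d (\<iota>\<^sub>s F)\<close>. It allows inductions on the degree, because \<open>\<iota>\<^sub>s F\<close> is again an alternating
  map.\<close>

lemma d_Cons:
  assumes F: "alternating (length ss) F" and S: "s \<in> S" "set ss \<subseteq> S"
  shows "d F (s # ss) = act s (F ss) - (\<Sum>k<length ss. F (ss[k := br s (ss ! k)])) - d (\<lambda>ts. F (s # ts)) ss"
proof -
  have nth: "ss ! k \<in> S" if "k < length ss" for k
    using S that by auto
  have om: "length (omit i (omit j ss)) = length ss - 2" "set (omit i (omit j ss)) \<subseteq> S"
    if "i < j" "j < length ss" for i j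
    using that S set_omit[of j ss] set_omit[of i "omit j ss"] by (auto simp: length_omit)
  have "(\<Sum>k<length ss. F (ss[k := br s (ss ! k)])) = (\<Sum>k<length ss. (- 1) ^ k * F (br s (ss ! k) # omit k ss))"
    using F S nth by (intro sum.cong refl alternating_update_front br_closed) auto
  moreover have "F (br (ss ! i) (ss ! j) # s # omit i (omit j ss)) = - F (s # br (ss ! i) (ss ! j) # omit i (omit j ss))"
    if "i < j" "j < length ss" for i j
    using om[OF that] that S nth by (intro alternating_swap_front[OF F] br_closed) auto
  then have "(\<Sum>j<length ss. \<Sum>i<j. (- 1) ^ (i + j) * F (br (ss ! i) (ss ! j) # s # omit i (omit j ss)))
      = - (\<Sum>j<length ss. \<Sum>i<j. (- 1) ^ (i + j) * F (s # br (ss ! i) (ss ! j) # omit i (omit j ss)))"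
    unfolding sum_negf[symmetric] by (intro sum.cong refl) auto
  ultimately show ?thesis
    unfolding d_Cons_front by (simp add: d_def)
qed

lemma d_cong:
  assumes "\<And>ts. length ts = r \<Longrightarrow> set ts \<subseteq> S \<Longrightarrow> F ts = G ts" "length ss = Suc r" "set ss \<subseteq> S"
  shows "d F ss = d G ss"
proof -
  have "F (omit i ss) = G (omit i ss)" if "i < length ss" for i
    using that assms set_omit[of i ss] by (intro assms(1)) (auto simp: length_omit)
  moreover have "F (br (ss ! i) (ss ! j) # omit i (omit j ss)) = G (br (ss ! i) (ss ! j) # omit i (omit j ss))"
    if "i < j" "j < length ss" for i j
  proof (intro assms(1))
    have "ss ! i \<in> S" "ss ! j \<in> S"
      using that assms by auto
    then show "set (br (ss ! i) (ss ! j) # omit i (omit j ss)) \<subseteq> S"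
      using that assms(3) set_omit[of j ss] set_omit[of i "omit j ss"] br_closed by auto
  qed (use that assms in \<open>auto simp: length_omit\<close>)
  ultimately show ?thesis
    by (simp add: d_def)
qed

lemma d_linear_form:
  assumes F: "alternating r F" and G: "alternating r G" and ab: "a \<in> R" "b \<in> R"
    and ss: "length ss = Suc r" "set ss \<subseteq> S"
  shows "d (\<lambda>ts. a * F ts + b * G ts) ss = a * d F ss + b * d G ss
     + (\<Sum>i<length ss. (- 1) ^ i * (act (ss ! i) a * F (omit i ss) + act (ss ! i) b * G (omit i ss)))"
proof -
  have "act (ss ! i) (a * F (omit i ss) + b * G (omit i ss)) =
      act (ss ! i) a * F (omit i ss) + a * act (ss ! i) (F (omit i ss))
      + (act (ss ! i) b * G (omit i ss) + b * act (ss ! i) (G (omit i ss)))" if "i < length ss" for i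
  proof -
    have "F (omit i ss) \<in> R" "G (omit i ss) \<in> R" "ss ! i \<in> S"
      using that ss set_omit[of i ss] alternating_closed[OF F] alternating_closed[OF G]
      by (auto simp: length_omit)
    then show ?thesis
      using ab by (simp add: act_add act_mult R_mult)
  qed
  then show ?thesis
    by (simp add: d_def sum.distrib sum_distrib_left algebra_simps)
qed

lemma d_closed:
  assumes F: "alternating r F" and ss: "length ss = Suc r" "set ss \<subseteq> S"
  shows "d F ss \<in> R"
proof -
  have "F (omit i ss) \<in> R" "ss ! i \<in> S" if "i < length ss" for i
    using that ss set_omit[of i ss] alternating_closed[OF F] by (auto simp: length_omit)
  moreover have "F (br (ss ! i) (ss ! j) # omit i (omit j ss)) \<in> R"
    if "i < j" "j < length ss" for i j
  proof (rule alternating_closed[OF F])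
    have "ss ! i \<in> S" "ss ! j \<in> S"
      using that ss by auto
    then show "set (br (ss ! i) (ss ! j) # omit i (omit j ss)) \<subseteq> S"
      using that ss set_omit[of j ss] set_omit[of i "omit j ss"] br_closed by auto
  qed (use that ss in \<open>auto simp: length_omit\<close>)
  ultimately show ?thesis
    unfolding d_def by (intro R_add R_sum R_mult R_power_minus_one act_closed) auto
qed

text \<open>Linearity in the first argument, where derivatives of the coefficients occur twice: in the Leibniz rule for the
  brackets and in \<open>d (a \<iota>\<^sub>u F + b \<iota>\<^sub>v F)\<close>. They cancel.\<close>

lemma d_linear_head:
  assumes F: "alternating r F" and ss: "length ss = r" "set ss \<subseteq> S"
    and uv: "u \<in> S" "v \<in> S" and ab: "a \<in> R" "b \<in> R"
  shows "d F ((smul a u + smul b v) # ss) = a * d F (u # ss) + b * d F (v # ss)"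
proof -
  let ?w = "smul a u + smul b v"
  have w: "smul a u \<in> S" "smul b v \<in> S" "?w \<in> S"
    using uv ab S_add S_smul by auto
  have nth: "ss ! k \<in> S" if "k < r" for k
    using ss that by auto
  have L: "F (ss[k := br ?w (ss ! k)]) =
      a * F (ss[k := br u (ss ! k)]) + b * F (ss[k := br v (ss ! k)])
      - (- 1) ^ k * (act (ss ! k) a * F (u # omit k ss) + act (ss ! k) b * F (v # omit k ss))"
    if k: "k < r" for k
  proof -
    let ?t = "ss ! k"
    have "br ?w ?t = smul a (br u ?t) + smul b (br v ?t)
        + (smul (- act ?t a) u + smul (- act ?t b) v)"
      using w uv ab nth[OF k] by (simp add: br_add_left br_smul_left smul_uminus)
    then have "F (ss[k := br ?w ?t]) = F (ss[k := smul a (br u ?t) + smul b (br v ?t)])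
        + F (ss[k := smul (- act ?t a) u + smul (- act ?t b) v])"
      using alternating_add[OF F ss k] k ab uv nth br_closed act_closed S_smul S_add R_uminus by simp
    also have "\<dots> = a * F (ss[k := br u ?t]) + b * F (ss[k := br v ?t])
        + (- act ?t a * F (ss[k := u]) + - act ?t b * F (ss[k := v]))"
      using alternating_linear[OF F ss k] k ab uv nth br_closed act_closed R_uminus by simp
    finally show ?thesis
      using alternating_update_front[OF F ss k] uv by (simp add: algebra_simps)
  qed
  have dL: "d (\<lambda>ts. F (?w # ts)) ss = a * d (\<lambda>ts. F (u # ts)) ss + b * d (\<lambda>ts. F (v # ts)) ss
     + (\<Sum>i<length ss. (- 1) ^ i * (act (ss ! i) a * F (u # omit i ss) + act (ss ! i) b * F (v # omit i ss)))"
  proof (cases r)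
    case 0
    then show ?thesis using ss by (simp add: d_def)
  next
    case (Suc n)
    have "F (?w # ts) = a * F (u # ts) + b * F (v # ts)" if "length ts = n" "set ts \<subseteq> S" for ts
      using alternating_linear[OF F, of "u # ts" 0 u v a b] that uv ab Suc by simp
    then have "d (\<lambda>ts. F (?w # ts)) ss = d (\<lambda>ts. a * F (u # ts) + b * F (v # ts)) ss"
      using ss Suc by (intro d_cong[of n]) auto
    also note d_linear_form[OF alternating_contract alternating_contract ab, of n F u F v ss]
    finally show ?thesis using F ss uv Suc by simp
  qed
  have du: "d F (u # ss) = act u (F ss) - (\<Sum>k<r. F (ss[k := br u (ss ! k)])) - d (\<lambda>ts. F (u # ts)) ss"
    and dv: "d F (v # ss) = act v (F ss) - (\<Sum>k<r. F (ss[k := br v (ss ! k)])) - d (\<lambda>ts. F (v # ts)) ss"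
    using d_Cons[of ss F] F ss uv by auto
  have "F ss \<in> R" using alternating_closed[OF F ss] .
  then have "d F (?w # ss) = a * act u (F ss) + b * act v (F ss)
      - (\<Sum>k<r. F (ss[k := br ?w (ss ! k)])) - d (\<lambda>ts. F (?w # ts)) ss"
    using d_Cons[of ss F ?w] F ss w act_linear_left[OF uv ab] by simp
  also have "(\<Sum>k<r. F (ss[k := br ?w (ss ! k)])) =
      a * (\<Sum>k<r. F (ss[k := br u (ss ! k)])) + b * (\<Sum>k<r. F (ss[k := br v (ss ! k)]))
      - (\<Sum>k<r. (- 1) ^ k * (act (ss ! k) a * F (u # omit k ss) + act (ss ! k) b * F (v # omit k ss)))"
    using L by (simp add: sum.distrib sum_subtractf sum_distrib_left)
  finally show ?thesis
    unfolding du dv dL using ss by (simp add: algebra_simps)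
qed

text \<open>Linearity in every argument. In the induction step the derivatives of the coefficients come from the two parts of the
  Lie derivative and cancel.\<close>

lemma d_linear:
  assumes F: "alternating r F" and ss: "length ss = Suc r" "set ss \<subseteq> S" and k: "k < Suc r"
    and uv: "u \<in> S" "v \<in> S" and ab: "a \<in> R" "b \<in> R"
  shows "d F (ss[k := smul a u + smul b v]) = a * d F (ss[k := u]) + b * d F (ss[k := v])"
  using F ss k
proof (induction r arbitrary: F ss k)
  case 0
  then obtain s where "ss = [s]" "k = 0"
    by (cases ss) auto
  then show ?case
    using d_linear_head[OF 0(1), of "[]"] uv ab by simp
next
  case (Suc n)
  obtain s ts where st: "ss = s # ts"
    using Suc.prems by (cases ss) auto
  have S: "s \<in> S" "length ts = Suc n" "set ts \<subseteq> S"
    using Suc.prems st by auto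
  show ?case
  proof (cases k)
    case 0
    then show ?thesis
      using d_linear_head[OF Suc.prems(1) S(2,3) uv ab] st by simp
  next
    case (Suc m)
    have m: "m < Suc n" using Suc \<open>k < Suc (Suc n)\<close> by simp
    let ?w = "smul a u + smul b v"
    have w: "?w \<in> S" using uv ab S_add S_smul by auto
    have nth: "ts ! j \<in> S" if "j < Suc n" for j
      using S that by auto
    note F = Suc.prems(1)
    note upd = alternating_linear[OF F] alternating_closed[OF F]
    have dC: "d F (s # ts[m := x]) = act s (F (ts[m := x]))
       - (\<Sum>j<Suc n. F (ts[m := x, j := br s (ts[m := x] ! j)])) - d (\<lambda>us. F (s # us)) (ts[m := x])"
      if "x \<in> S" for x
      using d_Cons[of "ts[m := x]" F s] F S that set_update_subset by simp
    have A: "act s (F (ts[m := ?w])) = a * act s (F (ts[m := u])) + b * act s (F (ts[m := v]))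
        + (act s a * F (ts[m := u]) + act s b * F (ts[m := v]))"
      using upd(1)[OF S(2,3) m uv ab] upd(2)[of "ts[m := u]"] upd(2)[of "ts[m := v]"] S uv ab set_update_subset
      by (simp add: act_add act_mult R_mult algebra_simps)
    have L: "F (ts[m := ?w, j := br s (ts[m := ?w] ! j)]) =
        a * F (ts[m := u, j := br s (ts[m := u] ! j)]) + b * F (ts[m := v, j := br s (ts[m := v] ! j)])
        + (if j = m then act s a * F (ts[m := u]) + act s b * F (ts[m := v]) else 0)"
      if j: "j < Suc n" for j
    proof (cases "j = m")
      case True
      have "br s ?w = (smul a (br s u) + smul b (br s v)) + (smul (act s a) u + smul (act s b) v)"
        using uv ab S S_smul by (simp add: br_add_right br_smul_right)
      then have "F (ts[m := br s ?w]) = F (ts[m := smul a (br s u) + smul b (br s v)])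
          + F (ts[m := smul (act s a) u + smul (act s b) v])"
        using alternating_add[OF F S(2,3) m] ab uv S br_closed act_closed S_smul S_add by simp
      then show ?thesis
        using True m S upd(1)[OF S(2,3) m] ab uv br_closed act_closed by simp
    next
      case False
      have "F (ts[j := br s (ts ! j), m := ?w]) = a * F (ts[j := br s (ts ! j), m := u]) + b * F (ts[j := br s (ts ! j), m := v])"
        using upd(1)[of "ts[j := br s (ts ! j)]" m] m S uv ab set_update_subset br_closed nth[OF j] by simp
      then show ?thesis
        using False by (simp add: list_update_swap[of m j])
    qed
    have IH: "d (\<lambda>us. F (s # us)) (ts[m := ?w]) =
        a * d (\<lambda>us. F (s # us)) (ts[m := u]) + b * d (\<lambda>us. F (s # us)) (ts[m := v])"
      using Suc.IH[OF alternating_contract[OF F S(1)] S(2,3) m] .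
    have "(\<Sum>j<Suc n. F (ts[m := ?w, j := br s (ts[m := ?w] ! j)])) =
        a * (\<Sum>j<Suc n. F (ts[m := u, j := br s (ts[m := u] ! j)]))
        + b * (\<Sum>j<Suc n. F (ts[m := v, j := br s (ts[m := v] ! j)]))
        + (act s a * F (ts[m := u]) + act s b * F (ts[m := v]))"
    proof -
      have "(\<Sum>j<Suc n. F (ts[m := ?w, j := br s (ts[m := ?w] ! j)])) = (\<Sum>j<Suc n.
         a * F (ts[m := u, j := br s (ts[m := u] ! j)]) + b * F (ts[m := v, j := br s (ts[m := v] ! j)])
        + (if j = m then act s a * F (ts[m := u]) + act s b * F (ts[m := v]) else 0))"
        using L by (intro sum.cong) auto
      also have "\<dots> = (\<Sum>j<Suc n. a * F (ts[m := u, j := br s (ts[m := u] ! j)]))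
        + (\<Sum>j<Suc n. b * F (ts[m := v, j := br s (ts[m := v] ! j)]))
        + (act s a * F (ts[m := u]) + act s b * F (ts[m := v]))"
        unfolding sum.distrib using m by (subst sum.delta) auto
      finally show ?thesis by (simp only: sum_distrib_left)
    qed
    then show ?thesis
      unfolding st Suc list_update_code dC[OF w] dC[OF uv(1)] dC[OF uv(2)] A IH
      by (simp only:) (simp only: algebra_simps)
  qed
qed

lemma d_repeat_head:
  assumes F: "alternating (Suc r) F" and us: "length us = r" "set us \<subseteq> S" and s: "s \<in> S"
  shows "d F (s # s # us) = 0"
proof -
  note Fs = alternating_contract[OF F s]
  have "F (s # s # ts) = 0" if "Suc (length ts) = r" "set ts \<subseteq> S" for ts
    using alternating_repeat[OF F, of "s # s # ts" 1 0] that s by simp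
  then have dd: "d (\<lambda>ts. F (s # s # ts)) us = 0"
  proof (cases r)
    case 0
    then show ?thesis using us by (simp add: d_def)
  next
    case (Suc n)
    have "act t 0 = 0" if "t \<in> S" for t
      using act_add[of t 0 0] that R_zero by simp
    then have "d (\<lambda>ts. 0) us = 0"
      using us by (auto simp: d_def subset_iff intro!: sum.neutral)
    then show ?thesis
      using d_cong[of n "\<lambda>ts. F (s # s # ts)" "\<lambda>ts. 0" us] Suc us
        \<open>\<And>ts. Suc (length ts) = r \<Longrightarrow> set ts \<subseteq> S \<Longrightarrow> F (s # s # ts) = 0\<close> by simp
  qed
  have "F (br s s # us) = 0"
    using alternating_zero_arg[OF F, of "0 # us"] br_self[OF s] us S_zero by simp
  then have "(\<Sum>k<length (s # us). F ((s # us)[k := br s ((s # us) ! k)])) = (\<Sum>k<length us. F (s # us[k := br s (us ! k)]))"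
    by (simp only: length_Cons sum.lessThan_Suc_shift) simp
  then show ?thesis
    using d_Cons[of "s # us" F s] d_Cons[of us "\<lambda>ts. F (s # ts)" s] F Fs us s dd by simp
qed

text \<open>Repeated arguments are treated by induction on the degree. If the first argument is not repeated, Cartan's formula
  applies; if it is, the second occurrence is moved to the second place, using that \<open>d F\<close> is already known to be
  alternating in the remaining arguments.\<close>

theorem d_alternating:
  assumes "alternating r F"
  shows "alternating (Suc r) (d F)"
proof -
  have vanish: "d F ss = 0" if "alternating r F" "length ss = Suc r" "set ss \<subseteq> S" "i < j" "j < Suc r" "ss ! i = ss ! j"
    for ss i j r F
    using that
  proof (induction r arbitrary: F ss i j)
    case 0
    then show ?case by simp
  next
    case (Suc n)
    obtain s ts where st: "ss = s # ts"
      using Suc.prems by (cases ss) auto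
    have S: "s \<in> S" "length ts = Suc n" "set ts \<subseteq> S"
      using Suc.prems st by auto
    note F = Suc.prems(1)
    note Fs = alternating_contract[OF F S(1)]
    have tail: "d F (s # us) = 0"
      if us: "length us = Suc n" "set us \<subseteq> S" and kl: "k < l" "l < Suc n" "us ! k = us ! l" for us k l
    proof -
      have "us ! k \<in> S" "us ! l \<in> S" using us kl by auto
      have "(\<Sum>m<Suc n. F (us[m := br s (us ! m)])) = 0"
        using us kl S by (intro alternating_sum_replace_repeat[OF F us kl(1,2)] br_closed) auto
      moreover have "F us = 0"
        using alternating_repeat[OF F us kl(2,1,3)] .
      moreover have "d (\<lambda>ts. F (s # ts)) us = 0"
        using Suc.IH[OF Fs us kl] .
      moreover have "act s 0 = 0"
        using act_add[of s 0 0] S R_zero by simp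
      ultimately show ?thesis
        using d_Cons[of us F s] F us S by simp
    qed
    show ?case
    proof (cases i)
      case (Suc i')
      then show ?thesis
        using tail[OF S(2,3), of i' "j - 1"] Suc.prems st by (cases j) auto
    next
      case 0
      obtain j' where j: "j = Suc j'" using Suc.prems by (cases j) auto
      have sj: "ts ! j' = s" "j' < Suc n" using 0 j st Suc.prems by auto
      show ?thesis
      proof (cases j')
        case 0
        then obtain us where "ts = s # us" using sj S by (cases ts) auto
        then show ?thesis
          using d_repeat_head[OF F, of us s] S st by simp
      next
        case (Suc m)
        define G where "G us = d F (s # us)" for us
        have G: "alternating (Suc n) G"
          unfolding alternating_def
        proof (intro allI impI conjI ballI)
          fix us assume us: "length us = Suc n \<and> set us \<subseteq> S"
          show "G us \<in> R"
            using d_closed[OF F, of "s # us"] us S by (simp add: G_def)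
          fix k assume k: "k < Suc n"
          show "G (us[k := smul a u + smul b v]) = a * G (us[k := u]) + b * G (us[k := v])"
            if "u \<in> S" "v \<in> S" "a \<in> R" "b \<in> R" for u v a b
            using d_linear[OF F, of "s # us" "Suc k" u v a b] us S k that by (simp add: G_def)
          show "G us = 0" if "i < k" "us ! i = us ! k" for i
            using tail[of us i k] us k that by (simp add: G_def)
        qed
        have t0: "ts ! 0 \<in> S" using S by auto
        have "G (ts[0 := ts ! 0, j' := s]) = - G (ts[0 := s, j' := ts ! 0])"
          using sj t0 S Suc by (intro alternating_swap[OF G]) auto
        moreover have "ts[0 := ts ! 0, j' := s] = ts"
          using sj by (metis list_update_id)
        moreover have "G (ts[0 := s, j' := ts ! 0]) = 0"
        proof -
          obtain us where us: "ts[0 := s, j' := ts ! 0] = s # us" "length us = n"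
            using S Suc by (cases ts) auto
          have "set (ts[0 := s, j' := ts ! 0]) \<subseteq> S"
            using S t0 set_update_subset by simp
          then show ?thesis
            using d_repeat_head[OF F, of us s] us S by (simp add: G_def)
        qed
        ultimately show ?thesis
          using st by (simp add: G_def)
      qed
    qed
  qed
  show ?thesis
    unfolding alternating_def
    using d_closed[OF assms] d_linear[OF assms] vanish[OF assms]
    by (intro allI impI conjI ballI; elim conjE) blast+
qed

end

section \<open>Sections and forms of the complexified bundle\<close>

lemma scaleI_fst_snd [simp]: "fst (scaleI c w) = Re c *\<^sub>R fst w - Im c *\<^sub>R snd w"
  "snd (scaleI c w) = Re c *\<^sub>R snd w + Im c *\<^sub>R fst w"
  by (simp_all add: scaleI_def)

lemma scaleI_add_left: "scaleI (a + b) w = scaleI a w + scaleI b w"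
  by (simp add: scaleI_def algebra_simps)

lemma scaleI_add_right: "scaleI a (v + w) = scaleI a v + scaleI a w"
  by (simp add: scaleI_def algebra_simps)

lemma scaleI_one [simp]: "scaleI 1 w = w"
  by (simp add: scaleI_def)

lemma scaleI_scaleI: "scaleI a (scaleI b w) = scaleI (a * b) w"
  by (simp add: scaleI_def algebra_simps)

lemma sum_fun_apply: "(\<Sum>i\<in>I. f i) x = (\<Sum>i\<in>I. f i x)"
  by (induction I rule: infinite_finite_induct) auto

lemma power_fun_apply: "(f ^ k) x = f x ^ k"
  by (induction k) auto

context manifold_atlas
begin

text \<open>The complex-valued smooth functions.\<close>

definition csmooth :: "('m \<Rightarrow> complex) set" where
  "csmooth = {f. msmooth_on K UNIV f}"

lemma msmooth_of_Re_Im: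
  assumes "open W" "msmooth_on K W (\<lambda>x. Re (f x))" "msmooth_on K W (\<lambda>x. Im (f x))"
  shows "msmooth_on K W f"
proof -
  have "msmooth_on K W (\<lambda>x. Re (f x) *\<^sub>R 1 + Im (f x) *\<^sub>R \<i>)"
    by (intro msmooth_add msmooth_scaleR msmooth_const assms)
  moreover have "(\<lambda>x. Re (f x) *\<^sub>R 1 + Im (f x) *\<^sub>R \<i>) = f"
    by (rule ext) (simp add: complex_eq_iff)
  ultimately show ?thesis by simp
qed

lemma msmooth_Re: "open W \<Longrightarrow> msmooth_on K W f \<Longrightarrow> msmooth_on K W (\<lambda>x. Re (f x))"
  and msmooth_Im: "open W \<Longrightarrow> msmooth_on K W f \<Longrightarrow> msmooth_on K W (\<lambda>x. Im (f x))"
  by (rule msmooth_bounded_linear[OF _ bounded_linear_Re] msmooth_bounded_linear[OF _ bounded_linear_Im], assumption+)+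

lemma csmooth_iff: "f \<in> csmooth \<longleftrightarrow> (\<lambda>x. Re (f x)) \<in> smooth_functions K \<and> (\<lambda>x. Im (f x)) \<in> smooth_functions K"
  using msmooth_Re[OF open_UNIV, of f] msmooth_Im[OF open_UNIV, of f] msmooth_of_Re_Im[OF open_UNIV, of f]
  by (auto simp: csmooth_def smooth_functions_def)

lemma csmoothI: "msmooth_on K UNIV f \<Longrightarrow> f \<in> csmooth"
  by (simp add: csmooth_def)

lemma csmoothD: "f \<in> csmooth \<Longrightarrow> open W \<Longrightarrow> msmooth_on K W f"
  by (simp add: csmooth_def msmooth_subset[of UNIV])

end

text \<open>Sections of the complexification as a module over the complex-valued smooth functions.\<close>

definition smulC :: "('m \<Rightarrow> complex) \<Rightarrow> ('m \<Rightarrow> 'v::real_vector \<times> 'v) \<Rightarrow> 'm \<Rightarrow> 'v \<times> 'v" where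
  "smulC f s = (\<lambda>x. scaleI (f x) (s x))"

text \<open>The section \<open>s \<otimes> 1\<close> of the complexification.\<close>

definition realify :: "('m \<Rightarrow> 'v::real_vector) \<Rightarrow> 'm \<Rightarrow> 'v \<times> 'v" where
  "realify s = (\<lambda>x. (s x, 0))"

context smooth_bundle
begin

lemma sectionsC_iff: "s \<in> sectionsC A \<longleftrightarrow> (\<lambda>x. fst (s x)) \<in> sections A \<and> (\<lambda>x. snd (s x)) \<in> sections A"
  by (simp add: sectionsC_def)

lemma sections_diff: "s \<in> sections A \<Longrightarrow> t \<in> sections A \<Longrightarrow> (\<lambda>x. s x - t x) \<in> sections A"
  using sections_linear[of s t 1 "- 1"] by simp

lemma sectionsC_add: "s \<in> sectionsC A \<Longrightarrow> t \<in> sectionsC A \<Longrightarrow> s + t \<in> sectionsC A"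
  by (simp add: sectionsC_iff sections_add)

lemma sectionsC_smul: "f \<in> csmooth \<Longrightarrow> s \<in> sectionsC A \<Longrightarrow> smulC f s \<in> sectionsC A"
  by (simp add: sectionsC_iff csmooth_iff smulC_def sections_add sections_diff sections_scale)

lemma sectionsC_fibre: "s \<in> sectionsC A \<Longrightarrow> s x \<in> fibreC A x"
  using section_fibre[of "\<lambda>x. fst (s x)" x] section_fibre[of "\<lambda>x. snd (s x)" x]
  by (simp add: sectionsC_iff fibreC_def mem_Times_iff)

lemma realify_sectionsC: "s \<in> sections A \<Longrightarrow> realify s \<in> sectionsC A"
  by (simp add: sectionsC_iff realify_def sections_zero)

lemma sectionC_through:
  assumes "w \<in> fibreC A x"
  shows "\<exists>s. s \<in> sectionsC A \<and> s x = w"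
proof -
  have w: "fst w \<in> fibre A x" "snd w \<in> fibre A x"
    using assms by (auto simp: fibreC_def)
  obtain s where s: "s \<in> sections A" "s x = fst w"
    using section_through[OF w(1)] .
  obtain t where t: "t \<in> sections A" "t x = snd w"
    using section_through[OF w(2)] .
  show ?thesis
    using s t by (intro exI[of _ "\<lambda>y. (s y, t y)"]) (simp add: sectionsC_iff)
qed

text \<open>Alternating maps on global sections (\<open>sec\<close>) and, for each \<open>x\<close>, on the complexified fibre (\<open>fib\<close>).\<close>

sublocale sec: module_on csmooth "sectionsC A" smulC
proof
  show "1 \<in> csmooth"
    unfolding one_fun_def by (intro csmoothI msmooth_const) auto
  show "a + b \<in> csmooth" if "a \<in> csmooth" "b \<in> csmooth" for a b
    unfolding plus_fun_def by (intro csmoothI msmooth_add csmoothD[OF that(1)] csmoothD[OF that(2)]) auto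
  show "a * b \<in> csmooth" if "a \<in> csmooth" "b \<in> csmooth" for a b
    unfolding times_fun_def by (intro csmoothI msmooth_mult csmoothD[OF that(1)] csmoothD[OF that(2)]) auto
  show "- a \<in> csmooth" if "a \<in> csmooth" for a
    unfolding fun_Compl_def
    by (intro csmoothI msmooth_bounded_linear[OF _ bounded_linear_minus[OF bounded_linear_ident]] csmoothD[OF that]) auto
  show "0 \<in> sectionsC A"
    by (simp add: sectionsC_iff sections_zero)
  show "s + t \<in> sectionsC A" if "s \<in> sectionsC A" "t \<in> sectionsC A" for s t
    using that by (rule sectionsC_add)
  show "smulC f s \<in> sectionsC A" if "f \<in> csmooth" "s \<in> sectionsC A" for f s
    using that by (rule sectionsC_smul)
qed (auto simp: smulC_def scaleI_add_left scaleI_add_right fun_eq_iff)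

lemma fibreC_add: "u \<in> fibreC A x \<Longrightarrow> v \<in> fibreC A x \<Longrightarrow> u + v \<in> fibreC A x"
  by (simp add: fibreC_def mem_Times_iff subspace_add[OF fibre_subspace])

lemma fibreC_scaleI: "w \<in> fibreC A x \<Longrightarrow> scaleI c w \<in> fibreC A x"
  by (simp add: fibreC_def mem_Times_iff subspace_add[OF fibre_subspace]
      subspace_diff[OF fibre_subspace] subspace_scale[OF fibre_subspace])

sublocale fib: module_on UNIV "fibreC A x" scaleI for x
  by unfold_locales
    (auto simp: fibreC_add fibreC_scaleI scaleI_add_left scaleI_add_right,
      simp add: fibreC_def mem_Times_iff subspace_0[OF fibre_subspace])

lemma forms_iff:
  "\<omega> \<in> forms A r \<longleftrightarrow> (\<forall>x. fib.alternating x r (\<omega> x)) \<and>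
     (\<forall>(U, e)\<in>frames A. \<forall>is. length is = r \<and> set is \<subseteq> {..<n} \<longrightarrow>
        msmooth_on K U (\<lambda>x. \<omega> x (map (\<lambda>i. (e i x, 0)) is)))"
  unfolding forms_def fib.alternating_def by (simp only: mem_Collect_eq) simp

lemma form_alternating: "\<omega> \<in> forms A r \<Longrightarrow> fib.alternating x r (\<omega> x)"
  by (simp add: forms_iff)

lemma form_frame_smooth:
  assumes "\<omega> \<in> forms A r" "(U, e) \<in> frames A" "length is = r" "set is \<subseteq> {..<n}"
  shows "msmooth_on K U (\<lambda>x. \<omega> x (map (\<lambda>i. (e i x, 0)) is))"
  using bspec[OF conjunct2[OF assms(1)[unfolded forms_iff]] assms(2), unfolded prod.case] assms(3,4) by blast

lemma set_values_fibreC: "set ss \<subseteq> sectionsC A \<Longrightarrow> set (map (\<lambda>s. s x) ss) \<subseteq> fibreC A x"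
  using sectionsC_fibre by auto

lemma coordC_sum:
  assumes "(U, e) \<in> frames A" "x \<in> U" "w \<in> fibreC A x"
  shows "w = (\<Sum>i<n. scaleI (Complex (coord e x (fst w) i) (coord e x (snd w) i)) (e i x, 0))"
proof -
  have w: "fst w \<in> fibre A x" "snd w \<in> fibre A x"
    using assms(3) by (auto simp: fibreC_def)
  have "fst w = (\<Sum>i<n. coord e x (fst w) i *\<^sub>R e i x)" "snd w = (\<Sum>i<n. coord e x (snd w) i *\<^sub>R e i x)"
    by (rule coord_sum[OF assms(1,2) w(1)], rule coord_sum[OF assms(1,2) w(2)])
  then show ?thesis
    unfolding prod_eq_iff fst_sum snd_sum scaleI_fst_snd by simp
qed

text \<open>Over the domain of a frame the arguments are expanded in the frame one after the other, beginning with the last.\<close>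

lemma form_eval_csmooth:
  assumes \<omega>: "\<omega> \<in> forms A r" and ss: "length ss = r" "set ss \<subseteq> sectionsC A"
  shows "form_eval \<omega> ss \<in> csmooth"
proof -
  have main: "msmooth_on K U (\<lambda>x. \<omega> x (map (\<lambda>s. s x) ss @ map (\<lambda>i. (e i x, 0)) is))"
    if fr: "(U, e) \<in> frames A" and "length ss + length is = r" "set ss \<subseteq> sectionsC A" "set is \<subseteq> {..<n}" for U e ss "is"
    using that(2-4)
  proof (induction ss arbitrary: "is" rule: rev_induct)
    case Nil
    then show ?case using form_frame_smooth[OF \<omega> fr] by simp
  next
    case (snoc s ss)
    have U: "open U" by (rule frame_open[OF fr])
    have s: "s \<in> sectionsC A" using snoc.prems by simp
    let ?c = "\<lambda>i x. Complex (coord e x (fst (s x)) i) (coord e x (snd (s x)) i)"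
    have "msmooth_on K U (\<lambda>x. ?c i x * \<omega> x (map (\<lambda>s. s x) ss @ map (\<lambda>i. (e i x, 0)) (i # is)))" if "i < n" for i
    proof (rule msmooth_mult[OF U])
      show "msmooth_on K U (?c i)"
        using s unfolding sectionsC_iff
        by (intro msmooth_of_Re_Im[OF U]) (simp_all add: section_coord_smooth[OF _ fr that])
      show "msmooth_on K U (\<lambda>x. \<omega> x (map (\<lambda>s. s x) ss @ map (\<lambda>i. (e i x, 0)) (i # is)))"
        using snoc.prems that by (intro snoc.IH) auto
    qed
    then have "msmooth_on K U (\<lambda>x. \<Sum>i<n. ?c i x * \<omega> x (map (\<lambda>s. s x) ss @ map (\<lambda>i. (e i x, 0)) (i # is)))"
      by (intro msmooth_sum[OF U]) simp
    then show ?case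
    proof (rule msmooth_cong[OF _ U])
      fix x assume x: "x \<in> U"
      let ?ws = "map (\<lambda>s. s x) ss @ s x # map (\<lambda>i. (e i x, 0)) is"
      have "set ?ws \<subseteq> fibreC A x"
        using snoc.prems set_values_fibreC[of ss x] sectionsC_fibre[OF s] frame_mem[OF fr x]
        by (auto simp: fibreC_def subspace_0[OF fibre_subspace])
      moreover have "(e i x, 0) \<in> fibreC A x" if "i < n" for i
        using frame_mem[OF fr x that] by (simp add: fibreC_def subspace_0[OF fibre_subspace])
      ultimately have "\<omega> x (?ws[length ss := \<Sum>i<n. scaleI (?c i x) (e i x, 0)])
          = (\<Sum>i<n. ?c i x * \<omega> x (?ws[length ss := (e i x, 0)]))"
        using snoc.prems by (intro fib.alternating_sum_arg[OF form_alternating[OF \<omega>]]) auto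
      moreover have "?ws[length ss := z] = map (\<lambda>s. s x) ss @ z # map (\<lambda>i. (e i x, 0)) is" for z
        by (simp add: list_update_append)
      ultimately show "(\<Sum>i<n. ?c i x * \<omega> x (map (\<lambda>s. s x) ss @ map (\<lambda>i. (e i x, 0)) (i # is)))
          = \<omega> x (map (\<lambda>s. s x) (ss @ [s]) @ map (\<lambda>i. (e i x, 0)) is)"
        by (simp only: coordC_sum[OF fr x sectionsC_fibre[OF s], symmetric]) simp
    qed
  qed
  show ?thesis
  proof (intro csmoothI msmooth_local open_UNIV)
    fix x
    obtain U e where "(U, e) \<in> frames A" "x \<in> U"
      using frame_cover by blast
    then show "\<exists>T. open T \<and> x \<in> T \<and> msmooth_on K T (form_eval \<omega> ss)"
      using main[of U e ss "[]"] ss frame_open by (auto simp: form_eval_def intro!: exI[of _ U])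
  qed
qed

lemma form_eval_alternating:
  assumes \<omega>: "\<omega> \<in> forms A r"
  shows "sec.alternating r (form_eval \<omega>)"
  unfolding sec.alternating_def
proof (intro allI impI conjI ballI)
  fix ss assume ss: "length ss = r \<and> set ss \<subseteq> sectionsC A"
  show "form_eval \<omega> ss \<in> csmooth"
    using form_eval_csmooth[OF \<omega>] ss by blast
  fix k assume k: "k < r"
  show "form_eval \<omega> (ss[k := smulC a u + smulC b v]) = a * form_eval \<omega> (ss[k := u]) + b * form_eval \<omega> (ss[k := v])"
    if "u \<in> sectionsC A" "v \<in> sectionsC A" for u v a b
    using fib.alternating_linear[OF form_alternating[OF \<omega>], of "map (\<lambda>s. s x) ss" x k "u x" "v x" "a x" "b x" for x]
      ss k set_values_fibreC[of ss] sectionsC_fibre that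
    by (intro ext) (simp add: form_eval_def map_update smulC_def)
  show "form_eval \<omega> ss = 0" if "i < k" "ss ! i = ss ! k" for i
    using fib.alternating_repeat[OF form_alternating[OF \<omega>], of "map (\<lambda>s. s x) ss" x k i for x]
      ss k set_values_fibreC[of ss] that
    by (intro ext) (simp add: form_eval_def)
qed

section \<open>Function-linear alternating maps are forms\<close>

lemma alternating_zero_at:
  assumes \<Phi>: "sec.alternating r \<Phi>" and ss: "length ss = r" "set ss \<subseteq> sectionsC A" "k < r"
    and s: "s \<in> sectionsC A" "s x = 0"
  shows "\<Phi> (ss[k := s]) x = 0"
proof -
  \<comment> \<open>by linearity it suffices to treat the real and the imaginary part of \<open>s\<close>\<close>
  have real: "\<Phi> (ss[k := realify t]) x = 0" if t: "t \<in> sections A" "t x = 0" for t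
  proof -
    obtain N f u where d: "\<And>i. i < N \<Longrightarrow> f i \<in> smooth_functions K" "\<And>i. i < N \<Longrightarrow> f i x = (0::real)"
      "\<And>i. i < N \<Longrightarrow> u i \<in> sections A" "t = (\<lambda>y. \<Sum>i<(N::nat). f i y *\<^sub>R u i y)"
      by (rule section_vanishing_decomposition[OF t]) (rule that; simp)
    let ?f = "\<lambda>i y. complex_of_real (f i y)"
    have f: "?f i \<in> csmooth" if "i < N" for i
      unfolding csmooth_iff using d(1)[OF that] by (simp add: smooth_const)
    have "realify t = (\<Sum>i<N. smulC (?f i) (realify (u i)))"
      by (rule ext) (simp add: d(4) sum_fun_apply realify_def smulC_def prod_eq_iff fst_sum snd_sum)
    then have "\<Phi> (ss[k := realify t]) = (\<Sum>i<N. ?f i * \<Phi> (ss[k := realify (u i)]))"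
      using sec.alternating_sum_arg[OF \<Phi> ss, of "{..<N}" ?f "\<lambda>i. realify (u i)"] f realify_sectionsC[OF d(3)] by simp
    then show ?thesis
      using d(2) by (simp add: sum_fun_apply)
  qed
  let ?i = "\<lambda>_. \<i> :: complex"
  have i: "?i \<in> csmooth"
    by (intro csmoothI msmooth_const open_UNIV)
  have st: "(\<lambda>x. fst (s x)) \<in> sections A" "(\<lambda>x. snd (s x)) \<in> sections A"
    using s(1) by (simp_all add: sectionsC_iff)
  have "s = smulC 1 (realify (\<lambda>x. fst (s x))) + smulC ?i (realify (\<lambda>x. snd (s x)))"
    by (rule ext) (simp add: realify_def smulC_def prod_eq_iff)
  then have "\<Phi> (ss[k := s]) = 1 * \<Phi> (ss[k := realify (\<lambda>x. fst (s x))]) + ?i * \<Phi> (ss[k := realify (\<lambda>x. snd (s x))])"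
    using sec.alternating_linear[OF \<Phi> ss realify_sectionsC[OF st(1)] realify_sectionsC[OF st(2)] sec.R_one i] by simp
  then show ?thesis
    using real[OF st(1)] real[OF st(2)] s(2) by simp
qed

text \<open>The value at \<open>x\<close> depends only on the values of the arguments at \<open>x\<close>: they are exchanged one by one.\<close>

lemma alternating_tensorial:
  assumes \<Phi>: "sec.alternating r \<Phi>"
    and ss: "length ss = r" "set ss \<subseteq> sectionsC A" and ts: "length ts = r" "set ts \<subseteq> sectionsC A"
    and eq: "map (\<lambda>s. s x) ss = map (\<lambda>s. s x) ts"
  shows "\<Phi> ss x = \<Phi> ts x"
proof -
  have one: "\<Phi> (us @ s # vs) x = \<Phi> (us @ t # vs) x"
    if "length us + Suc (length vs) = r" "set us \<subseteq> sectionsC A" "set vs \<subseteq> sectionsC A"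
      "s \<in> sectionsC A" "t \<in> sectionsC A" "s x = t x" for us vs s t
  proof -
    let ?l = "us @ t # vs" and ?k = "length us"
    have m: "smulC (- 1) t \<in> sectionsC A"
      using that by (intro sec.S_smul sec.R_uminus sec.R_one)
    define u where "u = s + smulC (- 1) t"
    have u: "u \<in> sectionsC A" "u x = 0"
      using that m by (auto intro: sec.S_add simp: u_def smulC_def prod_eq_iff)
    have s: "t + u = s"
      by (rule ext) (simp add: u_def smulC_def prod_eq_iff)
    have "\<Phi> (?l[?k := t + u]) = \<Phi> (?l[?k := t]) + \<Phi> (?l[?k := u])"
      using that u by (intro sec.alternating_add[OF \<Phi>]) auto
    moreover have "\<Phi> (?l[?k := u]) x = 0"
      using that u by (intro alternating_zero_at[OF \<Phi>]) auto
    moreover have "?l[?k := z] = us @ z # vs" for z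
      by simp
    ultimately show ?thesis
      unfolding s by simp
  qed
  have "\<Phi> (us @ ss) x = \<Phi> (us @ ts) x"
    if "length ss = length ts" "length us + length ss = r" "set us \<subseteq> sectionsC A" "set ss \<subseteq> sectionsC A"
      "set ts \<subseteq> sectionsC A" "map (\<lambda>s. s x) ss = map (\<lambda>s. s x) ts" for us ss ts
    using that
  proof (induction ss ts arbitrary: us rule: list_induct2)
    case Nil
    then show ?case by simp
  next
    case (Cons s ss t ts)
    have "\<Phi> (us @ s # ss) x = \<Phi> (us @ t # ss) x"
      using Cons.prems by (intro one) auto
    also have "\<dots> = \<Phi> ((us @ [t]) @ ss) x" by simp
    also have "\<dots> = \<Phi> ((us @ [t]) @ ts) x"
      using Cons.prems by (intro Cons.IH) auto
    finally show ?case by simp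
  qed
  from this[of ss ts "[]"] show ?thesis
    using assms by simp
qed

text \<open>Every alternating function-multilinear map on sections comes from a smooth form. The form is evaluated by extending
  vectors to global sections; its components are smooth because the frame fields become global sections after
  multiplication by a bump function.\<close>

theorem alternating_is_form:
  assumes \<Phi>: "sec.alternating r \<Phi>"
  obtains \<eta> where "\<eta> \<in> forms A r"
    "\<And>ss. length ss = r \<Longrightarrow> set ss \<subseteq> sectionsC A \<Longrightarrow> form_eval \<eta> ss = \<Phi> ss"
proof -
  define ext where "ext x w = (SOME s. s \<in> sectionsC A \<and> s x = w)" for x w
  have ext: "ext x w \<in> sectionsC A" "ext x w x = w" if "w \<in> fibreC A x" for x w
    using someI_ex[OF sectionC_through[OF that]] by (simp_all add: ext_def)
  define \<eta> where "\<eta> x ws = \<Phi> (map (ext x) ws) x" for x ws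
  have eval: "form_eval \<eta> ss = \<Phi> ss" if ss: "length ss = r" "set ss \<subseteq> sectionsC A" for ss
  proof (rule HOL.ext)
    fix x
    have "set (map (ext x) (map (\<lambda>s. s x) ss)) \<subseteq> sectionsC A"
      using ss(2) by (auto intro!: ext(1) sectionsC_fibre)
    moreover have "map (\<lambda>s. s x) (map (ext x) (map (\<lambda>s. s x) ss)) = map (\<lambda>s. s x) ss"
      using ss(2) by (auto intro!: ext(2) sectionsC_fibre)
    ultimately show "form_eval \<eta> ss x = \<Phi> ss x"
      unfolding form_eval_def \<eta>_def using ss by (intro alternating_tensorial[OF \<Phi>]) auto
  qed
  have alt: "fib.alternating x r (\<eta> x)" for x
    unfolding fib.alternating_def
  proof (intro allI impI conjI ballI)
    fix ws assume ws: "length ws = r \<and> set ws \<subseteq> fibreC A x"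
    let ?ss = "map (ext x) ws"
    have ss: "length ?ss = r" "set ?ss \<subseteq> sectionsC A" "map (\<lambda>s. s x) ?ss = ws"
      using ws by (auto intro!: ext map_idI)
    have val: "\<eta> x (ws[k := s x]) = \<Phi> (?ss[k := s]) x" if "s \<in> sectionsC A" for k s
    proof -
      have "form_eval \<eta> (?ss[k := s]) x = \<Phi> (?ss[k := s]) x"
        using ss that sec.set_update_subset by (subst eval) auto
      then show ?thesis
        unfolding form_eval_def map_update ss(3) .
    qed
    show "\<eta> x ws \<in> UNIV" by simp
    fix k assume k: "k < r"
    show "\<eta> x (ws[k := scaleI a u + scaleI b v]) = a * \<eta> x (ws[k := u]) + b * \<eta> x (ws[k := v])"
      if "u \<in> fibreC A x" "v \<in> fibreC A x" for u v a b
    proof -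
      let ?u = "ext x u" and ?v = "ext x v" and ?a = "\<lambda>_. a" and ?b = "\<lambda>_. b"
      have ab: "?a \<in> csmooth" "?b \<in> csmooth"
        by (intro csmoothI msmooth_const open_UNIV)+
      have "\<Phi> (?ss[k := smulC ?a ?u + smulC ?b ?v]) x = a * \<Phi> (?ss[k := ?u]) x + b * \<Phi> (?ss[k := ?v]) x"
        using sec.alternating_linear[OF \<Phi> ss(1,2) k ext(1)[OF that(1)] ext(1)[OF that(2)] ab] by simp
      moreover have "smulC ?a ?u + smulC ?b ?v \<in> sectionsC A"
        using ab ext(1)[OF that(1)] ext(1)[OF that(2)] by (intro sec.S_add sec.S_smul)
      ultimately show ?thesis
        using val[OF ext(1)[OF that(1)], of k] val[OF ext(1)[OF that(2)], of k] val[of "smulC ?a ?u + smulC ?b ?v" k]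
          ext(2)[OF that(1)] ext(2)[OF that(2)] by (simp add: smulC_def)
    qed
    show "\<eta> x ws = 0" if "i < k" "ws ! i = ws ! k" for i
    proof -
      have "\<Phi> ?ss = 0"
        using sec.alternating_repeat[OF \<Phi> ss(1,2) k that(1)] that k ws by simp
      then show ?thesis by (simp add: \<eta>_def)
    qed
  qed
  have smooth: "msmooth_on K U (\<lambda>x. \<eta> x (map (\<lambda>i. (e i x, 0)) is))"
    if fr: "(U, e) \<in> frames A" and "is": "length is = r" "set is \<subseteq> {..<n}" for U e "is"
  proof (rule msmooth_if_bump_mult[OF frame_open[OF fr]])
    fix x assume x: "x \<in> U"
    obtain \<beta> C where \<beta>: "\<beta> \<in> smooth_functions K" "closed C" "C \<subseteq> U" "\<beta> x = 1" "\<And>y. y \<notin> C \<Longrightarrow> \<beta> y = 0"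
      using exists_bump[OF frame_open[OF fr] x] by metis
    let ?t = "\<lambda>i. realify (\<lambda>y. if y \<in> U then \<beta> y *\<^sub>R e i y else 0)"
    have t: "set (map ?t is) \<subseteq> sectionsC A"
      using "is" section_bump_frame[OF fr _ \<beta>(1-3,5)] realify_sectionsC by auto
    have "\<Phi> (map ?t is) \<in> csmooth"
      using sec.alternating_closed[OF \<Phi> _ t] "is" by simp
    then have "msmooth_on K U (\<Phi> (map ?t is))"
      using frame_open[OF fr] by (rule csmoothD)
    \<comment> \<open>each of the \<open>r\<close> arguments contributes a factor \<open>\<beta>\<close>\<close>
    then have "msmooth_on K U (\<lambda>y. \<beta> y ^ r *\<^sub>R \<eta> y (map (\<lambda>i. (e i y, 0)) is))"
    proof (rule msmooth_cong[OF _ frame_open[OF fr]])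
      fix y assume y: "y \<in> U"
      let ?us = "map (\<lambda>i. (e i y, 0 :: 'v)) is"
      have us: "set ?us \<subseteq> fibreC A y"
        using "is" frame_mem[OF fr y] by (auto simp: fibreC_def subspace_0[OF fibre_subspace])
      have "\<Phi> (map ?t is) y = \<eta> y (map (scaleI (of_real (\<beta> y))) ?us @ [])"
        using fun_cong[OF eval[OF _ t], of y] "is" y by (simp add: form_eval_def comp_def realify_def scaleI_def)
      also have "\<dots> = of_real (\<beta> y) ^ length ?us * \<eta> y (?us @ [])"
        using us "is" by (intro fib.alternating_map_smul[OF alt]) auto
      finally show "\<Phi> (map ?t is) y = \<beta> y ^ r *\<^sub>R \<eta> y (map (\<lambda>i. (e i y, 0)) is)"
        using "is" by (simp add: scaleR_conv_of_real)
    qed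
    then show "\<exists>h\<in>smooth_functions K. h x \<noteq> 0 \<and> msmooth_on K U (\<lambda>y. h y *\<^sub>R \<eta> y (map (\<lambda>i. (e i y, 0)) is))"
      using \<beta>(4) by (intro bexI[of _ "\<lambda>y. \<beta> y ^ r"] conjI smooth_functionsI msmooth_power smooth_functionsD[OF \<beta>(1)]) auto
  qed
  have "\<eta> \<in> forms A r"
    unfolding forms_iff using alt smooth by (auto split: prod.splits)
  then show ?thesis
    using eval by (rule that)
qed

end

section \<open>The complexified Lie algebroid\<close>

locale algebroid =
  fixes A :: "('m::{t2_space,second_countable_topology}, 'k::real_inner, 'v::real_vector, 'z) lie_algebroid_scheme"
  assumes algebroid_structure: "lie_algebroid A"
begin

lemmas algebroid_conditions = algebroid_structure[unfolded lie_algebroid_def]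

sublocale smooth_bundle A
  by unfold_locales (rule conjunct1[OF algebroid_conditions])

lemmas anchor_conditions = conjunct1[OF conjunct2[OF algebroid_conditions], unfolded morphism_to_tangent_def]
lemmas bracket_conditions = conjunct2[OF conjunct2[OF algebroid_conditions]]

lemma anchor_tangent: "u \<in> fibre A x \<Longrightarrow> anchor A x u \<in> tangent_space K x"
  using conjunct1[OF anchor_conditions] by simp

lemma anchor_linear:
  assumes "u \<in> fibre A x" "v \<in> fibre A x"
  shows "anchor A x (a *\<^sub>R u + b *\<^sub>R v) f = a * anchor A x u f + b * anchor A x v f"
  by (rule fun_cong[OF conjunct1[OF conjunct2[OF anchor_conditions], rule_format, OF assms]])

lemma anchor_linear_fun:
  assumes "u \<in> fibre A x" "f \<in> smooth_functions K" "g \<in> smooth_functions K"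
  shows "anchor A x u (\<lambda>y. a * f y + b * g y) = a * anchor A x u f + b * anchor A x u g"
  using conjunct1[OF conjunct2[OF CollectD[OF anchor_tangent[OF assms(1), unfolded tangent_space_def]]]] assms(2,3)
  by blast

lemma anchor_mult:
  assumes "u \<in> fibre A x" "f \<in> smooth_functions K" "g \<in> smooth_functions K"
  shows "anchor A x u (\<lambda>y. f y * g y) = anchor A x u f * g x + f x * anchor A x u g"
  using conjunct2[OF conjunct2[OF CollectD[OF anchor_tangent[OF assms(1), unfolded tangent_space_def]]]] assms(2,3)
  by blast

lemma bracket_closed: "s \<in> sections A \<Longrightarrow> t \<in> sections A \<Longrightarrow> bracket A s t \<in> sections A"
  using conjunct1[OF bracket_conditions] by blast

lemma
  assumes "s \<in> sections A" "t \<in> sections A" "u \<in> sections A"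
  shows bracket_linear_left: "bracket A (\<lambda>x. a *\<^sub>R s x + b *\<^sub>R t x) u = (\<lambda>x. a *\<^sub>R bracket A s u x + b *\<^sub>R bracket A t u x)"
    and bracket_linear_right: "bracket A u (\<lambda>x. a *\<^sub>R s x + b *\<^sub>R t x) = (\<lambda>x. a *\<^sub>R bracket A u s x + b *\<^sub>R bracket A u t x)"
  using conjunct1[OF conjunct2[OF bracket_conditions], rule_format, OF assms] by blast+

lemma bracket_self: "s \<in> sections A \<Longrightarrow> bracket A s s = (\<lambda>x. 0)"
  using conjunct1[OF conjunct2[OF conjunct2[OF bracket_conditions]]] by blast

lemma bracket_scale_right:
  assumes "s \<in> sections A" "t \<in> sections A" "f \<in> smooth_functions K"
  shows "bracket A s (\<lambda>x. f x *\<^sub>R t x) = (\<lambda>x. f x *\<^sub>R bracket A s t x + anchor A x (s x) f *\<^sub>R t x)"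
  by (rule conjunct2[OF conjunct2[OF conjunct2[OF conjunct2[OF conjunct2[OF bracket_conditions]]]], rule_format, OF assms])

lemma bracket_add_right:
  "s \<in> sections A \<Longrightarrow> t \<in> sections A \<Longrightarrow> u \<in> sections A \<Longrightarrow>
     bracket A u (\<lambda>x. s x + t x) = (\<lambda>x. bracket A u s x + bracket A u t x)"
  using bracket_linear_right[of s t u 1 1] by simp

lemma bracket_diff_right:
  "s \<in> sections A \<Longrightarrow> t \<in> sections A \<Longrightarrow> u \<in> sections A \<Longrightarrow>
     bracket A u (\<lambda>x. s x - t x) = (\<lambda>x. bracket A u s x - bracket A u t x)"
  using bracket_linear_right[of s t u 1 "- 1"] by simp

lemma bracket_add_left:
  "s \<in> sections A \<Longrightarrow> t \<in> sections A \<Longrightarrow> u \<in> sections A \<Longrightarrow>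
     bracket A (\<lambda>x. s x + t x) u = (\<lambda>x. bracket A s u x + bracket A t u x)"
  using bracket_linear_left[of s t u 1 1] by simp

lemma bracket_uminus_right:
  "t \<in> sections A \<Longrightarrow> u \<in> sections A \<Longrightarrow> bracket A u (\<lambda>x. - t x) = (\<lambda>x. - bracket A u t x)"
  using bracket_linear_right[of t t u "- 1" 0] by simp

lemma bracket_uminus_left:
  "t \<in> sections A \<Longrightarrow> u \<in> sections A \<Longrightarrow> bracket A (\<lambda>x. - t x) u = (\<lambda>x. - bracket A t u x)"
  using bracket_linear_left[of t t u "- 1" 0] by simp

lemma bracket_swap:
  assumes "s \<in> sections A" "t \<in> sections A"
  shows "bracket A s t x = - bracket A t s x"
proof -
  have "bracket A (\<lambda>x. s x + t x) (\<lambda>x. s x + t x) x = 0"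
    using bracket_self[OF sections_add[OF assms]] by simp
  then show ?thesis
    using assms by (simp add: bracket_add_left bracket_add_right sections_add bracket_self eq_neg_iff_add_eq_0)
qed

text \<open>By the Leibniz rule \<open>(\<rho>(s) f) t = [s, f t] - f [s, t]\<close> is a section for every section \<open>t\<close>. Taking for \<open>t\<close> a frame field
  cut off by a bump function gives smoothness of \<open>\<rho>(s) f\<close> without coordinates on \<open>M\<close>. In rank 0 there is no frame field,
  but then \<open>\<rho>(s) = 0\<close>.\<close>

lemma anchor_smooth:
  assumes s: "s \<in> sections A" and f: "f \<in> smooth_functions K"
  shows "(\<lambda>x. anchor A x (s x) f) \<in> smooth_functions K"
proof (intro smooth_functionsI msmooth_local open_UNIV)
  fix x
  let ?g = "\<lambda>x. anchor A x (s x) f"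
  obtain U e where fr: "(U, e) \<in> frames A" and x: "x \<in> U"
    using frame_cover by blast
  have "msmooth_on K U ?g"
  proof (cases "n = 0")
    case True
    have "?g y = 0" if "y \<in> U" for y
    proof -
      have "s y = 0"
        using coord_sum[OF fr that section_fibre[OF s]] True by simp
      then show ?thesis
        using anchor_linear[of 0 y 0 0 0 f] subspace_0[OF fibre_subspace, of y] by simp
    qed
    then show ?thesis
      by (intro msmooth_cong[OF msmooth_const[OF frame_open[OF fr], of 0] frame_open[OF fr]]) simp
  next
    case False
    then have n: "0 < n" by simp
    show ?thesis
    proof (rule msmooth_if_bump_mult[OF frame_open[OF fr]])
      fix x assume x: "x \<in> U"
      obtain \<beta> C where \<beta>: "\<beta> \<in> smooth_functions K" "closed C" "C \<subseteq> U" "\<beta> x = 1" "\<And>y. y \<notin> C \<Longrightarrow> \<beta> y = 0"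
        using exists_bump[OF frame_open[OF fr] x] by metis
      define t where "t = (\<lambda>y. if y \<in> U then \<beta> y *\<^sub>R e 0 y else 0)"
      have t: "t \<in> sections A"
        unfolding t_def by (rule section_bump_frame[OF fr n \<beta>(1-3,5)])
      have "(\<lambda>y. bracket A s (\<lambda>y. f y *\<^sub>R t y) y - f y *\<^sub>R bracket A s t y) \<in> sections A"
        by (intro sections_diff bracket_closed sections_scale s t f)
      then have u: "(\<lambda>y. ?g y *\<^sub>R t y) \<in> sections A"
        by (simp add: bracket_scale_right[OF s t f])
      have "msmooth_on K U (\<lambda>y. coord e y (?g y *\<^sub>R t y) 0)"
        by (rule section_coord_smooth[OF u fr n])
      then have "msmooth_on K U (\<lambda>y. \<beta> y *\<^sub>R ?g y)"
      proof (rule msmooth_cong[OF _ frame_open[OF fr]])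
        fix y assume y: "y \<in> U"
        show "coord e y (?g y *\<^sub>R t y) 0 = \<beta> y *\<^sub>R ?g y"
        proof (rule trans[OF coord_eqI[OF fr y _ n, where c = "\<lambda>i. if i = 0 then \<beta> y *\<^sub>R ?g y else 0"]])
          have "(\<Sum>i<n. (if i = 0 then \<beta> y *\<^sub>R ?g y else 0) *\<^sub>R e i y)
              = (\<Sum>i<n. if i = 0 then (\<beta> y *\<^sub>R ?g y) *\<^sub>R e 0 y else 0)"
            by (intro sum.cong) auto
          also have "\<dots> = ?g y *\<^sub>R t y"
            using n y by (simp add: t_def)
          finally show "?g y *\<^sub>R t y = (\<Sum>i<n. (if i = 0 then \<beta> y *\<^sub>R ?g y else 0) *\<^sub>R e i y)"
            by (rule sym)
        qed simp
      qed
      then show "\<exists>h\<in>smooth_functions K. h x \<noteq> 0 \<and> msmooth_on K U (\<lambda>y. h y *\<^sub>R ?g y)"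
        using \<beta>(1,4) by (intro bexI[of _ \<beta>]) auto
    qed
  qed
  then show "\<exists>T. open T \<and> x \<in> T \<and> msmooth_on K T ?g"
    using frame_open[OF fr] x by blast
qed

text \<open>The derivation of the complex-valued functions given by a section of the complexification.\<close>

definition actC :: "('m \<Rightarrow> 'v \<times> 'v) \<Rightarrow> ('m \<Rightarrow> complex) \<Rightarrow> 'm \<Rightarrow> complex" where
  "actC s f = (\<lambda>x. anchorC A x (s x) f)"

lemma smooth_diff: "f \<in> smooth_functions K \<Longrightarrow> g \<in> smooth_functions K \<Longrightarrow> (\<lambda>x. f x - g x) \<in> smooth_functions K"
  and smooth_add: "f \<in> smooth_functions K \<Longrightarrow> g \<in> smooth_functions K \<Longrightarrow> (\<lambda>x. f x + g x) \<in> smooth_functions K"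
  and smooth_mult: "f \<in> smooth_functions K \<Longrightarrow> g \<in> smooth_functions K \<Longrightarrow> (\<lambda>x. f x * g x) \<in> smooth_functions K"
proof -
  assume f: "f \<in> smooth_functions K" and g: "g \<in> smooth_functions K"
  note fg = smooth_functionsD[OF f open_UNIV] smooth_functionsD[OF g open_UNIV]
  show "(\<lambda>x. f x + g x) \<in> smooth_functions K" "(\<lambda>x. f x * g x) \<in> smooth_functions K"
    by (intro smooth_functionsI msmooth_add msmooth_mult fg open_UNIV)+
  have "msmooth_on K UNIV (\<lambda>x. f x + (- 1) * g x)"
    by (intro msmooth_add msmooth_mult msmooth_const fg open_UNIV)
  then show "(\<lambda>x. f x - g x) \<in> smooth_functions K"
    by (intro smooth_functionsI) simp
qed

lemma anchor_add_fun:
  "u \<in> fibre A x \<Longrightarrow> f \<in> smooth_functions K \<Longrightarrow> g \<in> smooth_functions K \<Longrightarrow>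
     anchor A x u (\<lambda>y. f y + g y) = anchor A x u f + anchor A x u g"
  using anchor_linear_fun[of u x f g 1 1] by simp

lemma anchor_diff_fun:
  "u \<in> fibre A x \<Longrightarrow> f \<in> smooth_functions K \<Longrightarrow> g \<in> smooth_functions K \<Longrightarrow>
     anchor A x u (\<lambda>y. f y - g y) = anchor A x u f - anchor A x u g"
  using anchor_linear_fun[of u x f g 1 "- 1"] by simp

lemma anchor_add:
  "u \<in> fibre A x \<Longrightarrow> v \<in> fibre A x \<Longrightarrow> anchor A x (u + v) f = anchor A x u f + anchor A x v f"
  using anchor_linear[of u x v 1 1] by simp

lemma anchor_lincomb_diff:
  "u \<in> fibre A x \<Longrightarrow> v \<in> fibre A x \<Longrightarrow>
     anchor A x (a *\<^sub>R u - b *\<^sub>R v) f = a * anchor A x u f - b * anchor A x v f"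
  using anchor_linear[of u x v a "- b"] by simp

lemma anchorC_scaleI:
  assumes "w \<in> fibreC A x"
  shows "anchorC A x (scaleI c w) f = c * anchorC A x w f"
proof -
  have w: "fst w \<in> fibre A x" "snd w \<in> fibre A x"
    using assms by (auto simp: fibreC_def)
  show ?thesis
    by (simp add: anchorC_def complex_eq_iff anchor_linear[OF w(2,1)] anchor_lincomb_diff[OF w])
      (simp add: algebra_simps)
qed

lemma anchorC_add:
  assumes "v \<in> fibreC A x" "w \<in> fibreC A x"
  shows "anchorC A x (v + w) f = anchorC A x v f + anchorC A x w f"
proof -
  have w: "fst v \<in> fibre A x" "snd v \<in> fibre A x" "fst w \<in> fibre A x" "snd w \<in> fibre A x"
    using assms by (auto simp: fibreC_def)
  show ?thesis
    by (simp add: anchorC_def complex_eq_iff anchor_add w)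
qed

lemma bracketC_apply:
  "bracketC A s t x =
     (bracket A (\<lambda>x. fst (s x)) (\<lambda>x. fst (t x)) x - bracket A (\<lambda>x. snd (s x)) (\<lambda>x. snd (t x)) x,
      bracket A (\<lambda>x. fst (s x)) (\<lambda>x. snd (t x)) x + bracket A (\<lambda>x. snd (s x)) (\<lambda>x. fst (t x)) x)"
  by (simp add: bracketC_def comp_def)

sublocale cpx: lie_rinehart csmooth "sectionsC A" smulC actC "bracketC A"
proof
  have sec: "(\<lambda>x. fst (s x)) \<in> sections A" "(\<lambda>x. snd (s x)) \<in> sections A"
    "fst (s x) \<in> fibre A x" "snd (s x) \<in> fibre A x" if "s \<in> sectionsC A" for s x
    using that section_fibre[of "\<lambda>x. fst (s x)" x] section_fibre[of "\<lambda>x. snd (s x)" x]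
    by (simp_all add: sectionsC_iff)
  have csm: "(\<lambda>x. Re (f x)) \<in> smooth_functions K" "(\<lambda>x. Im (f x)) \<in> smooth_functions K" if "f \<in> csmooth" for f
    using that by (simp_all add: csmooth_iff)
  fix s :: "'m \<Rightarrow> 'v \<times> 'v" assume s: "s \<in> sectionsC A"
  note s' = sec[OF s]
  show "bracketC A s s = 0"
    using s' by (intro ext) (simp add: bracketC_apply bracket_self bracket_swap[OF s'(2,1)] prod_eq_iff)
  show "actC s f \<in> csmooth" if "f \<in> csmooth" for f
    unfolding csmooth_iff actC_def anchorC_def complex.sel
    by (intro conjI smooth_diff smooth_add anchor_smooth[OF s'(1)] anchor_smooth[OF s'(2)] csm[OF that])
  show "actC s (f + g) = actC s f + actC s g" if "f \<in> csmooth" "g \<in> csmooth" for f g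
    by (rule ext) (simp add: actC_def anchorC_def complex_eq_iff anchor_add_fun[OF s'(3)] anchor_add_fun[OF s'(4)]
        csm[OF that(1)] csm[OF that(2)])
  show "actC s (f * g) = actC s f * g + f * actC s g" if "f \<in> csmooth" "g \<in> csmooth" for f g
    by (rule ext) (simp add: actC_def anchorC_def complex_eq_iff anchor_add_fun[OF s'(3)] anchor_add_fun[OF s'(4)]
        anchor_diff_fun[OF s'(3)] anchor_diff_fun[OF s'(4)] anchor_mult[OF s'(3)] anchor_mult[OF s'(4)]
        smooth_mult csm[OF that(1)] csm[OF that(2)] algebra_simps)
  fix t :: "'m \<Rightarrow> 'v \<times> 'v" assume t: "t \<in> sectionsC A"
  note t' = sec[OF t]
  show "actC (smulC a s + smulC b t) f = a * actC s f + b * actC t f" for a b f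
    using sectionsC_fibre[OF s] sectionsC_fibre[OF t]
    by (intro ext) (simp add: actC_def smulC_def anchorC_add anchorC_scaleI fibreC_scaleI)
  show "bracketC A s t \<in> sectionsC A"
    unfolding sectionsC_iff bracketC_apply fst_conv snd_conv
    by (intro conjI sections_add sections_diff bracket_closed s' t')
  show "bracketC A s (smulC f t) = smulC f (bracketC A s t) + smulC (actC s f) t" if "f \<in> csmooth" for f
    using s' t' csm[OF that]
    by (intro ext) (simp add: bracketC_apply smulC_def actC_def anchorC_def prod_eq_iff bracket_diff_right bracket_add_right
        bracket_scale_right sections_scale algebra_simps)
  fix u :: "'m \<Rightarrow> 'v \<times> 'v" assume u: "u \<in> sectionsC A"
  note u' = sec[OF u]
  show "bracketC A (s + t) u = bracketC A s u + bracketC A t u"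
    using s' t' u' by (intro ext) (simp add: bracketC_apply bracket_add_left prod_eq_iff)
  show "bracketC A u (s + t) = bracketC A u s + bracketC A u t"
    using s' t' u' by (intro ext) (simp add: bracketC_apply bracket_add_right prod_eq_iff)
qed

lemma dE_eq_d: "dE A \<omega> ss = cpx.d (form_eval \<omega>) ss"
  by (rule ext) (simp add: dE_def cpx.d_def sum_fun_apply power_fun_apply actC_def)

lemma actC_zero: "s \<in> sectionsC A \<Longrightarrow> actC s 0 = 0"
  using cpx.act_add[of s 0 0] sec.R_zero by simp

end

section \<open>Types\<close>

text \<open>The number of entries \<open>True\<close> minus the number of entries \<open>False\<close>.\<close>

lemma sum_signs:
  "(\<Sum>k<length ts. if ts ! k then 1 else - 1 :: complex) = 2 * of_nat (length (filter id ts)) - of_nat (length ts)"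
proof (induction ts)
  case (Cons t ts)
  have "(\<Sum>k<length (t # ts). if (t # ts) ! k then 1 else - 1 :: complex)
      = (if t then 1 else - 1) + (\<Sum>k<length ts. if ts ! k then 1 else - 1)"
    by (simp only: length_Cons sum.lessThan_Suc_shift) simp
  then show ?case using Cons by simp
qed simp

locale almost_complex_algebroid =
  fixes A :: "('m::{t2_space,second_countable_topology}, 'k::real_inner, 'v::real_vector, 'z) almost_complex_lie_algebroid_scheme"
  assumes almost_complex_structure: "almost_complex_lie_algebroid A"
begin

lemmas almost_complex_conditions = almost_complex_structure[unfolded almost_complex_lie_algebroid_def]

sublocale algebroid A
  by unfold_locales (rule conjunct1[OF almost_complex_conditions])

lemma J_endo: "bundle_endomorphism A (cplx_str A)"
  by (rule conjunct1[OF conjunct2[OF conjunct2[OF almost_complex_conditions]]])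

lemma J_mem: "u \<in> fibre A x \<Longrightarrow> cplx_str A x u \<in> fibre A x"
  by (rule conjunct1[OF J_endo[unfolded bundle_endomorphism_def], rule_format])

lemma J_linear:
  "u \<in> fibre A x \<Longrightarrow> v \<in> fibre A x \<Longrightarrow>
     cplx_str A x (a *\<^sub>R u + b *\<^sub>R v) = a *\<^sub>R cplx_str A x u + b *\<^sub>R cplx_str A x v"
  by (rule conjunct1[OF conjunct2[OF J_endo[unfolded bundle_endomorphism_def]], rule_format])

lemma J_J: "u \<in> fibre A x \<Longrightarrow> cplx_str A x (cplx_str A x u) = - u"
  by (rule conjunct2[OF conjunct2[OF conjunct2[OF almost_complex_conditions]], rule_format])

lemma J_uminus: "u \<in> fibre A x \<Longrightarrow> cplx_str A x (- u) = - cplx_str A x u"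
  using J_linear[of u x u "- 1" 0] by simp

lemma J_add: "u \<in> fibre A x \<Longrightarrow> v \<in> fibre A x \<Longrightarrow> cplx_str A x (u + v) = cplx_str A x u + cplx_str A x v"
  using J_linear[of u x v 1 1] by simp

lemma J_lincomb_diff: "u \<in> fibre A x \<Longrightarrow> v \<in> fibre A x \<Longrightarrow>
     cplx_str A x (a *\<^sub>R u - b *\<^sub>R v) = a *\<^sub>R cplx_str A x u - b *\<^sub>R cplx_str A x v"
  using J_linear[of u x v a "- b"] by simp

lemma fibreC_iff: "w \<in> fibreC A x \<longleftrightarrow> fst w \<in> fibre A x \<and> snd w \<in> fibre A x"
  by (auto simp: fibreC_def mem_Times_iff)

lemma JC_mem: "w \<in> fibreC A x \<Longrightarrow> JC A x w \<in> fibreC A x"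
  by (simp add: fibreC_iff JC_def J_mem)

lemma JC_add: "v \<in> fibreC A x \<Longrightarrow> w \<in> fibreC A x \<Longrightarrow> JC A x (v + w) = JC A x v + JC A x w"
  by (simp add: fibreC_iff JC_def J_add)

lemma JC_scaleI: "w \<in> fibreC A x \<Longrightarrow> JC A x (scaleI c w) = scaleI c (JC A x w)"
  by (simp add: fibreC_iff JC_def J_linear J_lincomb_diff scaleI_def)

lemma JC_JC: "w \<in> fibreC A x \<Longrightarrow> JC A x (JC A x w) = scaleI (- 1) w"
  by (simp add: fibreC_iff JC_def J_J scaleI_def)

lemma JC_section: "s \<in> sectionsC A \<Longrightarrow> (\<lambda>x. JC A x (s x)) \<in> sectionsC A"
  unfolding sectionsC_iff JC_def fst_conv snd_conv
  by (elim conjE, intro conjI endomorphism_section[OF J_endo])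

text \<open>For \<open>c = -\<i>\<close> and \<open>c = \<i>\<close> the projections to \<^const>\<open>E10\<close> and \<^const>\<open>E01\<close>.\<close>

definition type_proj :: "complex \<Rightarrow> 'm \<Rightarrow> 'v \<times> 'v \<Rightarrow> 'v \<times> 'v" where
  "type_proj c x w = scaleI (1 / 2) (w + scaleI c (JC A x w))"

lemma proj_E10: "w \<in> fibreC A x \<Longrightarrow> type_proj (- \<i>) x w \<in> E10 A x"
  by (simp add: E10_def type_proj_def JC_scaleI JC_add JC_JC JC_mem fibreC_add fibreC_scaleI scaleI_scaleI scaleI_add_right)

lemma proj_E01: "w \<in> fibreC A x \<Longrightarrow> type_proj \<i> x w \<in> E01 A x"
  by (simp add: E01_def type_proj_def JC_scaleI JC_add JC_JC JC_mem fibreC_add fibreC_scaleI scaleI_scaleI scaleI_add_right)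

lemma proj_add_proj: "type_proj (- \<i>) x w + type_proj \<i> x w = w"
  by (simp add: type_proj_def prod_eq_iff scaleR_add_right scaleR_diff_right flip: scaleR_add_left)

lemma proj_E10_id: "w \<in> E10 A x \<Longrightarrow> type_proj (- \<i>) x w = w" "w \<in> E10 A x \<Longrightarrow> type_proj \<i> x w = 0"
  by (auto simp: E10_def type_proj_def scaleI_scaleI prod_eq_iff simp flip: scaleR_add_left)

lemma proj_E01_id: "w \<in> E01 A x \<Longrightarrow> type_proj \<i> x w = w"
  by (auto simp: E01_def type_proj_def scaleI_scaleI prod_eq_iff simp flip: scaleR_add_left)

lemma proj_section: "s \<in> sectionsC A \<Longrightarrow> (\<lambda>x. type_proj c x (s x)) \<in> sectionsC A"
proof -
  assume s: "s \<in> sectionsC A"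
  have const: "(\<lambda>_. z) \<in> csmooth" for z
    by (intro csmoothI msmooth_const open_UNIV)
  have "smulC (\<lambda>_. 1 / 2) (s + smulC (\<lambda>_. c) (\<lambda>x. JC A x (s x))) \<in> sectionsC A"
    by (intro sectionsC_smul sectionsC_add const s JC_section)
  then show ?thesis
    by (simp add: smulC_def type_proj_def)
qed

text \<open>The types of vectors and of sections are encoded as \<open>True\<close> for \<open>(1, 0)\<close> and \<open>False\<close> for \<open>(0, 1)\<close>. Lists of types are
  kept separately from lists of vectors because the zero vector has both types.\<close>

definition typed :: "bool \<Rightarrow> 'm \<Rightarrow> ('v \<times> 'v) set" where
  "typed \<tau> x = (if \<tau> then E10 A x else E01 A x)"

definition typed_sections :: "bool \<Rightarrow> ('m \<Rightarrow> 'v \<times> 'v) set" where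
  "typed_sections \<tau> = (if \<tau> then sections10 A else sections01 A)"

text \<open>The eigenvalue of the complex structure on vectors of type \<open>\<tau>\<close>.\<close>

abbreviation sgnI :: "bool \<Rightarrow> complex" where
  "sgnI \<tau> \<equiv> (if \<tau> then \<i> else - \<i>)"

lemma typed_fibreC: "w \<in> typed \<tau> x \<Longrightarrow> w \<in> fibreC A x"
  by (auto simp: typed_def E10_def E01_def split: if_splits)

lemma typed_JC: "w \<in> typed \<tau> x \<Longrightarrow> JC A x w = scaleI (sgnI \<tau>) w"
  by (auto simp: typed_def E10_def E01_def split: if_splits)

lemma typed_sections_iff: "s \<in> typed_sections \<tau> \<longleftrightarrow> s \<in> sectionsC A \<and> (\<forall>x. s x \<in> typed \<tau> x)"
  by (auto simp: typed_sections_def typed_def sections10_def sections01_def)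

text \<open>Apply the projection to a global section through \<open>w\<close>.\<close>

lemma typed_section_through:
  assumes "w \<in> typed \<tau> x"
  shows "\<exists>s. s \<in> typed_sections \<tau> \<and> s x = w"
proof -
  obtain s where s: "s \<in> sectionsC A" "s x = w"
    using sectionC_through[OF typed_fibreC[OF assms]] by blast
  show ?thesis
    using s assms proj_section[OF s(1)] proj_E10[OF sectionsC_fibre[OF s(1)]] proj_E01[OF sectionsC_fibre[OF s(1)]]
      proj_E10_id(1)[of w x] proj_E01_id[of w x]
    by (intro exI[of _ "\<lambda>y. type_proj (if \<tau> then - \<i> else \<i>) y (s y)"]) (auto simp: typed_sections_iff typed_def)
qed

lemma E10_Int_E01: "w \<in> E10 A x \<Longrightarrow> w \<in> E01 A x \<Longrightarrow> w = 0"
  using proj_E10_id(2)[of w x] proj_E01_id[of w x] by simp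

lemma Omega_vanish:
  assumes \<omega>: "\<omega> \<in> Omega A p q" and ws: "list_all2 (\<lambda>\<tau> w. w \<in> typed \<tau> x) ts ws"
    and len: "length ts = p + q" and num: "length (filter id ts) \<noteq> p"
  shows "\<omega> x ws = 0"
proof -
  have \<omega>': "\<omega> \<in> forms A (p + q)"
    and van: "\<And>ws. length ws = p + q \<Longrightarrow> set ws \<subseteq> E10 A x \<union> E01 A x \<Longrightarrow>
      length (filter (\<lambda>w. w \<in> E10 A x) ws) \<noteq> p \<Longrightarrow> \<omega> x ws = 0"
    using \<omega> by (auto simp: Omega_def)
  have len': "length ws = p + q"
    using ws len by (simp add: list_all2_lengthD)
  have ty: "ws ! k \<in> typed (ts ! k) x" if "k < p + q" for k
    using list_all2_nthD[OF ws] that len by simp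
  have sub: "set ws \<subseteq> E10 A x \<union> E01 A x"
    using ty len' by (auto simp: in_set_conv_nth typed_def split: if_splits) (metis (full_types))
  show ?thesis
  proof (cases "0 \<in> set ws")
    case True
    have "set ws \<subseteq> fibreC A x"
      using sub by (auto simp: E10_def E01_def)
    then show ?thesis
      using fib.alternating_zero_arg[OF form_alternating[OF \<omega>'] len' _ True] by simp
  next
    case False
    have "ws ! k \<in> E10 A x \<longleftrightarrow> ts ! k" if "k < p + q" for k
    proof -
      have "ws ! k \<noteq> 0"
        using False nth_mem[of k ws] that len' by metis
      then show ?thesis
        using ty[OF that] E10_Int_E01[of "ws ! k" x] by (cases "ts ! k") (auto simp: typed_def)
    qed
    then have "length (filter (\<lambda>w. w \<in> E10 A x) ws) = length (filter id ts)"
      using len len' by (auto simp: length_filter_conv_card intro!: arg_cong[of _ _ card])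
    then show ?thesis
      using van[OF len' sub] num by simp
  qed
qed

lemma form_eval_vanish:
  assumes "\<omega> \<in> Omega A p q" "list_all2 (\<lambda>\<tau> s. s \<in> typed_sections \<tau>) ts ss"
    "length ts = p + q" "length (filter id ts) \<noteq> p"
  shows "form_eval \<omega> ss = 0"
proof (rule ext)
  fix x
  have "list_all2 (\<lambda>\<tau> w. w \<in> typed \<tau> x) ts (map (\<lambda>s. s x) ss)"
    unfolding list_all2_map2 using assms(2) by (rule list_all2_mono) (simp add: typed_sections_iff)
  then show "form_eval \<omega> ss x = 0 x"
    unfolding form_eval_def using Omega_vanish[OF assms(1) _ assms(3,4)] by simp
qed

lemma Omega_forms: "\<omega> \<in> Omega A p q \<Longrightarrow> \<omega> \<in> forms A (p + q)"
  by (simp add: Omega_def)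

abbreviation "closed_type \<tau> \<equiv> \<forall>s\<in>typed_sections \<tau>. \<forall>t\<in>typed_sections \<tau>. bracketC A s t \<in> typed_sections \<tau>"

lemma typed_list_sections:
  "list_all2 (\<lambda>\<tau> s. s \<in> typed_sections \<tau>) ts ss \<Longrightarrow> set ss \<subseteq> sectionsC A"
  by (auto simp: list_all2_conv_all_nth in_set_conv_nth typed_sections_iff)

text \<open>All summands of the differential vanish for reasons of type. A bracket of two sections of the same type has that type
  by assumption; a bracket of sections of different types is the sum of its components of both types.\<close>

lemma dE_vanish:
  assumes cl: "closed_type True" "closed_type False"
    and \<omega>: "\<omega> \<in> Omega A p q" and ss: "list_all2 (\<lambda>\<tau> s. s \<in> typed_sections \<tau>) ts ss"
    and len: "length ts = Suc (p + q)" and num: "length (filter id ts) \<noteq> p" "length (filter id ts) \<noteq> Suc p"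
  shows "cpx.d (form_eval \<omega>) ss = 0"
proof -
  have len': "length ss = Suc (p + q)"
    using ss len by (simp add: list_all2_lengthD)
  have ty: "ss ! i \<in> typed_sections (ts ! i)" if "i < Suc (p + q)" for i
    using list_all2_nthD[OF ss] that len by simp
  have "actC (ss ! i) (form_eval \<omega> (omit i ss)) = 0" if i: "i < Suc (p + q)" for i
  proof -
    have "form_eval \<omega> (omit i ss) = 0"
      using i num len filter_omit[of i ts id]
      by (intro form_eval_vanish[OF \<omega> list_all2_omit[OF ss]]) (auto simp: length_omit split: if_splits)
    then show ?thesis
      using ty[OF i] actC_zero by (simp add: typed_sections_iff)
  qed
  moreover have "form_eval \<omega> (bracketC A (ss ! i) (ss ! j) # omit i (omit j ss)) = 0"
    if ij: "i < j" "j < Suc (p + q)" for i j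
  proof -
    let ?b = "bracketC A (ss ! i) (ss ! j)" and ?us = "omit i (omit j ss)" and ?us' = "omit i (omit j ts)"
    have us: "list_all2 (\<lambda>\<tau> s. s \<in> typed_sections \<tau>) ?us' ?us"
      by (intro list_all2_omit ss)
    have l: "Suc (length ?us') = p + q"
      using ij len by (simp add: length_omit)
    have c: "length (filter id ?us') + (if ts ! i then 1 else 0) + (if ts ! j then 1 else 0) = length (filter id ts)"
      using filter_omit[of i "omit j ts" id] filter_omit[of j ts id] nth_omit_less[of i j ts] ij len
      by (simp add: length_omit)
    have ti: "ss ! i \<in> typed_sections (ts ! i)" and tj: "ss ! j \<in> typed_sections (ts ! j)"
      using ty ij by auto
    have b: "?b \<in> sectionsC A"
      using ti tj by (intro cpx.br_closed) (simp_all add: typed_sections_iff)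
    have cons: "form_eval \<omega> (t # ?us) = 0"
      if "t \<in> typed_sections \<tau>" "length (filter id ?us') + (if \<tau> then 1 else 0) \<noteq> p" for t \<tau>
      using that us l by (intro form_eval_vanish[OF \<omega>, of "\<tau> # ?us'"]) auto
    show ?thesis
    proof (cases "ts ! i = ts ! j")
      case True
      have "?b \<in> typed_sections (ts ! i)"
        using cl ti tj True by (cases "ts ! i") auto
      then show ?thesis
        using c num True by (intro cons[of _ "ts ! i"]) (auto split: if_splits)
    next
      case False
      let ?b' = "\<lambda>x. type_proj (- \<i>) x (?b x)" and ?b'' = "\<lambda>x. type_proj \<i> x (?b x)"
      have bt: "?b' \<in> typed_sections True" "?b'' \<in> typed_sections False"
        using proj_section[OF b] proj_E10[OF sectionsC_fibre[OF b]] proj_E01[OF sectionsC_fibre[OF b]]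
        by (auto simp: typed_sections_iff typed_def)
      have "length (filter id ts) = Suc (length (filter id ?us'))"
        using c False by (auto split: if_splits)
      then have z: "form_eval \<omega> (?b' # ?us) = 0" "form_eval \<omega> (?b'' # ?us) = 0"
        using num by (auto intro!: cons[OF bt(1)] cons[OF bt(2)])
      have S: "?b' \<in> sectionsC A" "?b'' \<in> sectionsC A" "set ?us \<subseteq> sectionsC A"
        using bt typed_list_sections[OF us] by (auto simp: typed_sections_iff)
      have "length ?us = length ?us'"
        using us by (simp add: list_all2_lengthD)
      then have "form_eval \<omega> ((?b # ?us)[0 := ?b' + ?b'']) = form_eval \<omega> ((?b # ?us)[0 := ?b']) + form_eval \<omega> ((?b # ?us)[0 := ?b''])"
        using l b S by (intro sec.alternating_add[OF form_eval_alternating[OF Omega_forms[OF \<omega>]]]) auto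
      moreover have "?b' + ?b'' = ?b"
        by (rule ext) (simp add: proj_add_proj)
      ultimately show ?thesis
        using z by simp
    qed
  qed
  ultimately show ?thesis
    unfolding cpx.d_def len' by simp
qed

lemma typed_lists_through:
  assumes "set ws \<subseteq> E10 A x \<union> E01 A x"
  obtains ss where "list_all2 (\<lambda>\<tau> s. s \<in> typed_sections \<tau>) (map (\<lambda>w. w \<in> E10 A x) ws) ss" "map (\<lambda>s. s x) ss = ws"
proof -
  have "\<exists>ss. list_all2 (\<lambda>\<tau> s. s \<in> typed_sections \<tau>) (map (\<lambda>w. w \<in> E10 A x) ws) ss \<and> map (\<lambda>s. s x) ss = ws"
    using assms
  proof (induction ws)
    case (Cons w ws)
    have "w \<in> typed (w \<in> E10 A x) x"
      using Cons.prems by (auto simp: typed_def)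
    then obtain s where "s \<in> typed_sections (w \<in> E10 A x)" "s x = w"
      using typed_section_through by blast
    moreover obtain ss where "list_all2 (\<lambda>\<tau> s. s \<in> typed_sections \<tau>) (map (\<lambda>w. w \<in> E10 A x) ws) ss" "map (\<lambda>s. s x) ss = ws"
      using Cons by auto
    ultimately show ?case
      by (intro exI[of _ "s # ss"]) simp
  qed simp
  then show ?thesis using that by blast
qed

lemma alternating_type_component:
  assumes \<Phi>: "sec.alternating (p + q) \<Phi>"
    and van: "\<And>ts ss. list_all2 (\<lambda>\<tau> s. s \<in> typed_sections \<tau>) ts ss \<Longrightarrow> length ts = p + q \<Longrightarrow>
      length (filter id ts) \<noteq> p \<Longrightarrow> \<Phi> ss = 0"
  obtains \<eta> where "\<eta> \<in> Omega A p q" "\<And>ss. length ss = p + q \<Longrightarrow> set ss \<subseteq> sectionsC A \<Longrightarrow> form_eval \<eta> ss = \<Phi> ss"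
proof -
  obtain \<eta> where \<eta>: "\<eta> \<in> forms A (p + q)" "\<And>ss. length ss = p + q \<Longrightarrow> set ss \<subseteq> sectionsC A \<Longrightarrow> form_eval \<eta> ss = \<Phi> ss"
    using alternating_is_form[OF \<Phi>] by blast
  have "\<eta> x ws = 0"
    if ws: "length ws = p + q" "set ws \<subseteq> E10 A x \<union> E01 A x" "length (filter (\<lambda>w. w \<in> E10 A x) ws) \<noteq> p" for x ws
  proof -
    obtain ss where ss: "list_all2 (\<lambda>\<tau> s. s \<in> typed_sections \<tau>) (map (\<lambda>w. w \<in> E10 A x) ws) ss" "map (\<lambda>s. s x) ss = ws"
      using typed_lists_through[OF ws(2)] .
    have "\<Phi> ss = 0"
      using ws by (intro van[OF ss(1)]) (simp_all add: filter_map comp_def)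
    moreover have "form_eval \<eta> ss = \<Phi> ss"
      using ss ws(1) typed_list_sections[OF ss(1)] by (intro \<eta>(2)) auto
    moreover have "\<eta> x ws = form_eval \<eta> ss x"
      by (simp add: form_eval_def ss(2))
    ultimately show ?thesis by simp
  qed
  then have "\<eta> \<in> Omega A p q"
    using \<eta>(1) by (simp add: Omega_def)
  then show ?thesis
    using \<eta>(2) by (rule that)
qed

text \<open>The components of types \<open>(p + 1, q)\<close> and \<open>(p, q + 1)\<close> of \<open>\<Phi> = d \<omega>\<close> are separated by the derivation \<open>D\<close> that extends the complex
  structure: it acts on forms of type \<open>(a, b)\<close> as multiplication by \<open>\<i> (a - b)\<close>. On the two types that occur, \<open>-\<i> D\<close> has the
  eigenvalues \<open>N + 1\<close> and \<open>N - 1\<close> with \<open>N = p - q\<close>, so that \<open>(-\<i> D + 1 - N) / 2\<close> and \<open>(\<i> D + 1 + N) / 2\<close> are the projections.\<close>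

lemma dE_in_form_sum:
  assumes cl: "closed_type True" "closed_type False" and \<omega>: "\<omega> \<in> Omega A p q"
  shows "dE_in A (p + q) \<omega> (form_sum (Omega A (p + 1) q) (Omega A p (q + 1)))"
proof -
  define \<Phi> where "\<Phi> = cpx.d (form_eval \<omega>)"
  have \<Phi>: "sec.alternating (Suc (p + q)) \<Phi>"
    unfolding \<Phi>_def by (intro cpx.d_alternating form_eval_alternating Omega_forms \<omega>)
  define D where "D ss = (\<Sum>k<Suc (p + q). \<Phi> (ss[k := (\<lambda>x. JC A x ((ss ! k) x))]))" for ss
  have D: "sec.alternating (Suc (p + q)) D"
    unfolding D_def
  proof (rule sec.alternating_derivation[OF \<Phi>, where T = "\<lambda>s x. JC A x (s x)"])
    show "(\<lambda>x. JC A x ((smulC a u + smulC b v) x)) = smulC a (\<lambda>x. JC A x (u x)) + smulC b (\<lambda>x. JC A x (v x))"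
      if "u \<in> sectionsC A" "v \<in> sectionsC A" for u v a b
      using sectionsC_fibre[OF that(1)] sectionsC_fibre[OF that(2)]
      by (intro ext) (simp add: smulC_def JC_add JC_scaleI fibreC_scaleI)
  qed (rule JC_section)
  have const: "(\<lambda>_. z) \<in> csmooth" for z
    by (intro csmoothI msmooth_const open_UNIV)
  define N where "N = (of_nat p - of_nat q :: complex)"
  define G where "G a b ss = (\<lambda>_. a) * D ss + (\<lambda>_. b) * \<Phi> ss" for a b ss
  have G: "sec.alternating (Suc (p + q)) (G a b)" for a b
    unfolding G_def by (rule sec.alternating_lincomb[OF D \<Phi> const const])
  have G_typed: "G a b ss = (\<lambda>_. a * \<i> * (2 * of_nat (length (filter id ts)) - of_nat (Suc (p + q))) + b) * \<Phi> ss"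
    if ss: "list_all2 (\<lambda>\<tau> s. s \<in> typed_sections \<tau>) ts ss" and len: "length ts = Suc (p + q)" for ts ss a b
  proof -
    have len': "length ss = Suc (p + q)"
      using ss len by (simp add: list_all2_lengthD)
    have S: "set ss \<subseteq> sectionsC A"
      by (rule typed_list_sections[OF ss])
    have "\<Phi> (ss[k := (\<lambda>x. JC A x ((ss ! k) x))]) = (\<lambda>_. sgnI (ts ! k)) * \<Phi> ss" if k: "k < Suc (p + q)" for k
    proof -
      have t: "ss ! k \<in> typed_sections (ts ! k)"
        using list_all2_nthD[OF ss] k len by simp
      then have "(\<lambda>x. JC A x ((ss ! k) x)) = smulC (\<lambda>_. sgnI (ts ! k)) (ss ! k)"
        by (intro ext) (simp add: typed_sections_iff smulC_def typed_JC)
      then show ?thesis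
        using sec.alternating_smul[OF \<Phi> len' S k _ const, of "ss ! k"] t by (simp add: typed_sections_iff)
    qed
    then have D_sum: "D ss = (\<Sum>k<Suc (p + q). (\<lambda>_. sgnI (ts ! k)) * \<Phi> ss)"
      unfolding D_def by (intro sum.cong) auto
    have sgn: "(\<Sum>k<Suc (p + q). sgnI (ts ! k)) = \<i> * (\<Sum>k<length ts. if ts ! k then 1 else - 1)"
      unfolding sum_distrib_left len by (intro sum.cong) auto
    have "D ss x = (\<Sum>k<Suc (p + q). sgnI (ts ! k)) * \<Phi> ss x" for x
      unfolding D_sum sum_fun_apply times_fun_apply by (rule sum_distrib_right[symmetric])
    then show ?thesis
      unfolding G_def sgn sum_signs unfolding len
      by (intro ext) (simp only: plus_fun_apply times_fun_apply ring_distribs ac_simps)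
  qed
  have van: "\<Phi> ss = 0" if "list_all2 (\<lambda>\<tau> s. s \<in> typed_sections \<tau>) ts ss" "length ts = Suc (p + q)"
      "length (filter id ts) \<noteq> p" "length (filter id ts) \<noteq> Suc p" for ts ss
    unfolding \<Phi>_def by (rule dE_vanish[OF cl \<omega> that])
  obtain \<alpha> where \<alpha>: "\<alpha> \<in> Omega A (p + 1) q"
    "\<And>ss. length ss = (p + 1) + q \<Longrightarrow> set ss \<subseteq> sectionsC A \<Longrightarrow> form_eval \<alpha> ss = G (- \<i> / 2) ((1 - N) / 2) ss"
  proof (rule alternating_type_component[of "p + 1" q "G (- \<i> / 2) ((1 - N) / 2)"])
    show "sec.alternating (p + 1 + q) (G (- \<i> / 2) ((1 - N) / 2))"
      using G by simp
    show "G (- \<i> / 2) ((1 - N) / 2) ss = 0"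
      if "list_all2 (\<lambda>\<tau> s. s \<in> typed_sections \<tau>) ts ss" "length ts = p + 1 + q" "length (filter id ts) \<noteq> p + 1" for ts ss
    proof (cases "length (filter id ts) = p")
      case True
      have "- \<i> / 2 * \<i> * (2 * of_nat p - of_nat (Suc (p + q))) + (1 - N) / 2 = 0"
        by (simp add: N_def field_simps)
      then show ?thesis
        using G_typed[OF that(1), of "- \<i> / 2" "(1 - N) / 2"] that(2) True by (simp add: fun_eq_iff)
    next
      case False
      then have "\<Phi> ss = 0"
        using that by (intro van[OF that(1)]) auto
      then show ?thesis
        using G_typed[OF that(1)] that(2) by simp
    qed
  qed (rule that)
  obtain \<beta> where \<beta>: "\<beta> \<in> Omega A p (q + 1)"
    "\<And>ss. length ss = p + (q + 1) \<Longrightarrow> set ss \<subseteq> sectionsC A \<Longrightarrow> form_eval \<beta> ss = G (\<i> / 2) ((1 + N) / 2) ss"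
  proof (rule alternating_type_component[of p "q + 1" "G (\<i> / 2) ((1 + N) / 2)"])
    show "sec.alternating (p + (q + 1)) (G (\<i> / 2) ((1 + N) / 2))"
      using G by simp
    show "G (\<i> / 2) ((1 + N) / 2) ss = 0"
      if "list_all2 (\<lambda>\<tau> s. s \<in> typed_sections \<tau>) ts ss" "length ts = p + (q + 1)" "length (filter id ts) \<noteq> p" for ts ss
    proof (cases "length (filter id ts) = Suc p")
      case True
      have "\<i> / 2 * \<i> * (2 * of_nat (Suc p) - of_nat (Suc (p + q))) + (1 + N) / 2 = 0"
        by (simp add: N_def field_simps)
      then show ?thesis
        using G_typed[OF that(1), of "\<i> / 2" "(1 + N) / 2"] that(2) True by (simp add: fun_eq_iff)
    next
      case False
      then have "\<Phi> ss = 0"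
        using that by (intro van[OF that(1)]) auto
      then show ?thesis
        using G_typed[OF that(1)] that(2) by simp
    qed
  qed (rule that)
  have "dE A \<omega> ss = form_eval (\<lambda>x ws. \<alpha> x ws + \<beta> x ws) ss" if ss: "length ss = Suc (p + q)" "set ss \<subseteq> sectionsC A" for ss
  proof -
    have "form_eval (\<lambda>x ws. \<alpha> x ws + \<beta> x ws) ss = form_eval \<alpha> ss + form_eval \<beta> ss"
      by (rule ext) (simp add: form_eval_def)
    also have "\<dots> = G (- \<i> / 2) ((1 - N) / 2) ss + G (\<i> / 2) ((1 + N) / 2) ss"
      using \<alpha>(2) \<beta>(2) ss by simp
    also have "\<dots> = \<Phi> ss"
      by (rule ext) (simp add: G_def field_simps)
    finally show ?thesis
      by (simp add: dE_eq_d \<Phi>_def)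
  qed
  then show ?thesis
    unfolding dE_in_def form_sum_def using \<alpha>(1) \<beta>(1) by blast
qed

section \<open>Separation by forms of type (0, 1)\<close>

lemma coord_linearC:
  assumes "(U, e) \<in> frames A" "x \<in> U" "v \<in> fibreC A x" "w \<in> fibreC A x" "i < n"
  defines "cc \<equiv> \<lambda>w. Complex (coord e x (fst w) i) (coord e x (snd w) i)"
  shows "cc (scaleI a v + scaleI b w) = a * cc v + b * cc w"
proof -
  have m: "fst v \<in> fibre A x" "snd v \<in> fibre A x" "fst w \<in> fibre A x" "snd w \<in> fibre A x"
    using assms(3,4) by (auto simp: fibreC_iff)
  note lin = coord_linear[OF assms(1,2) _ _ assms(5)]
  have add: "coord e x (s + t) i = coord e x s i + coord e x t i" if "s \<in> fibre A x" "t \<in> fibre A x" for s t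
    using lin[OF that, of 1 1] by simp
  have scale: "cc (scaleI c w) = c * cc w" if "w \<in> fibreC A x" for c w
    using lin[of "fst w" "snd w" "Re c" "- Im c"] lin[of "snd w" "fst w" "Re c" "Im c"] that
    by (simp add: cc_def complex_eq_iff fibreC_iff)
  have "cc (s + t) = cc s + cc t" if "s \<in> fibreC A x" "t \<in> fibreC A x" for s t
    using that by (simp add: cc_def complex_eq_iff fibreC_iff add)
  then show ?thesis
    using assms(3,4) by (simp add: fibreC_scaleI scale)
qed

text \<open>There are enough forms of type \<open>(0, 1)\<close>: the coordinates, in a local frame, of the \<open>(0, 1)\<close>-part of a vector, cut off by
  a bump function.\<close>

lemma E10_if_Omega01_vanish:
  assumes w: "w \<in> fibreC A x" and van: "\<And>\<omega>. \<omega> \<in> Omega A 0 1 \<Longrightarrow> \<omega> x [w] = 0"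
  shows "w \<in> E10 A x"
proof -
  obtain U e where fr: "(U, e) \<in> frames A" and x: "x \<in> U"
    using frame_cover by blast
  note U = frame_open[OF fr]
  obtain \<beta> C where \<beta>: "\<beta> \<in> smooth_functions K" "closed C" "C \<subseteq> U" "\<beta> x = 1" "\<And>y. y \<notin> C \<Longrightarrow> \<beta> y = 0"
    using exists_bump[OF U x] by metis
  define cc where "cc i y w = Complex (coord e y (fst w) i) (coord e y (snd w) i)" for i y w
  have cc0: "cc i x (type_proj \<i> x w) = 0" if i: "i < n" for i
  proof -
    \<comment> \<open>the value at the one-element list \<open>[s]\<close> is the \<open>i\<close>-th coordinate of the \<open>(0, 1)\<close>-part of \<open>s\<close>, times \<open>\<beta>\<close>\<close>
    define \<Phi> where "\<Phi> ss = (\<lambda>y. if y \<in> U then \<beta> y *\<^sub>R cc i y (type_proj \<i> y (hd ss y)) else 0)" for ss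
    have P: "type_proj \<i> y v \<in> fibreC A y" if "v \<in> fibreC A y" for y v
      using proj_E01[OF that] by (simp add: E01_def)
    have Plin: "type_proj \<i> y (scaleI a u + scaleI b v) = scaleI a (type_proj \<i> y u) + scaleI b (type_proj \<i> y v)"
      if "u \<in> fibreC A y" "v \<in> fibreC A y" for y u v a b
      using that by (simp add: type_proj_def JC_add JC_scaleI fibreC_scaleI scaleI_add_right scaleI_scaleI ac_simps)
    have alt: "sec.alternating (0 + 1) \<Phi>"
      unfolding sec.alternating_def
    proof (intro allI impI conjI ballI)
      fix ss assume "length ss = 0 + 1 \<and> set ss \<subseteq> sectionsC A"
      then obtain s where ss: "ss = [s]" and s: "s \<in> sectionsC A"
        by (cases ss) auto
      have Ps: "(\<lambda>y. fst (type_proj \<i> y (s y))) \<in> sections A" "(\<lambda>y. snd (type_proj \<i> y (s y))) \<in> sections A"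
        using proj_section[OF s] by (simp_all add: sectionsC_iff)
      have "msmooth_on K (U \<inter> UNIV) (\<lambda>y. cc i y (type_proj \<i> y (s y)))"
        using msmooth_of_Re_Im[OF U, of "\<lambda>y. cc i y (type_proj \<i> y (s y))"]
          section_coord_smooth[OF Ps(1) fr i] section_coord_smooth[OF Ps(2) fr i] by (simp add: cc_def)
      then have "msmooth_on K UNIV (\<lambda>y. if y \<in> U then \<beta> y *\<^sub>R cc i y (type_proj \<i> y (s y)) else 0)"
        by (intro msmooth_extend[OF \<beta>(1-3,5) U open_UNIV])
      then show "\<Phi> ss \<in> csmooth"
        by (intro csmoothI) (simp only: \<Phi>_def ss list.sel)
      fix k :: nat assume k: "k < 0 + 1"
      show "\<Phi> (ss[k := smulC a u + smulC b v]) = a * \<Phi> (ss[k := u]) + b * \<Phi> (ss[k := v])"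
        if uv: "u \<in> sectionsC A" "v \<in> sectionsC A" for u v a b
      proof (rule ext)
        fix y
        have "cc i y (type_proj \<i> y ((smulC a u + smulC b v) y)) = a y * cc i y (type_proj \<i> y (u y)) + b y * cc i y (type_proj \<i> y (v y))" if "y \<in> U"
          using coord_linearC[OF fr that P P i] sectionsC_fibre[OF uv(1), of y] sectionsC_fibre[OF uv(2), of y]
          by (simp add: cc_def smulC_def Plin)
        then show "\<Phi> (ss[k := smulC a u + smulC b v]) y = (a * \<Phi> (ss[k := u]) + b * \<Phi> (ss[k := v])) y"
          using k by (simp add: \<Phi>_def ss scaleR_add_right)
      qed
      show "\<Phi> ss = 0" if "j < k" for j
        using that k by simp
    qed
    obtain \<omega> where \<omega>: "\<omega> \<in> Omega A 0 1" "\<And>ss. length ss = 0 + 1 \<Longrightarrow> set ss \<subseteq> sectionsC A \<Longrightarrow> form_eval \<omega> ss = \<Phi> ss"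
    proof (rule alternating_type_component[OF alt])
      fix ts ss
      assume ss: "list_all2 (\<lambda>\<tau> s. s \<in> typed_sections \<tau>) ts ss" and len: "length ts = 0 + 1"
        and num: "length (filter id ts) \<noteq> 0"
      obtain \<tau> where "ts = [\<tau>]"
        using len by (cases ts) auto
      then obtain s where s: "ss = [s]" "s \<in> typed_sections True"
        using ss num by (cases \<tau>) (auto simp: list_all2_Cons1)
      have "type_proj \<i> y (s y) = 0" for y
        using s(2) proj_E10_id(2)[of "s y" y] by (simp add: typed_sections_iff typed_def)
      moreover have "cc i y 0 = 0" if "y \<in> U" for y
        using coord_eqI[OF fr that _ i, of 0 "\<lambda>_. 0"] by (simp add: cc_def complex_eq_iff)
      ultimately show "\<Phi> ss = 0"
        by (intro ext) (simp add: \<Phi>_def s(1))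
    qed (rule that)
    obtain s where s: "s \<in> sectionsC A" "s x = w"
      using sectionC_through[OF w] by blast
    have "\<omega> x [w] = form_eval \<omega> [s] x"
      by (simp add: form_eval_def s(2))
    also have "\<dots> = cc i x (type_proj \<i> x w)"
      using \<omega>(2)[of "[s]"] s x \<beta>(4) by (simp add: \<Phi>_def)
    finally show ?thesis
      using van[OF \<omega>(1)] by simp
  qed
  have Pw: "type_proj \<i> x w \<in> fibreC A x"
    using proj_E01[OF w] by (simp add: E01_def)
  have "type_proj \<i> x w = 0"
    using coord_eq_0[OF fr x, of "fst (type_proj \<i> x w)"] coord_eq_0[OF fr x, of "snd (type_proj \<i> x w)"] Pw cc0
    by (simp add: fibreC_iff cc_def prod_eq_iff complex_eq_iff)
  then show ?thesis
    using proj_add_proj[of x w] proj_E10[OF w] by simp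
qed

text \<open>For \<open>\<omega>\<close> of type \<open>(0, 1)\<close> and \<open>s\<close>, \<open>t\<close> of type \<open>(1, 0)\<close> the formula for the differential reduces to
  \<open>d \<omega> (s, t) = - \<omega> ([s, t])\<close>, and the left-hand side vanishes if \<open>d \<omega>\<close> has no component of type \<open>(2, 0)\<close>.\<close>

lemma closed10_if_dE:
  assumes dE: "\<forall>\<omega>\<in>Omega A 0 1. dE_in A 1 \<omega> (form_sum (Omega A 1 1) (Omega A 0 2))"
  shows "closed_type True"
proof (intro ballI)
  fix s t assume st: "s \<in> typed_sections True" "t \<in> typed_sections True"
  have S: "s \<in> sectionsC A" "t \<in> sectionsC A"
    using st by (auto simp: typed_sections_iff)
  have b: "bracketC A s t \<in> sectionsC A"
    by (rule cpx.br_closed[OF S])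
  have "bracketC A s t x \<in> E10 A x" for x
  proof (rule E10_if_Omega01_vanish[OF sectionsC_fibre[OF b]])
    fix \<omega> assume \<omega>: "\<omega> \<in> Omega A 0 1"
    obtain \<alpha> \<gamma> where ag: "\<alpha> \<in> Omega A 1 1" "\<gamma> \<in> Omega A 0 2"
      "\<forall>ss. length ss = Suc 1 \<and> set ss \<subseteq> sectionsC A \<longrightarrow> dE A \<omega> ss = form_eval (\<lambda>x ws. \<alpha> x ws + \<gamma> x ws) ss"
      using bspec[OF dE \<omega>] unfolding dE_in_def form_sum_def by blast
    have ty: "list_all2 (\<lambda>\<tau> s. s \<in> typed_sections \<tau>) [True, True] [s, t]"
      using st by simp
    have "form_eval \<alpha> [s, t] = 0" "form_eval \<gamma> [s, t] = 0"
      using form_eval_vanish[OF ag(1) ty] form_eval_vanish[OF ag(2) ty] by simp_all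
    then have "cpx.d (form_eval \<omega>) [s, t] x = 0"
      using ag(3) S by (simp add: form_eval_def fun_eq_iff flip: dE_eq_d)
    moreover have "form_eval \<omega> [s] = 0" "form_eval \<omega> [t] = 0"
      using form_eval_vanish[OF \<omega>, of "[True]" "[s]"] form_eval_vanish[OF \<omega>, of "[True]" "[t]"] st by simp_all
    ultimately show "\<omega> x [bracketC A s t x] = 0"
      using actC_zero[OF S(1)] actC_zero[OF S(2)]
      by (simp add: cpx.d_def omit_def form_eval_def)
  qed
  then show "bracketC A s t \<in> typed_sections True"
    using b by (simp add: typed_sections_iff typed_def)
qed

section \<open>Conjugation and the Nijenhuis tensor\<close>

text \<open>Complex conjugation of sections; it exchanges the two types.\<close>

definition conjC :: "('m \<Rightarrow> 'v \<times> 'v) \<Rightarrow> 'm \<Rightarrow> 'v \<times> 'v" where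
  "conjC s = (\<lambda>x. (fst (s x), - snd (s x)))"

lemma conjC_conjC [simp]: "conjC (conjC s) = s"
  by (simp add: conjC_def)

lemma conjC_sections: "s \<in> sectionsC A \<Longrightarrow> conjC s \<in> sectionsC A"
  using sections_linear[of "\<lambda>x. snd (s x)" "\<lambda>x. snd (s x)" "- 1" 0] by (simp add: sectionsC_iff conjC_def)

lemma conjC_typed: "s \<in> typed_sections \<tau> \<Longrightarrow> conjC s \<in> typed_sections (\<not> \<tau>)"
  using conjC_sections[of s] sectionsC_fibre[of "conjC s"]
  by (auto simp: typed_sections_iff typed_def E10_def E01_def JC_def conjC_def scaleI_def fibreC_iff J_uminus
      split: if_splits)

lemma conjC_bracket:
  assumes "s \<in> sectionsC A" "t \<in> sectionsC A"
  shows "bracketC A (conjC s) (conjC t) = conjC (bracketC A s t)"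
  using assms sections_linear[of "\<lambda>x. snd (s x)" "\<lambda>x. snd (s x)" "- 1" 0]
    sections_linear[of "\<lambda>x. snd (t x)" "\<lambda>x. snd (t x)" "- 1" 0]
  by (intro ext) (simp add: bracketC_apply conjC_def sectionsC_iff bracket_uminus_left bracket_uminus_right)

lemma closed_type_conj:
  assumes "closed_type \<tau>"
  shows "closed_type (\<not> \<tau>)"
proof (intro ballI)
  fix s t assume st: "s \<in> typed_sections (\<not> \<tau>)" "t \<in> typed_sections (\<not> \<tau>)"
  then have "conjC (bracketC A (conjC s) (conjC t)) \<in> typed_sections (\<not> \<tau>)"
    using assms conjC_typed[OF st(1)] conjC_typed[OF st(2)] by (intro conjC_typed) simp
  moreover have "bracketC A (conjC s) (conjC t) = conjC (bracketC A s t)"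
    using st by (intro conjC_bracket) (simp_all add: typed_sections_iff)
  ultimately show "bracketC A s t \<in> typed_sections (\<not> \<tau>)"
    by simp
qed

lemma apply_J_section: "s \<in> sections A \<Longrightarrow> apply_J A s \<in> sections A"
  unfolding apply_J_def by (rule endomorphism_section[OF J_endo])

lemma typed_True_iff:
  assumes "s \<in> sectionsC A"
  shows "s \<in> typed_sections True \<longleftrightarrow> (\<forall>x. snd (s x) = - cplx_str A x (fst (s x)))"
proof -
  have "s x \<in> E10 A x \<longleftrightarrow> snd (s x) = - cplx_str A x (fst (s x))" for x
    using sectionsC_fibre[OF assms, of x] J_J[of "fst (s x)" x] J_uminus[OF J_mem, of "fst (s x)" x]
    by (auto simp: E10_def JC_def scaleI_def fibreC_iff prod_eq_iff)
  then show ?thesis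
    using assms by (simp add: typed_sections_iff typed_def)
qed

text \<open>The sections of type \<open>(1, 0)\<close> are the sections \<open>s - \<i> J s\<close> with \<open>s\<close> real, and the bracket of two of them is \<open>P - \<i> Q\<close> with
  \<open>P = [s, t] - [J s, J t]\<close> and \<open>Q = [s, J t] + [J s, t]\<close>. It has type \<open>(1, 0)\<close> if \<open>Q = J P\<close>, and the Nijenhuis tensor is
  \<open>- P - J Q\<close>.\<close>

lemma bracket10_iff:
  assumes s: "s \<in> sections A" and t: "t \<in> sections A"
  defines "e \<equiv> \<lambda>s x. (s x, - apply_J A s x)"
  shows "bracketC A (e s) (e t) \<in> typed_sections True \<longleftrightarrow> nijenhuis A s t = (\<lambda>x. 0)"
proof -
  note J = apply_J_section[OF s] apply_J_section[OF t]
  have neg: "(\<lambda>x. - u x) \<in> sections A" if "u \<in> sections A" for u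
    using sections_linear[OF that that, of "- 1" 0] by simp
  have e: "e s \<in> sectionsC A" "e t \<in> sectionsC A"
    using s t neg J by (simp_all add: e_def sectionsC_iff)
  define P where "P x = bracket A s t x - bracket A (apply_J A s) (apply_J A t) x" for x
  define Q where "Q x = bracket A s (apply_J A t) x + bracket A (apply_J A s) t x" for x
  have b: "bracketC A (e s) (e t) x = (P x, - Q x)" for x
    using s t J neg by (simp add: bracketC_apply e_def P_def Q_def bracket_uminus_left bracket_uminus_right)
  have m: "bracket A s t x \<in> fibre A x" "bracket A (apply_J A s) (apply_J A t) x \<in> fibre A x"
    "bracket A s (apply_J A t) x \<in> fibre A x" "bracket A (apply_J A s) t x \<in> fibre A x" for x
    by (intro section_fibre bracket_closed s t J)+
  have PQ: "P x \<in> fibre A x" "Q x \<in> fibre A x" for x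
    unfolding P_def Q_def by (intro subspace_add subspace_diff fibre_subspace m)+
  have N: "nijenhuis A s t x = - P x - cplx_str A x (Q x)" for x
    unfolding nijenhuis_def P_def Q_def J_add[OF m(3,4)] by (simp add: apply_J_def)
  have "- Q x = - cplx_str A x (P x) \<longleftrightarrow> - P x - cplx_str A x (Q x) = 0" for x
  proof
    assume "- Q x = - cplx_str A x (P x)"
    then have "Q x = cplx_str A x (P x)" by simp
    then show "- P x - cplx_str A x (Q x) = 0" using J_J[OF PQ(1)] by simp
  next
    assume "- P x - cplx_str A x (Q x) = 0"
    then have "P x = - cplx_str A x (Q x)" by (metis eq_iff_diff_eq_0 minus_minus)
    then show "- Q x = - cplx_str A x (P x)" using J_J[OF PQ(2)] J_uminus[OF J_mem[OF PQ(2)]] by simp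
  qed
  then show ?thesis
    unfolding typed_True_iff[OF cpx.br_closed[OF e]] b fun_eq_iff N by simp
qed

lemma closed10_iff_nijenhuis:
  "closed_type True \<longleftrightarrow> (\<forall>s\<in>sections A. \<forall>t\<in>sections A. nijenhuis A s t = (\<lambda>x. 0))"
proof -
  let ?e = "\<lambda>s x. (s x, - apply_J A s x)"
  have mem: "?e s \<in> typed_sections True" if s: "s \<in> sections A" for s
  proof -
    have "?e s \<in> sectionsC A"
      using s sections_linear[OF apply_J_section[OF s] apply_J_section[OF s], of "- 1" 0] by (simp add: sectionsC_iff)
    then show ?thesis
      by (simp add: typed_True_iff apply_J_def)
  qed
  have rep: "\<exists>s'\<in>sections A. s = ?e s'" if "s \<in> typed_sections True" for s
  proof -
    have s: "s \<in> sectionsC A"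
      using that by (simp add: typed_sections_iff)
    then have "s = ?e (\<lambda>x. fst (s x))"
      using that by (intro ext) (simp add: typed_True_iff apply_J_def prod_eq_iff)
    moreover have "(\<lambda>x. fst (s x)) \<in> sections A"
      using s by (simp add: sectionsC_iff)
    ultimately show ?thesis
      by (intro bexI[of _ "\<lambda>x. fst (s x)"])
  qed
  show ?thesis
  proof (intro iffI ballI)
    fix s t assume cl: "closed_type True" and st: "s \<in> sections A" "t \<in> sections A"
    have "bracketC A (?e s) (?e t) \<in> typed_sections True"
      using cl mem[OF st(1)] mem[OF st(2)] by simp
    then show "nijenhuis A s t = (\<lambda>x. 0)"
      using bracket10_iff[OF st] by simp
  next
    fix s t assume N: "\<forall>s\<in>sections A. \<forall>t\<in>sections A. nijenhuis A s t = (\<lambda>x. 0)"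
      and st: "s \<in> typed_sections True" "t \<in> typed_sections True"
    obtain s' t' where st': "s' \<in> sections A" "s = ?e s'" "t' \<in> sections A" "t = ?e t'"
      using rep[OF st(1)] rep[OF st(2)] by (elim bexE)
    have "nijenhuis A s' t' = (\<lambda>x. 0)"
      using N st'(1,3) by simp
    then show "bracketC A s t \<in> typed_sections True"
      unfolding st'(2,4) bracket10_iff[OF st'(1,3)] .
  qed
qed

end

theorem theorem2p1:
  fixes A :: "('m::{t2_space,second_countable_topology}, 'k::real_inner, 'v::real_vector)
                almost_complex_lie_algebroid"
  assumes "almost_complex_lie_algebroid A"
  shows "let
      i = (\<forall>s1\<in>sections10 A. \<forall>s2\<in>sections10 A. bracketC A s1 s2 \<in> sections10 A);
      ii = (\<forall>s1\<in>sections01 A. \<forall>s2\<in>sections01 A. bracketC A s1 s2 \<in> sections01 A);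
      iii = ((\<forall>\<omega>\<in>Omega A 1 0. dE_in A 1 \<omega> (form_sum (Omega A 2 0) (Omega A 1 1))) \<and>
             (\<forall>\<omega>\<in>Omega A 0 1. dE_in A 1 \<omega> (form_sum (Omega A 1 1) (Omega A 0 2))));
      iv = (\<forall>p q. \<forall>\<omega>\<in>Omega A p q.
             dE_in A (p + q) \<omega> (form_sum (Omega A (p + 1) q) (Omega A p (q + 1))));
      v = (\<forall>s1\<in>sections A. \<forall>s2\<in>sections A. nijenhuis A s1 s2 = (\<lambda>x. 0))
    in (i \<longleftrightarrow> ii) \<and> (i \<longleftrightarrow> iii) \<and> (i \<longleftrightarrow> iv) \<and> (i \<longleftrightarrow> v)"
proof -
  interpret almost_complex_algebroid A
    using assms by unfold_locales
  define i where "i = (\<forall>s1\<in>sections10 A. \<forall>s2\<in>sections10 A. bracketC A s1 s2 \<in> sections10 A)"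
  define ii where "ii = (\<forall>s1\<in>sections01 A. \<forall>s2\<in>sections01 A. bracketC A s1 s2 \<in> sections01 A)"
  define iii where "iii = ((\<forall>\<omega>\<in>Omega A 1 0. dE_in A 1 \<omega> (form_sum (Omega A 2 0) (Omega A 1 1))) \<and>
             (\<forall>\<omega>\<in>Omega A 0 1. dE_in A 1 \<omega> (form_sum (Omega A 1 1) (Omega A 0 2))))"
  define iv where "iv = (\<forall>p q. \<forall>\<omega>\<in>Omega A p q.
             dE_in A (p + q) \<omega> (form_sum (Omega A (p + 1) q) (Omega A p (q + 1))))"
  define v where "v = (\<forall>s1\<in>sections A. \<forall>s2\<in>sections A. nijenhuis A s1 s2 = (\<lambda>x. 0))"
  have i: "i = closed_type True" and ii: "ii = closed_type False"
    by (simp_all add: i_def ii_def typed_sections_def)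
  have "i \<longleftrightarrow> ii"
    unfolding i ii using closed_type_conj[of True] closed_type_conj[of False] by auto
  moreover have "i \<longleftrightarrow> v"
    unfolding i v_def by (rule closed10_iff_nijenhuis)
  moreover have "iv" if "i" "ii"
    unfolding iv_def using dE_in_form_sum that[unfolded i ii] by blast
  moreover have "iii" if "iv"
    unfolding iii_def
    using that[unfolded iv_def, rule_format, of _ 1 0] that[unfolded iv_def, rule_format, of _ 0 1]
    by (simp add: numeral_2_eq_2)
  moreover have "i" if "iii"
    unfolding i using that[unfolded iii_def] by (intro closed10_if_dE) blast
  ultimately have "(i \<longleftrightarrow> ii) \<and> (i \<longleftrightarrow> iii) \<and> (i \<longleftrightarrow> iv) \<and> (i \<longleftrightarrow> v)"
    by blast
  then show ?thesis
    unfolding Let_def i_def ii_def iii_def iv_def v_def .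
qed

end
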